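(* Let $F$ be a finitely generated group that is virtually non-abelian free, and let $\Gamma$ and $\Gamma'$ be trees in $\mathscr{T}(F)$. There is a witness $g\in F$ (for the pair $\Gamma,\Gamma'$), the projection of whose axis into the quotient graph of groups $F\backslash\!\backslash\Gamma$ has one of the following forms. 1. An embedded simple loop. 2. An embedded figure-eight (a wedge of two circles). 3. An embedded barbell (two simple loops joined by a segment). 4. An embedded singly degenerate barbell (a non-free vertex and a simple loop joined by a segment). 5. An embedded doubly degenerate barbell (two non-free vertices joined by a segment).
   Context: Let $F$ be a finitely generated virtually non-abelian free group. $\mathscr{T}(F)$ is the set of minimal isometric actions of $F$ on simplicial $\mathbb{R}$-trees $\Gamma$ with all stabilizers finite, up to $F$-equivariant isometry. For $\Gamma,\Gamma'\in\mathscr{T}(F)$, $\mathrm{Lip}(\Gamma,\Gamma')$ is the infimum of the Lipschitz constants of $F$-equivariant Lipschitz maps $\Gamma\to\Gamma'$. For $g\in F$, $\|g\|_\Gamma$ is the translation length of $g$ on $\Gamma$. A witness is an element $g\in F$ acting hyperbolically on $\Gamma$ with $\mathrm{Lip}(\Gamma,\Gamma')=\|g\|_{\Gamma'}/\|g\|_{\Gamma}$. After subdividing at midpoints of inverted edges, $F$ acts on $\Gamma$ without inversions, and $F\backslash\!\backslash\Gamma$ denotes the quotient graph of groups in the sense of Bass–Serre theory: its underlying graph is $F\backslash\Gamma$, and its vertex and edge groups are stabilizers of lifts. A vertex is non-free if its vertex group is nontrivial. If $g$ is hyperbolic on $\Gamma$, projecting its axis and dividing by the action of $g$ gives a cyclically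 reduced closed graph-of-groups edge path $\gamma=g_0e_1g_1\cdots e_kg_k$ in $F\backslash\!\backslash\Gamma$ (the $e_i$ are oriented edges, the $g_i$ vertex group elements), well defined up to the usual equivalence and cyclic reordering. The listed forms refer to this cyclic path. A simple loop is a closed edge path in $F\backslash\Gamma$ visiting no vertex twice (other than its coinciding endpoints), and a segment $\sigma$ is an edge path with all vertices distinct. Suppressing vertex group elements at vertices where no backtracking occurs: (1) $\gamma$ runs once around a simple loop. (2) $\gamma$ runs once around each of two simple loops meeting in exactly one vertex. (3) $\gamma=\alpha\sigma\beta\bar\sigma$, where $\alpha,\beta$ are disjoint simple loops and $\sigma$ is a segment from $\alpha$ to $\beta$ meeting the loops only in its endpoints. (4) $\gamma=\alpha\sigma h\bar\sigma$, where $\alpha$ is a simple loop, $\sigma$ is a segment meeting $\alpha$ only in its initial endpoint and ending at a non-free vertex $v$, and $h$ is an element of the vertex group of $v$. (5) $\gamma=\sigma h\bar\sigma h'$, where $\sigma$ is a segment joining two non-free vertices, and $h,h'$ are elements of the vertex groups at its terminal and initial endpoints respectively. *)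

theory Defs
  imports "HOL-Analysis.Analysis" "HOL-Algebra.Group_Action" "HOL-Algebra.Generated_Groups"
begin

section \<open>Finitely generated, virtually non-abelian free groups\<close>

definition finitely_generated_group :: "('g, 'm) monoid_scheme \<Rightarrow> bool" where
  "finitely_generated_group G \<longleftrightarrow>
     (\<exists>A. finite A \<and> A \<subseteq> carrier G \<and> generate G A = carrier G)"

text \<open>The letter \<open>(x, True)\<close> stands for \<open>x\<close> and \<open>(x, False)\<close> for its formal inverse.\<close>

definition reduced_words :: "'g set \<Rightarrow> ('g \<times> bool) list set" where
  "reduced_words X = {w. fst ` set w \<subseteq> X \<and>
     successively (\<lambda>a b. \<not> (fst a = fst b \<and> snd a \<noteq> snd b)) w}"

fun word_value :: "('g, 'm) monoid_scheme \<Rightarrow> ('g \<times> bool) list \<Rightarrow> 'g" where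
  "word_value G [] = \<one>\<^bsub>G\<^esub>"
| "word_value G ((x, b) # w) = (if b then x else inv\<^bsub>G\<^esub> x) \<otimes>\<^bsub>G\<^esub> word_value G w"

text \<open>\<open>G\<close> is free on \<open>X\<close> iff the canonical map to \<open>G\<close> from the free group on \<open>X\<close>,
  that is from the set of reduced words, is a bijection.\<close>

definition free_group :: "('g, 'm) monoid_scheme \<Rightarrow> bool" where
  "free_group G \<longleftrightarrow> group G \<and>
     (\<exists>X \<subseteq> carrier G. bij_betw (word_value G) (reduced_words X) (carrier G))"

definition virtually_nonabelian_free :: "('g, 'm) monoid_scheme \<Rightarrow> bool" where
  "virtually_nonabelian_free F \<longleftrightarrow>
     (\<exists>H. subgroup H F \<and> finite (rcosets\<^bsub>F\<^esub> H) \<and>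
          free_group (F\<lparr>carrier := H\<rparr>) \<and> \<not> comm_group (F\<lparr>carrier := H\<rparr>))"


section \<open>Simplicial real trees\<close>

definition geodesic_segment :: "'p metric \<Rightarrow> 'p \<Rightarrow> 'p \<Rightarrow> 'p set \<Rightarrow> bool" where
  "geodesic_segment \<Gamma> x y S \<longleftrightarrow> S \<subseteq> mspace \<Gamma> \<and>
     (\<exists>c. c 0 = x \<and> c (mdist \<Gamma> x y) = y \<and> c ` {0..mdist \<Gamma> x y} = S \<and>
          (\<forall>s\<in>{0..mdist \<Gamma> x y}. \<forall>t\<in>{0..mdist \<Gamma> x y}. mdist \<Gamma> (c s) (c t) = \<bar>s - t\<bar>))"

definition real_tree :: "'p metric \<Rightarrow> bool" where
  "real_tree \<Gamma> \<longleftrightarrow>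
     (\<forall>x\<in>mspace \<Gamma>. \<forall>y\<in>mspace \<Gamma>. \<exists>!S. geodesic_segment \<Gamma> x y S) \<and>
     (\<forall>x\<in>mspace \<Gamma>. \<forall>y\<in>mspace \<Gamma>. \<forall>z\<in>mspace \<Gamma>. \<forall>S T.
        geodesic_segment \<Gamma> y x S \<and> geodesic_segment \<Gamma> x z T \<and> S \<inter> T = {x}
        \<longrightarrow> geodesic_segment \<Gamma> y z (S \<union> T))"

definition seg :: "'p metric \<Rightarrow> 'p \<Rightarrow> 'p \<Rightarrow> 'p set" where
  "seg \<Gamma> x y = (THE S. geodesic_segment \<Gamma> x y S)"

text \<open>The oriented edges of the simplicial structure with vertex set \<open>V\<close>, each given by its
  initial and terminal vertex; in a tree an edge is determined by these.\<close>

definition tree_edges :: "'p metric \<Rightarrow> 'p set \<Rightarrow> ('p \<times> 'p) set" where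
  "tree_edges \<Gamma> V = {(x, y). x \<in> V \<and> y \<in> V \<and> x \<noteq> y \<and> seg \<Gamma> x y \<inter> V = {x, y}}"

text \<open>The following says that a real tree \<open>\<Gamma>\<close> is the geometric realization, with its path metric,
  of a simplicial tree with vertex set \<open>V\<close> and edges of positive length.\<close>

definition simplicial_structure :: "'p metric \<Rightarrow> 'p set \<Rightarrow> bool" where
  "simplicial_structure \<Gamma> V \<longleftrightarrow> V \<subseteq> mspace \<Gamma> \<and>
     (\<forall>x\<in>V. \<forall>y\<in>V. finite (V \<inter> seg \<Gamma> x y)) \<and>
     mspace \<Gamma> = V \<union> (\<Union>(x, y)\<in>tree_edges \<Gamma> V. seg \<Gamma> x y) \<and>
     (\<forall>(x, y)\<in>tree_edges \<Gamma> V. \<forall>(u, v)\<in>tree_edges \<Gamma> V.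
        {x, y} \<noteq> {u, v} \<longrightarrow> seg \<Gamma> x y \<inter> seg \<Gamma> u v \<subseteq> V)"


section \<open>Actions on trees\<close>

definition minimal_action :: "('g, 'm) monoid_scheme \<Rightarrow> 'p metric \<Rightarrow> ('g \<Rightarrow> 'p \<Rightarrow> 'p) \<Rightarrow> bool" where
  "minimal_action F \<Gamma> \<phi> \<longleftrightarrow>
     (\<forall>N \<subseteq> mspace \<Gamma>. N \<noteq> {} \<and> (\<forall>x\<in>N. \<forall>y\<in>N. seg \<Gamma> x y \<subseteq> N) \<and>
        (\<forall>g\<in>carrier F. \<phi> g ` N \<subseteq> N) \<longrightarrow> N = mspace \<Gamma>)"

text \<open>\<open>outer_space F \<Gamma> V \<phi>\<close>: the tree \<open>\<Gamma>\<close> with simplicial structure \<open>V\<close> and action \<open>\<phi>\<close>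
  represents a point of \<open>\<T>(F)\<close>. Inversions of edges are allowed.\<close>

definition outer_space ::
    "('g, 'm) monoid_scheme \<Rightarrow> 'p metric \<Rightarrow> 'p set \<Rightarrow> ('g \<Rightarrow> 'p \<Rightarrow> 'p) \<Rightarrow> bool" where
  "outer_space F \<Gamma> V \<phi> \<longleftrightarrow>
     mspace \<Gamma> \<noteq> {} \<and> real_tree \<Gamma> \<and> simplicial_structure \<Gamma> V \<and>
     group_action F (mspace \<Gamma>) \<phi> \<and>
     (\<forall>g\<in>carrier F. \<forall>x\<in>mspace \<Gamma>. \<forall>y\<in>mspace \<Gamma>. mdist \<Gamma> (\<phi> g x) (\<phi> g y) = mdist \<Gamma> x y) \<and>
     (\<forall>g\<in>carrier F. \<phi> g ` V = V) \<and>
     minimal_action F \<Gamma> \<phi> \<and>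
     (\<forall>x\<in>mspace \<Gamma>. finite (stabilizer F \<phi> x))"

text \<open>Adding the midpoints of inverted edges to the vertex set.\<close>

definition subdivision ::
    "('g, 'm) monoid_scheme \<Rightarrow> 'p metric \<Rightarrow> ('g \<Rightarrow> 'p \<Rightarrow> 'p) \<Rightarrow> 'p set \<Rightarrow> 'p set" where
  "subdivision F \<Gamma> \<phi> V = V \<union>
     {m. \<exists>(x, y)\<in>tree_edges \<Gamma> V. (\<exists>g\<in>carrier F. \<phi> g x = y \<and> \<phi> g y = x) \<and>
           m \<in> seg \<Gamma> x y \<and> mdist \<Gamma> x m = mdist \<Gamma> m y}"

definition translation_length :: "'p metric \<Rightarrow> ('g \<Rightarrow> 'p \<Rightarrow> 'p) \<Rightarrow> 'g \<Rightarrow> real" where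
  "translation_length \<Gamma> \<phi> g = (INF x\<in>mspace \<Gamma>. mdist \<Gamma> x (\<phi> g x))"

definition hyperbolic :: "'p metric \<Rightarrow> ('g \<Rightarrow> 'p \<Rightarrow> 'p) \<Rightarrow> 'g \<Rightarrow> bool" where
  "hyperbolic \<Gamma> \<phi> g \<longleftrightarrow> translation_length \<Gamma> \<phi> g > 0"

definition axis :: "'p metric \<Rightarrow> ('g \<Rightarrow> 'p \<Rightarrow> 'p) \<Rightarrow> 'g \<Rightarrow> 'p set" where
  "axis \<Gamma> \<phi> g = {x \<in> mspace \<Gamma>. mdist \<Gamma> x (\<phi> g x) = translation_length \<Gamma> \<phi> g}"

definition Lip :: "('g, 'm) monoid_scheme \<Rightarrow> 'p metric \<Rightarrow> ('g \<Rightarrow> 'p \<Rightarrow> 'p) \<Rightarrow>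
    'q metric \<Rightarrow> ('g \<Rightarrow> 'q \<Rightarrow> 'q) \<Rightarrow> real" where
  "Lip F \<Gamma> \<phi> \<Gamma>' \<phi>' = Inf {L. 0 \<le> L \<and>
     (\<exists>f \<in> mspace \<Gamma> \<rightarrow> mspace \<Gamma>'.
        (\<forall>g\<in>carrier F. \<forall>x\<in>mspace \<Gamma>. f (\<phi> g x) = \<phi>' g (f x)) \<and>
        (\<forall>x\<in>mspace \<Gamma>. \<forall>y\<in>mspace \<Gamma>. mdist \<Gamma>' (f x) (f y) \<le> L * mdist \<Gamma> x y))}"

definition witness :: "('g, 'm) monoid_scheme \<Rightarrow> 'p metric \<Rightarrow> ('g \<Rightarrow> 'p \<Rightarrow> 'p) \<Rightarrow>
    'q metric \<Rightarrow> ('g \<Rightarrow> 'q \<Rightarrow> 'q) \<Rightarrow> 'g \<Rightarrow> bool" where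
  "witness F \<Gamma> \<phi> \<Gamma>' \<phi>' g \<longleftrightarrow> g \<in> carrier F \<and> hyperbolic \<Gamma> \<phi> g \<and>
     Lip F \<Gamma> \<phi> \<Gamma>' \<phi>' = translation_length \<Gamma>' \<phi>' g / translation_length \<Gamma> \<phi> g"


section \<open>Graphs of groups\<close>

text \<open>Graphs in the sense of Serre: \<open>edges\<close> are oriented, \<open>bar\<close> reverses orientation.
  \<open>emb Q e\<close> embeds the group of \<open>e\<close> into that of the terminal vertex of \<open>e\<close>.\<close>

record ('v, 'e, 'g) graph_of_groups =
  verts :: "'v set"
  edges :: "'e set"
  ini :: "'e \<Rightarrow> 'v"
  bar :: "'e \<Rightarrow> 'e"
  vgrp :: "'v \<Rightarrow> 'g monoid"
  egrp :: "'e \<Rightarrow> 'g monoid"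
  emb :: "'e \<Rightarrow> 'g \<Rightarrow> 'g"

definition ter :: "('v, 'e, 'g) graph_of_groups \<Rightarrow> 'e \<Rightarrow> 'v" where
  "ter Q e = ini Q (bar Q e)"

definition non_free :: "('v, 'e, 'g) graph_of_groups \<Rightarrow> 'v \<Rightarrow> bool" where
  "non_free Q v \<longleftrightarrow> v \<in> verts Q \<and> carrier (vgrp Q v) \<noteq> {\<one>\<^bsub>vgrp Q v\<^esub>}"

text \<open>The list \<open>[(e\<^sub>1, g\<^sub>1), \<dots>, (e\<^sub>k, g\<^sub>k)]\<close> is the cyclic word \<open>e\<^sub>1 g\<^sub>1 \<dots> e\<^sub>k g\<^sub>k\<close>. Up to cyclic
  reordering, a closed path \<open>g\<^sub>0 e\<^sub>1 g\<^sub>1 \<dots> e\<^sub>k g\<^sub>k\<close> is of this shape, with \<open>g\<^sub>k g\<^sub>0\<close> in place of \<open>g\<^sub>k\<close>;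
  cyclic reordering of such lists is \<^const>\<open>rotate\<close>.\<close>

definition cyclic_path :: "('v, 'e, 'g) graph_of_groups \<Rightarrow> ('e \<times> 'g) list \<Rightarrow> bool" where
  "cyclic_path Q p \<longleftrightarrow> p \<noteq> [] \<and>
     (\<forall>(e, g)\<in>set p. e \<in> edges Q \<and> g \<in> carrier (vgrp Q (ter Q e))) \<and>
     (\<forall>i<length p. ter Q (fst (p ! i)) = ini Q (fst (p ! (Suc i mod length p))))"

definition cyclically_reduced :: "('v, 'e, 'g) graph_of_groups \<Rightarrow> ('e \<times> 'g) list \<Rightarrow> bool" where
  "cyclically_reduced Q p \<longleftrightarrow>
     (\<forall>i<length p. fst (p ! (Suc i mod length p)) = bar Q (fst (p ! i)) \<longrightarrow>
        snd (p ! i) \<notin> emb Q (fst (p ! i)) ` carrier (egrp Q (fst (p ! i))))"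


section \<open>The quotient graph of groups\<close>

definition quotient_edges ::
    "('g, 'm) monoid_scheme \<Rightarrow> 'p metric \<Rightarrow> ('g \<Rightarrow> 'p \<Rightarrow> 'p) \<Rightarrow> 'p set \<Rightarrow> ('p \<times> 'p) set set" where
  "quotient_edges F \<Gamma> \<phi> V = orbits F (tree_edges \<Gamma> V) (\<lambda>g. map_prod (\<phi> g) (\<phi> g))"

text \<open>The choices entering the construction of the quotient graph of groups for an action without
  inversions: a lift \<open>s v\<close> of every vertex, a lift \<open>l e\<close> of every edge, the same up to orientation
  for \<open>e\<close> and its reverse, and an element \<open>c e\<close> taking the lift of the terminal vertex of \<open>e\<close> to
  the terminal vertex of the lift of \<open>e\<close>. If \<open>e\<close> is an orbit of oriented edges, then \<open>fst ` e\<close> and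
  \<open>snd ` e\<close> are the orbits of their initial and terminal vertices.\<close>

definition quotient_lifts :: "('g, 'm) monoid_scheme \<Rightarrow> 'p metric \<Rightarrow> ('g \<Rightarrow> 'p \<Rightarrow> 'p) \<Rightarrow> 'p set \<Rightarrow>
    ('p set \<Rightarrow> 'p) \<Rightarrow> (('p \<times> 'p) set \<Rightarrow> 'p \<times> 'p) \<Rightarrow> (('p \<times> 'p) set \<Rightarrow> 'g) \<Rightarrow> bool" where
  "quotient_lifts F \<Gamma> \<phi> V s l c \<longleftrightarrow>
     (\<forall>v \<in> orbits F V \<phi>. s v \<in> v) \<and>
     (\<forall>e \<in> quotient_edges F \<Gamma> \<phi> V.
        l e \<in> e \<and> l (prod.swap ` e) = prod.swap (l e) \<and>
        c e \<in> carrier F \<and> \<phi> (c e) (s (snd ` e)) = snd (l e))"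

definition quotient_graph_of_groups ::
    "'g monoid \<Rightarrow> 'p metric \<Rightarrow> ('g \<Rightarrow> 'p \<Rightarrow> 'p) \<Rightarrow> 'p set \<Rightarrow>
     ('p set \<Rightarrow> 'p) \<Rightarrow> (('p \<times> 'p) set \<Rightarrow> 'p \<times> 'p) \<Rightarrow> (('p \<times> 'p) set \<Rightarrow> 'g) \<Rightarrow>
     ('p set, ('p \<times> 'p) set, 'g) graph_of_groups" where
  "quotient_graph_of_groups F \<Gamma> \<phi> V s l c =
     \<lparr> verts = orbits F V \<phi>,
       edges = quotient_edges F \<Gamma> \<phi> V,
       ini = (\<lambda>e. fst ` e),
       bar = (\<lambda>e. prod.swap ` e),
       vgrp = (\<lambda>v. F\<lparr>carrier := stabilizer F \<phi> (s v)\<rparr>),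
       egrp = (\<lambda>e. F\<lparr>carrier := stabilizer F \<phi> (fst (l e)) \<inter> stabilizer F \<phi> (snd (l e))\<rparr>),
       emb = (\<lambda>e x. inv\<^bsub>F\<^esub> (c e) \<otimes>\<^bsub>F\<^esub> x \<otimes>\<^bsub>F\<^esub> c e) \<rparr>"

text \<open>The element of \<open>F\<close> attached to an edge \<open>e\<close> by Bass--Serre theory: the edge
  \<open>inv (c (bar e)) \<cdot> l e\<close> of the tree goes from \<open>s (ini e)\<close> to \<open>edge_elem e \<cdot> s (ter e)\<close>.\<close>

definition edge_elem ::
    "('g, 'm) monoid_scheme \<Rightarrow> (('p \<times> 'p) set \<Rightarrow> 'g) \<Rightarrow> ('p \<times> 'p) set \<Rightarrow> 'g" where
  "edge_elem F c e = inv\<^bsub>F\<^esub> (c (prod.swap ` e)) \<otimes>\<^bsub>F\<^esub> c e"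

fun path_elem ::
    "('g, 'm) monoid_scheme \<Rightarrow> (('p \<times> 'p) set \<Rightarrow> 'g) \<Rightarrow> (('p \<times> 'p) set \<times> 'g) list \<Rightarrow> 'g" where
  "path_elem F c [] = \<one>\<^bsub>F\<^esub>"
| "path_elem F c ((e, h) # p) = edge_elem F c e \<otimes>\<^bsub>F\<^esub> h \<otimes>\<^bsub>F\<^esub> path_elem F c p"

text \<open>The sequence of oriented edges of the tree obtained by lifting a path in the quotient graph of
  groups, starting at the translate by \<open>a\<close> of the chosen lift of its initial vertex.\<close>

fun path_lift ::
    "('g, 'm) monoid_scheme \<Rightarrow> ('g \<Rightarrow> 'p \<Rightarrow> 'p) \<Rightarrow> (('p \<times> 'p) set \<Rightarrow> 'p \<times> 'p) \<Rightarrow>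
     (('p \<times> 'p) set \<Rightarrow> 'g) \<Rightarrow> 'g \<Rightarrow> (('p \<times> 'p) set \<times> 'g) list \<Rightarrow> ('p \<times> 'p) list" where
  "path_lift F \<phi> l c a [] = []"
| "path_lift F \<phi> l c a ((e, h) # p) =
     (let b = a \<otimes>\<^bsub>F\<^esub> inv\<^bsub>F\<^esub> (c (prod.swap ` e)) in map_prod (\<phi> b) (\<phi> b) (l e)) #
     path_lift F \<phi> l c (a \<otimes>\<^bsub>F\<^esub> edge_elem F c e \<otimes>\<^bsub>F\<^esub> h) p"

text \<open>\<open>p\<close> is a projection of the axis of \<open>g\<close> divided by the action of \<open>g\<close>: the lift of \<open>p\<close> at some
  \<open>a\<close> runs through the edges of the fundamental domain \<open>[x, g x]\<close> of the axis in their order, where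
  \<open>x\<close> is a vertex on the axis, and \<open>p\<close> represents the element \<open>inv a \<otimes> g \<otimes> a\<close>.\<close>

definition projects_axis :: "'g monoid \<Rightarrow> 'p metric \<Rightarrow> ('g \<Rightarrow> 'p \<Rightarrow> 'p) \<Rightarrow> 'p set \<Rightarrow>
    ('p set \<Rightarrow> 'p) \<Rightarrow> (('p \<times> 'p) set \<Rightarrow> 'p \<times> 'p) \<Rightarrow> (('p \<times> 'p) set \<Rightarrow> 'g) \<Rightarrow>
    'g \<Rightarrow> (('p \<times> 'p) set \<times> 'g) list \<Rightarrow> bool" where
  "projects_axis F \<Gamma> \<phi> V s l c g p \<longleftrightarrow>
     cyclic_path (quotient_graph_of_groups F \<Gamma> \<phi> V s l c) p \<and>
     cyclically_reduced (quotient_graph_of_groups F \<Gamma> \<phi> V s l c) p \<and>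
     (\<exists>a\<in>carrier F.
        a \<otimes>\<^bsub>F\<^esub> path_elem F c p = g \<otimes>\<^bsub>F\<^esub> a \<and>
        (let es = path_lift F \<phi> l c a p; x = fst (hd es); xs = map fst es @ [\<phi> g x] in
           x \<in> axis \<Gamma> \<phi> g \<and>
           set xs = seg \<Gamma> x (\<phi> g x) \<inter> V \<and>
           sorted_wrt (\<lambda>y z. mdist \<Gamma> x y < mdist \<Gamma> x z) xs))"


section \<open>The forms of a cyclic path\<close>

definition edge_path :: "('v, 'e, 'g) graph_of_groups \<Rightarrow> 'e list \<Rightarrow> bool" where
  "edge_path Q \<alpha> \<longleftrightarrow> \<alpha> \<noteq> [] \<and> set \<alpha> \<subseteq> edges Q \<and> successively (\<lambda>e f. ter Q e = ini Q f) \<alpha>"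

definition start :: "('v, 'e, 'g) graph_of_groups \<Rightarrow> 'e list \<Rightarrow> 'v" where
  "start Q \<alpha> = ini Q (hd \<alpha>)"

definition finish :: "('v, 'e, 'g) graph_of_groups \<Rightarrow> 'e list \<Rightarrow> 'v" where
  "finish Q \<alpha> = ter Q (last \<alpha>)"

definition path_verts :: "('v, 'e, 'g) graph_of_groups \<Rightarrow> 'e list \<Rightarrow> 'v set" where
  "path_verts Q \<alpha> = ini Q ` set \<alpha> \<union> ter Q ` set \<alpha>"

definition rev_path :: "('v, 'e, 'g) graph_of_groups \<Rightarrow> 'e list \<Rightarrow> 'e list" where
  "rev_path Q \<alpha> = rev (map (bar Q) \<alpha>)"

text \<open>Without the last clause, going back and forth along an edge would be a simple loop.\<close>

definition simple_loop :: "('v, 'e, 'g) graph_of_groups \<Rightarrow> 'e list \<Rightarrow> bool" where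
  "simple_loop Q \<alpha> \<longleftrightarrow> edge_path Q \<alpha> \<and> finish Q \<alpha> = start Q \<alpha> \<and>
     distinct (map (ini Q) \<alpha>) \<and> set \<alpha> \<inter> bar Q ` set \<alpha> = {}"

definition segment :: "('v, 'e, 'g) graph_of_groups \<Rightarrow> 'e list \<Rightarrow> bool" where
  "segment Q \<sigma> \<longleftrightarrow> edge_path Q \<sigma> \<and> distinct (map (ini Q) \<sigma> @ [finish Q \<sigma>])"

definition loop_form :: "('v, 'e, 'g) graph_of_groups \<Rightarrow> ('e \<times> 'g) list \<Rightarrow> bool" where
  "loop_form Q p \<longleftrightarrow> simple_loop Q (map fst p)"

text \<open>The edges of the two loops have to be disjoint as well: two copies of a loop with a single
  vertex also meet in exactly one vertex.\<close>

definition figure_eight_form :: "('v, 'e, 'g) graph_of_groups \<Rightarrow> ('e \<times> 'g) list \<Rightarrow> bool" where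
  "figure_eight_form Q p \<longleftrightarrow> (\<exists>\<alpha> \<beta>. map fst p = \<alpha> @ \<beta> \<and>
     simple_loop Q \<alpha> \<and> simple_loop Q \<beta> \<and> start Q \<alpha> = start Q \<beta> \<and>
     path_verts Q \<alpha> \<inter> path_verts Q \<beta> = {start Q \<alpha>} \<and>
     set \<alpha> \<inter> (set \<beta> \<union> bar Q ` set \<beta>) = {})"

definition barbell_form :: "('v, 'e, 'g) graph_of_groups \<Rightarrow> ('e \<times> 'g) list \<Rightarrow> bool" where
  "barbell_form Q p \<longleftrightarrow> (\<exists>\<alpha> \<sigma> \<beta>. map fst p = \<alpha> @ \<sigma> @ \<beta> @ rev_path Q \<sigma> \<and>
     simple_loop Q \<alpha> \<and> simple_loop Q \<beta> \<and> segment Q \<sigma> \<and>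
     start Q \<sigma> = start Q \<alpha> \<and> finish Q \<sigma> = start Q \<beta> \<and>
     path_verts Q \<alpha> \<inter> path_verts Q \<beta> = {} \<and>
     path_verts Q \<sigma> \<inter> path_verts Q \<alpha> = {start Q \<sigma>} \<and>
     path_verts Q \<sigma> \<inter> path_verts Q \<beta> = {finish Q \<sigma>})"

text \<open>In the last two forms the elements \<open>h\<close> and \<open>h'\<close> are those following the last edge of the
  segment and of its reverse, respectively. Cyclic reducedness says that they do not
  come from the adjacent edge group.\<close>

definition singly_degenerate_barbell_form ::
    "('v, 'e, 'g) graph_of_groups \<Rightarrow> ('e \<times> 'g) list \<Rightarrow> bool" where
  "singly_degenerate_barbell_form Q p \<longleftrightarrow> (\<exists>\<alpha> \<sigma> q r t h.
     p = q @ r @ t \<and> map fst q = \<alpha> \<and> map fst r = \<sigma> \<and> map fst t = rev_path Q \<sigma> \<and>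
     simple_loop Q \<alpha> \<and> segment Q \<sigma> \<and> start Q \<sigma> = start Q \<alpha> \<and>
     path_verts Q \<sigma> \<inter> path_verts Q \<alpha> = {start Q \<sigma>} \<and>
     non_free Q (finish Q \<sigma>) \<and> h = snd (last r) \<and> h \<in> carrier (vgrp Q (finish Q \<sigma>)))"

definition doubly_degenerate_barbell_form ::
    "('v, 'e, 'g) graph_of_groups \<Rightarrow> ('e \<times> 'g) list \<Rightarrow> bool" where
  "doubly_degenerate_barbell_form Q p \<longleftrightarrow> (\<exists>\<sigma> r t h h'.
     p = r @ t \<and> map fst r = \<sigma> \<and> map fst t = rev_path Q \<sigma> \<and> segment Q \<sigma> \<and>
     non_free Q (start Q \<sigma>) \<and> non_free Q (finish Q \<sigma>) \<and>
     h = snd (last r) \<and> h \<in> carrier (vgrp Q (finish Q \<sigma>)) \<and>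
     h' = snd (last t) \<and> h' \<in> carrier (vgrp Q (start Q \<sigma>)))"

definition candidate_form :: "('v, 'e, 'g) graph_of_groups \<Rightarrow> ('e \<times> 'g) list \<Rightarrow> bool" where
  "candidate_form Q p \<longleftrightarrow> (\<exists>n.
     loop_form Q (rotate n p) \<or>
     figure_eight_form Q (rotate n p) \<or>
     barbell_form Q (rotate n p) \<or>
     singly_degenerate_barbell_form Q (rotate n p) \<or>
     doubly_degenerate_barbell_form Q (rotate n p))"

end

(* Among the equivariant maps \<Gamma> -> \<Gamma>' that are affine on edges, choose one with the least Lipschitz
   constant \<Lambda> and, subject to this, with the fewest orbits of edges stretched by \<Lambda> ("tension edges").
   Then at every vertex the tension edges leave in at least two directions of \<Gamma>', for otherwise
   moving the image of the vertex would relax them. A path of tension edges is legal if its turns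
   are not folded; its image is then a geodesic, so that an element translating along a legal line
   in \<Gamma> is a witness. Whether a turn can be made legal, by a choice of vertex group element, depends
   only on the two edges of the quotient, and a shortest legal cyclic path in the quotient visits
   no vertex three times and has no interleaved pair of double points; this forces one of the five
   forms. *)
theory Submission
  imports Defs
begin

section \<open>Real trees\<close>

text \<open>Maps are handled through their values on vertices. A priori the infimum
  \<open>\<Lambda>\<close> over such maps need not be \<open>Lip\<close>; the two are identified
  only at the end, because the ratio of translation lengths of an element bounds every Lipschitz
  constant from below and the affine extension attains \<open>\<Lambda>\<close>. The analytic
  obstacle is the existence of a minimizer, since a minimizing sequence may run off to infinity in
  the target. Finite generation and minimality make the actions cocompact, and finite stabilizers
  make the trees locally finite, so bounded sequences have limits; what remains is to bring the
  sequence back without losing equivariance. In the quotient, the relation \<open>N\<close> between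
  outgoing edges (no choice of lifts opens the turn) is symmetric and transitive, but not reflexive:
  \<open>N e e\<close> fails when two lifts of \<open>e\<close> at one vertex are sent in different
  directions. A path may then arrive along the reverse of \<open>e\<close> and turn back through a
  vertex group element. Such turns become the degenerate ends of barbells, so the surgery on
  shortest words must never assume reflexivity.\<close>

locale rtree =
  fixes M :: "'p metric"
  assumes real_tree: "real_tree M"
begin

abbreviation d where "d \<equiv> mdist M"
abbreviation X where "X \<equiv> mspace M"
abbreviation sg where "sg \<equiv> seg M"

lemma d_triangle: "x \<in> X \<Longrightarrow> y \<in> X \<Longrightarrow> z \<in> X \<Longrightarrow> d x z \<le> d x y + d y z"
  by (rule mdist_triangle)

lemma d_self [simp]: "x \<in> X \<Longrightarrow> d x x = 0"
  by simp

lemma d_comm: "d x y = d y x"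
  by (rule mdist_commute)

lemma d_pos: "x \<in> X \<Longrightarrow> y \<in> X \<Longrightarrow> x \<noteq> y \<Longrightarrow> d x y > 0"
  by (metis mdist_nonneg mdist_zero order_le_less)

lemma geodesic_seg:
  assumes "x \<in> X" "y \<in> X"
  shows "geodesic_segment M x y (sg x y)"
  using real_tree assms unfolding real_tree_def seg_def by (metis theI')

lemma geodesic_unique:
  assumes "x \<in> X" "y \<in> X" "geodesic_segment M x y S"
  shows "S = sg x y"
  using real_tree assms geodesic_seg unfolding real_tree_def by metis

lemma seg_param:
  assumes "x \<in> X" "y \<in> X"
  obtains c where "c 0 = x" "c (d x y) = y" "c ` {0..d x y} = sg x y"
    "\<And>s t. \<lbrakk>0 \<le> s; s \<le> d x y; 0 \<le> t; t \<le> d x y\<rbrakk> \<Longrightarrow> d (c s) (c t) = \<bar>s - t\<bar>"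
  using geodesic_seg[OF assms] unfolding geodesic_segment_def by (auto simp: Ball_def)

lemma seg_subset: "x \<in> X \<Longrightarrow> y \<in> X \<Longrightarrow> sg x y \<subseteq> X"
  using geodesic_seg unfolding geodesic_segment_def by metis

lemma seg_dist_add:
  assumes "x \<in> X" "y \<in> X" "z \<in> sg x y"
  shows "d x z + d z y = d x y"
proof -
  obtain c where c: "c 0 = x" "c (d x y) = y" "c ` {0..d x y} = sg x y"
    "\<And>s t. \<lbrakk>0 \<le> s; s \<le> d x y; 0 \<le> t; t \<le> d x y\<rbrakk> \<Longrightarrow> d (c s) (c t) = \<bar>s - t\<bar>"
    by (rule seg_param[OF assms(1,2)]) (rule that)
  obtain t where t: "0 \<le> t" "t \<le> d x y" "z = c t"
    using c(3) assms(3) by fastforce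
  have "d x z = t" "d z y = d x y - t"
    using c(4)[of 0 t] c(4)[of t "d x y"] c(1,2) t by auto
  then show ?thesis by simp
qed

text \<open>Geodesics from \<open>x\<close> to \<open>z\<close> and from \<open>z\<close> to
  \<open>y\<close> are run through one after the other. If two points were closer than the
  difference of their parameters, the triangle inequality would make \<open>d x y\<close> too small.
  So the concatenation is the geodesic from \<open>x\<close> to \<open>y\<close>, and it contains
  \<open>z\<close>.\<close>

lemma dist_add_seg:
  assumes "x \<in> X" "y \<in> X" "z \<in> X" "d x z + d z y = d x y"
  shows "z \<in> sg x y"
proof -
  obtain a where a: "a 0 = x" "a (d x z) = z" "a ` {0..d x z} = sg x z"
    "\<And>s t. \<lbrakk>0 \<le> s; s \<le> d x z; 0 \<le> t; t \<le> d x z\<rbrakk> \<Longrightarrow> d (a s) (a t) = \<bar>s - t\<bar>"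
    by (rule seg_param[OF assms(1,3)]) (rule that)
  obtain b where b: "b 0 = z" "b (d z y) = y" "b ` {0..d z y} = sg z y"
    "\<And>s t. \<lbrakk>0 \<le> s; s \<le> d z y; 0 \<le> t; t \<le> d z y\<rbrakk> \<Longrightarrow> d (b s) (b t) = \<bar>s - t\<bar>"
    by (rule seg_param[OF assms(3,2)]) (rule that)
  define c where "c t = (if t \<le> d x z then a t else b (t - d x z))" for t
  have cz: "c (d x z) = z" and c0: "c 0 = x" using a by (auto simp: c_def)
  have cy: "c (d x y) = y"
  proof (cases "z = y")
    case True
    then show ?thesis using cz by simp
  next
    case False
    then have "d x y > d x z" using d_pos[OF assms(3,2)] assms(4) by linarith
    then show ?thesis using b(2) by (auto simp: c_def simp flip: assms(4))
  qed
  have cX: "c t \<in> X" if "0 \<le> t" "t \<le> d x y" for t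
  proof (cases "t \<le> d x z")
    case True
    then have "c t \<in> sg x z" using a(3) that by (auto simp: c_def)
    then show ?thesis using seg_subset assms by blast
  next
    case False
    then have "c t \<in> sg z y" using b(3) that assms(4) by (auto simp: c_def)
    then show ?thesis using seg_subset assms by blast
  qed
  have iso1: "d (c s) (c t) = t - s" if "0 \<le> s" "s \<le> t" "t \<le> d x y" for s t
  proof -
    consider "t \<le> d x z" | "s > d x z" | "s \<le> d x z" "t > d x z" by linarith
    then show ?thesis
    proof cases
      case 1
      then show ?thesis using a(4)[of s t] that by (auto simp: c_def)
    next
      case 2
      then show ?thesis using b(4)[of "s - d x z" "t - d x z"] that assms(4) by (auto simp: c_def)
    next
      case 3
      have 1: "d x (c s) = s" "d (c s) z = d x z - s"
        using a(4)[of 0 s] a(4)[of s "d x z"] 3 that a by (auto simp: c_def)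
      have 2: "d z (c t) = t - d x z" "d (c t) y = d x y - t"
        using b(4)[of 0 "t - d x z"] b(4)[of "t - d x z" "d z y"] 3 that b assms(4)
        by (auto simp: c_def)
      have X: "c s \<in> X" "c t \<in> X" using cX that by auto
      have "d (c s) (c t) \<le> t - s" using d_triangle[OF X(1) assms(3) X(2)] 1 2 by simp
      moreover have "d x y \<le> d x (c s) + d (c s) (c t) + d (c t) y"
        using d_triangle[OF assms(1) X(1) assms(2)] d_triangle[OF X assms(2)] by simp
      ultimately show ?thesis using 1 2 by simp
    qed
  qed
  have "geodesic_segment M x y (c ` {0..d x y})"
    unfolding geodesic_segment_def
  proof (intro conjI exI[of _ c] ballI)
    fix s t assume st: "s \<in> {0..d x y}" "t \<in> {0..d x y}"
    show "d (c s) (c t) = \<bar>s - t\<bar>"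
    proof (cases "s \<le> t")
      case True then show ?thesis using iso1[of s t] st by auto
    next
      case False then show ?thesis using iso1[of t s] st d_comm[of "c s" "c t"] by auto
    qed
  qed (use cX c0 cy in auto)
  then have "c ` {0..d x y} = sg x y" using geodesic_unique assms by blast
  moreover have "d x z \<in> {0..d x y}" using assms(4) mdist_nonneg[of M z y] mdist_nonneg[of M x z] by (auto simp del: mdist_nonneg)
  ultimately show ?thesis using cz by (metis image_eqI)
qed

lemma in_seg:
  assumes "x \<in> X" "y \<in> X"
  shows "z \<in> sg x y \<longleftrightarrow> z \<in> X \<and> d x z + d z y = d x y"
  using assms seg_dist_add dist_add_seg seg_subset by blast

lemma seg_comm: "x \<in> X \<Longrightarrow> y \<in> X \<Longrightarrow> sg x y = sg y x"
  using in_seg d_comm by (auto simp: add.commute)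

lemma seg_ends [simp]: "x \<in> X \<Longrightarrow> y \<in> X \<Longrightarrow> x \<in> sg x y" "x \<in> X \<Longrightarrow> y \<in> X \<Longrightarrow> y \<in> sg x y"
  by (auto simp: in_seg)

lemma seg_refl [simp]: "x \<in> X \<Longrightarrow> sg x x = {x}"
proof -
  assume x: "x \<in> X"
  have "z = x" if "z \<in> sg x x" for z
    using that x in_seg d_pos[of x z] mdist_nonneg[of M z x] by (cases "z = x") auto
  then show "sg x x = {x}" using x by auto
qed

lemma seg_point:
  assumes "x \<in> X" "y \<in> X" "0 \<le> t" "t \<le> d x y"
  obtains p where "p \<in> sg x y" "d x p = t"
proof -
  obtain c where c: "c 0 = x" "c (d x y) = y" "c ` {0..d x y} = sg x y"
    "\<And>s t. \<lbrakk>0 \<le> s; s \<le> d x y; 0 \<le> t; t \<le> d x y\<rbrakk> \<Longrightarrow> d (c s) (c t) = \<bar>s - t\<bar>"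
    by (rule seg_param[OF assms(1,2)]) (rule that)
  show ?thesis
  proof (rule that)
    show "c t \<in> sg x y" using c(3) assms by auto
    show "d x (c t) = t" using c(1) c(4)[of 0 t] assms by auto
  qed
qed

lemma seg_dist:
  assumes "x \<in> X" "y \<in> X" "p \<in> sg x y" "q \<in> sg x y"
  shows "d p q = \<bar>d x p - d x q\<bar>"
proof -
  obtain c where c: "c 0 = x" "c (d x y) = y" "c ` {0..d x y} = sg x y"
    "\<And>s t. \<lbrakk>0 \<le> s; s \<le> d x y; 0 \<le> t; t \<le> d x y\<rbrakk> \<Longrightarrow> d (c s) (c t) = \<bar>s - t\<bar>"
    by (rule seg_param[OF assms(1,2)]) (rule that)
  obtain t where t: "0 \<le> t" "t \<le> d x y" "p = c t"
    using c(3) assms(3) by fastforce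
  obtain s where s: "0 \<le> s" "s \<le> d x y" "q = c s"
    using c(3) assms(4) by fastforce
  have "d x p = t" "d x q = s" using c(4)[of 0 t] c(4)[of 0 s] s t unfolding c(1) by simp_all
  then show ?thesis using c(4)[of t s] s t by simp
qed

lemma seg_eqI:
  assumes "x \<in> X" "y \<in> X" "p \<in> sg x y" "q \<in> sg x y" "d x p = d x q"
  shows "p = q"
proof -
  have "p \<in> X" "q \<in> X" using assms seg_subset by auto
  moreover have "d p q = 0" using seg_dist[OF assms(1-4)] assms(5) by simp
  ultimately show ?thesis by simp
qed

lemma seg_order:
  assumes "x \<in> X" "y \<in> X" "p \<in> sg x y" "q \<in> sg x y" "d x p \<le> d x q"
  shows "p \<in> sg x q" "q \<in> sg p y"
proof -
  have X: "p \<in> X" "q \<in> X" using assms seg_subset by auto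
  have "d p q = d x q - d x p" using seg_dist[OF assms(1-4)] assms(5) by simp
  then show "p \<in> sg x q" "q \<in> sg p y"
    using X assms in_seg[of x q] in_seg[of p y] in_seg[of x y] by auto
qed

lemma seg_mono:
  assumes "x \<in> X" "y \<in> X" "p \<in> sg x y" "q \<in> sg x y"
  shows "sg p q \<subseteq> sg x y"
proof -
  have X: "p \<in> X" "q \<in> X" using assms seg_subset by auto
  have *: "sg p q \<subseteq> sg x y" if pq: "p \<in> sg x y" "q \<in> sg x y" "d x p \<le> d x q" "p \<in> X" "q \<in> X" for p q
  proof
    fix z assume z: "z \<in> sg p q"
    have zX: "z \<in> X" using z that seg_subset by blast
    have "d p q = d x q - d x p" using seg_dist[OF assms(1,2) pq(1,2)] pq(3) by simp
    moreover have "d p z + d z q = d p q" using z that seg_dist_add by blast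
    moreover have "d x q + d q y = d x y" using that assms seg_dist_add by blast
    moreover have "d x z \<le> d x p + d p z" "d z y \<le> d z q + d q y" "d x y \<le> d x z + d z y"
      using d_triangle zX that assms by auto
    ultimately have "d x z + d z y = d x y" by linarith
    then show "z \<in> sg x y" using zX assms in_seg by blast
  qed
  show ?thesis
    using *[of p q] *[of q p] assms X seg_comm[of p q] by (metis linear)
qed

lemma glue:
  assumes "x \<in> X" "y \<in> X" "z \<in> X" "sg x y \<inter> sg x z = {x}"
  shows "x \<in> sg y z"
proof -
  have "sg y x \<inter> sg x z = {x}" using assms seg_comm by metis
  then have "geodesic_segment M y z (sg y x \<union> sg x z)"
    using real_tree assms geodesic_seg unfolding real_tree_def by meson
  then show ?thesis using geodesic_unique assms by fastforce
qed

text \<open>The two segments from \<open>x\<close> agree up to a last common point. Beyond it they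
  part, so \<open>glue\<close> puts this point on the third segment as well.\<close>

lemma median:
  assumes X: "x \<in> X" "y \<in> X" "z \<in> X"
  obtains m where "m \<in> sg x y" "m \<in> sg x z" "m \<in> sg y z"
proof -
  define T where "T = {d x p | p. p \<in> sg x y \<inter> sg x z}"
  have T0: "0 \<in> T" unfolding T_def using X by (auto intro!: exI[of _ x])
  have Tub: "t \<le> d x y \<and> t \<le> d x z" if tT: "t \<in> T" for t
  proof -
    obtain p where p: "t = d x p" "p \<in> sg x y" "p \<in> sg x z" using tT unfolding T_def by blast
    show ?thesis
      using seg_dist_add[OF X(1,2) p(2)] seg_dist_add[OF X(1,3) p(3)] p(1)
        mdist_nonneg[of M p y] mdist_nonneg[of M p z] by linarith
  qed
  have bdd: "bdd_above T" using Tub by (meson bdd_aboveI)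
  define u where "u = Sup T"
  have u0: "0 \<le> u" unfolding u_def using T0 bdd by (rule cSup_upper)
  have u1: "u \<le> d x y" "u \<le> d x z" unfolding u_def using T0 Tub by (auto intro!: cSup_least)
  obtain p where p: "p \<in> sg x y" "d x p = u" using seg_point X u0 u1 by metis
  obtain q where q: "q \<in> sg x z" "d x q = u" using seg_point X u0 u1 by metis
  have pq: "p \<in> X" "q \<in> X" using p q seg_subset X by auto
  \<comment> \<open>A shared point whose distance from \<open>x\<close> is almost \<open>u\<close>
    is close to both \<open>p\<close> and \<open>q\<close>; hence these are equal and the supremum
    is attained.\<close>
  have "d p q \<le> e" if e: "e > 0" for e
  proof -
    obtain t where t: "t \<in> T" "t > u - e / 2"
      using e less_cSup_iff[of T "u - e/2"] T0 bdd unfolding u_def by auto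
    have "t \<le> u" unfolding u_def using t bdd by (auto intro: cSup_upper)
    obtain r where r: "r \<in> sg x y" "r \<in> sg x z" "d x r = t" using t unfolding T_def by auto
    have "d p r \<le> e/2" "d q r \<le> e/2"
      using seg_dist[OF X(1,2) p(1) r(1)] seg_dist[OF X(1,3) q(1) r(2)] p q r t \<open>t \<le> u\<close> by auto
    moreover have "r \<in> X" using r seg_subset X by auto
    ultimately show "d p q \<le> e" using d_triangle[of p r q] d_comm[of q r] pq by auto
  qed
  then have "d p q \<le> 0" by (meson field_le_epsilon dense_ge)
  then have "p = q" using d_pos pq by force
  have "sg p y \<inter> sg p z = {p}"
  proof -
    have "r = p" if r: "r \<in> sg p y" "r \<in> sg p z" for r
    proof -
      have rs: "r \<in> sg x y" "r \<in> sg x z"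
        using r seg_mono[OF X(1,2) p(1), of y] seg_mono[OF X(1,3) q(1), of z] X \<open>p = q\<close> by auto
      then have "d x r \<in> T" unfolding T_def by auto
      then have "d x r \<le> u" unfolding u_def using bdd by (auto intro: cSup_upper)
      moreover have "d x r \<ge> u"
        using seg_dist_add[OF pq(1) X(2) r(1)] seg_dist_add[OF X(1,2) rs(1)]
          seg_dist_add[OF X(1,2) p(1)] mdist_nonneg[of M p r] p(2) by linarith
      ultimately show ?thesis using seg_eqI[OF X(1,2) rs(1) p(1)] p by simp
    qed
    then show ?thesis using X pq by auto
  qed
  then have "p \<in> sg y z" using glue pq X by blast
  then show ?thesis using that p q \<open>p = q\<close> by auto
qed

text \<open>The three sides form a tripod around the median: it cuts \<open>sg x z\<close> into two
  pieces, each of which is part of one of the other sides.\<close>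

lemma seg_triangle:
  assumes X: "x \<in> X" "y \<in> X" "z \<in> X"
  shows "sg x z \<subseteq> sg x y \<union> sg y z"
proof -
  obtain m where m: "m \<in> sg x y" "m \<in> sg x z" "m \<in> sg y z" using median X by metis
  have mX: "m \<in> X" using m seg_subset X by blast
  show ?thesis
  proof
    fix p assume p: "p \<in> sg x z"
    show "p \<in> sg x y \<union> sg y z"
    proof (cases "d x p \<le> d x m")
      case True
      then have "p \<in> sg x m" using seg_order(1)[OF X(1,3) p m(2)] by simp
      then show ?thesis using seg_mono[OF X(1,2) _ m(1), of x] X by auto
    next
      case False
      then have "p \<in> sg m z" using seg_order(2)[OF X(1,3) m(2) p] by simp
      then show ?thesis using seg_mono[OF X(2,3) m(3), of z] X by auto
    qed
  qed
qed

lemma seg_split: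
  assumes X: "x \<in> X" "y \<in> X" "z \<in> sg x y"
  shows "sg x y = sg x z \<union> sg z y"
  using seg_triangle[of x z y] seg_mono[OF X(1,2), of x z] seg_mono[OF X(1,2), of z y] X seg_subset
  by (metis (no_types, lifting) Un_least seg_ends(1,2) subset_antisym subset_iff)

lemma midpoint_unique:
  assumes X: "x \<in> X" "y \<in> X" and "m \<in> sg x y" "d x m = d m y" "n \<in> sg x y" "d x n = d n y"
  shows "m = n"
proof -
  have "d x m = d x n"
    using seg_dist_add[OF X assms(3)] seg_dist_add[OF X assms(5)] assms(4,6) by linarith
  then show ?thesis using seg_eqI[OF X] assms by blast
qed

text \<open>By induction \<open>x n\<close> lies on the way back from \<open>x (Suc n)\<close> to
  \<open>x 0\<close>. A point common to this way and the next segment is either no farther than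
  \<open>x n\<close>, hence on the last segment and excluded by \<open>turn\<close>, or beyond
  \<open>x n\<close>, and then \<open>x n\<close> itself is common, again against
  \<open>turn\<close>. Thus the local absence of backtracking makes the whole chain
  geodesic.\<close>

lemma chain_step:
  assumes X: "\<And>i. x i \<in> X" and ne: "\<And>i. x i \<noteq> x (Suc i)"
    and turn: "\<And>i. sg (x (Suc i)) (x i) \<inter> sg (x (Suc i)) (x (Suc (Suc i))) = {x (Suc i)}"
  shows "x n \<in> sg (x 0) (x (Suc n))"
proof (induction n)
  case 0
  then show ?case using X by auto
next
  case (Suc n)
  have "sg (x (Suc n)) (x 0) \<inter> sg (x (Suc n)) (x (Suc (Suc n))) = {x (Suc n)}"
  proof -
    have "p = x (Suc n)" if p: "p \<in> sg (x (Suc n)) (x 0)" "p \<in> sg (x (Suc n)) (x (Suc (Suc n)))" for p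
    proof -
      have n: "x n \<in> sg (x (Suc n)) (x 0)" using Suc X seg_comm by metis
      show ?thesis
      proof (cases "d (x (Suc n)) p \<le> d (x (Suc n)) (x n)")
        case True
        then have "p \<in> sg (x (Suc n)) (x n)" using seg_order(1) X p n by blast
        then show ?thesis using turn[of n] p by blast
      next
        case False
        then have "x n \<in> sg (x (Suc n)) p" using seg_order(1) X p n by (meson linear)
        then have "x n \<in> sg (x (Suc n)) (x (Suc (Suc n)))"
          using seg_mono X p seg_ends(1) by (meson subsetD)
        then have "x n = x (Suc n)" using turn[of n] X seg_ends(2) by blast
        then show ?thesis using ne by simp
      qed
    qed
    then show ?thesis using X by auto
  qed
  then show ?case using glue X seg_comm by metis
qed

lemma chain_geodesic:
  assumes X: "\<And>i. x i \<in> X" and ne: "\<And>i. x i \<noteq> x (Suc i)"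
    and turn: "\<And>i. sg (x (Suc i)) (x i) \<inter> sg (x (Suc i)) (x (Suc (Suc i))) = {x (Suc i)}"
  shows "d (x 0) (x n) = (\<Sum>i<n. d (x i) (x (Suc i)))"
proof (induction n)
  case 0
  then show ?case using X by simp
next
  case (Suc n)
  then show ?case using seg_dist_add[OF X X chain_step[of x n, OF assms]] by simp
qed

text \<open>The centre of a finite set is the midpoint of a diameter.\<close>

lemma finite_centre:
  assumes S: "finite S" "S \<noteq> {}" "S \<subseteq> X"
  shows "\<exists>m\<in>X. \<forall>f. f ` S = S \<longrightarrow> f m \<in> X \<longrightarrow> (\<forall>x\<in>S. d (f x) (f m) = d x m) \<longrightarrow> f m = m"
proof -
  define P where "P = (\<lambda>(a, b). d a b)"
  have fin: "finite (P ` (S \<times> S))" "P ` (S \<times> S) \<noteq> {}" using S by auto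
  obtain a b where ab: "a \<in> S" "b \<in> S" "d a b = Max (P ` (S \<times> S))"
    using Max_in[OF fin] unfolding P_def by auto
  have max: "d x y \<le> d a b" if "x \<in> S" "y \<in> S" for x y
    using that Max_ge[OF fin(1), of "d x y"] ab(3) unfolding P_def by force
  have abX: "a \<in> X" "b \<in> X" using ab S by auto
  define r where "r = d a b / 2"
  obtain m where m: "m \<in> sg a b" "d a m = r"
    using seg_point[OF abX, of r] unfolding r_def by auto
  have mX: "m \<in> X" using m abX seg_subset by auto
  have mb: "d m b = r" using seg_dist_add[OF abX m(1)] m(2) unfolding r_def by simp
  \<comment> \<open>\<open>x\<close> branches off the diameter at \<open>k\<close>. As neither
    \<open>d a x\<close> nor \<open>d b x\<close> exceeds \<open>d a b\<close>, the branch is no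
    longer than the distance from \<open>k\<close> to the nearer end.\<close>
  have close: "d x m \<le> r" if x: "x \<in> S" for x
  proof -
    have xX: "x \<in> X" using x S by auto
    obtain k where k: "k \<in> sg a b" "k \<in> sg a x" "k \<in> sg b x" using median[OF abX xX] by metis
    have kX: "k \<in> X" using k abX seg_subset by auto
    have 1: "d a k + d k x = d a x" "d b k + d k x = d b x" "d a k + d k b = d a b"
      using seg_dist_add k abX xX by auto
    have 2: "d k m = \<bar>d a k - r\<bar>" using seg_dist[OF abX k(1) m(1)] m by simp
    show ?thesis
      using d_triangle[OF xX kX mX] 1 2 max[OF ab(1) x] max[OF ab(2) x] d_comm[of x k] d_comm[of b k]
      unfolding r_def by (auto simp: abs_if split: if_splits)
  qed
  \<comment> \<open>Only the midpoint is within \<open>r\<close> of both \<open>a\<close> and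
    \<open>b\<close>. It is therefore determined by its distances to \<open>S\<close> and cannot be
    moved by a map preserving \<open>S\<close> and these distances.\<close>
  have uniq: "n = m" if n: "n \<in> X" "\<And>x. x \<in> S \<Longrightarrow> d x n \<le> r" for n
  proof -
    have "d a n \<le> r" "d b n \<le> r" using n ab by auto
    then have "d a n = r" "d a n + d n b = d a b"
      using d_triangle[OF abX(1) n(1) abX(2)] d_comm[of b n] unfolding r_def by auto
    then show ?thesis using seg_eqI[OF abX _ m(1), of n] in_seg[OF abX] n m by auto
  qed
  show ?thesis
  proof (intro bexI[OF _ mX] allI impI)
    fix f assume f: "f ` S = S" "f m \<in> X" "\<forall>x\<in>S. d (f x) (f m) = d x m"
    show "f m = m"
    proof (rule uniq[OF f(2)])
      fix x assume "x \<in> S"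
      then obtain y where "y \<in> S" "x = f y" using f(1) by blast
      then show "d x (f m) \<le> r" using f(3) close by simp
    qed
  qed
qed

end


section \<open>Simplicial structures\<close>

lemma finite_ex_max:
  fixes f :: "'a \<Rightarrow> real"
  assumes "finite A" "A \<noteq> {}"
  shows "\<exists>a\<in>A. \<forall>q\<in>A. f q \<le> f a"
proof -
  have "Max (f ` A) \<in> f ` A" using assms by auto
  then obtain a where a: "a \<in> A" "Max (f ` A) = f a" by blast
  have "f q \<le> f a" if "q \<in> A" for q
    using Max_ge[of "f ` A" "f q"] assms that a(2) by auto
  then show ?thesis using a(1) by blast
qed

lemma finite_pos_bound:
  fixes f :: "'a \<Rightarrow> real"
  assumes "finite S" "\<And>e. e \<in> S \<Longrightarrow> 0 < f e"
  shows "\<exists>\<delta>>0. \<forall>e\<in>S. \<delta> < f e"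
proof (cases "S = {}")
  case True
  then show ?thesis by (intro exI[of _ 1]) auto
next
  case False
  then have "\<exists>a\<in>S. \<forall>q\<in>S. - f q \<le> - f a" using finite_ex_max[OF assms(1), of "\<lambda>q. - f q"] by blast
  then obtain a where a: "a \<in> S" "\<forall>q\<in>S. f a \<le> f q" by auto
  then show ?thesis using assms(2)[of a] by (intro exI[of _ "f a / 2"]) force
qed

section \<open>Consecutive points of a discrete set on a segment\<close>

context rtree
begin

text \<open>Among the finitely many points of \<open>W\<close> on the segment, take the last one
  before \<open>p\<close> and the first one after it; the ends of the segment guarantee that both
  exist.\<close>

lemma adjacent_points:
  assumes uw: "u \<in> X" "w \<in> X" "u \<in> W" "w \<in> W" and fin: "finite (W \<inter> sg u w)"
    and p: "p \<in> sg u w" "p \<notin> W"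
  obtains a b where "a \<in> W" "b \<in> W" "a \<in> sg u w" "b \<in> sg u w" "p \<in> sg a b" "a \<noteq> b"
    "sg a b \<inter> W = {a, b}"
proof -
  define A where "A = {q \<in> W \<inter> sg u w. d u q \<le> d u p}"
  define B where "B = {q \<in> W \<inter> sg u w. d u q \<ge> d u p}"
  have fAB: "finite A" "finite B" by (rule finite_subset[OF _ fin]; auto simp: A_def B_def)+
  have "d u p \<le> d u w"
    using seg_dist_add[OF uw(1,2) p(1)] mdist_nonneg[of M p w] by linarith
  then have "u \<in> A" "w \<in> B" using uw unfolding A_def B_def by auto
  then have ne: "A \<noteq> {}" "B \<noteq> {}" by auto
  obtain a where a: "a \<in> A" "\<forall>q\<in>A. d u q \<le> d u a"
    using finite_ex_max[OF fAB(1) ne(1), of "d u"] by blast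
  have "\<exists>b\<in>B. \<forall>q\<in>B. - d u q \<le> - d u b"
    using finite_ex_max[OF fAB(2) ne(2), of "\<lambda>q. - d u q"] .
  then obtain b where b: "b \<in> B" "\<forall>q\<in>B. d u b \<le> d u q" by auto
  have aW: "a \<in> W" "a \<in> sg u w" "d u a \<le> d u p" using a(1) unfolding A_def by auto
  have bW: "b \<in> W" "b \<in> sg u w" "d u p \<le> d u b" using b(1) unfolding B_def by auto
  have X: "a \<in> X" "b \<in> X" "p \<in> X" using aW bW p seg_subset uw by auto
  have "d u a \<noteq> d u p" using seg_eqI[OF uw(1,2) aW(2) p(1)] aW(1) p(2) by metis
  then have lt: "d u a < d u p" using aW by simp
  have "d a p + d p b = d a b"
    using seg_dist[OF uw(1,2) aW(2) p(1)] seg_dist[OF uw(1,2) p(1) bW(2)]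
      seg_dist[OF uw(1,2) aW(2) bW(2)] aW(3) bW(3) by linarith
  then have pab: "p \<in> sg a b" using in_seg X by blast
  have "q = a \<or> q = b" if q: "q \<in> sg a b" "q \<in> W" for q
  proof -
    have qs: "q \<in> sg u w" using seg_mono[OF uw(1,2) aW(2) bW(2)] q by auto
    have ds: "\<bar>d u a - d u q\<bar> + \<bar>d u q - d u b\<bar> = \<bar>d u a - d u b\<bar>"
      using seg_dist[OF uw(1,2) aW(2) qs] seg_dist[OF uw(1,2) qs bW(2)]
        seg_dist[OF uw(1,2) aW(2) bW(2)] seg_dist_add[OF X(1,2) q(1)] by linarith
    show ?thesis
    proof (cases "d u q \<le> d u p")
      case True
      then have "d u q \<le> d u a" using a(2) q qs unfolding A_def by blast
      then have "d u q = d u a" using ds lt bW(3) by linarith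
      then show ?thesis using seg_eqI[OF uw(1,2) qs aW(2)] by simp
    next
      case False
      then have "d u b \<le> d u q" using b(2) q qs unfolding B_def by fastforce
      then have "d u q = d u b" using ds lt bW(3) by linarith
      then show ?thesis using seg_eqI[OF uw(1,2) qs bW(2)] by simp
    qed
  qed
  then have "sg a b \<inter> W = {a, b}" using aW bW X by auto
  moreover have "a \<noteq> b" using lt bW(3) by auto
  ultimately show ?thesis using that aW bW pab by blast
qed

text \<open>Measured by the distance from \<open>a\<close>, both pairs bound an interval around
  \<open>p\<close> with no point of \<open>W\<close> inside, so the lower ends agree and the upper
  ends agree. The orientations of the pairs are unknown, whence four cases. This will keep the edges
  of the subdivision apart.\<close>

lemma adjacent_unique:
  assumes X: "a \<in> X" "b \<in> X" and x: "x \<in> sg a b" "y \<in> sg a b" and u: "u \<in> sg a b" "v \<in> sg a b"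
    and xy: "sg x y \<inter> W = {x, y}" and uv: "sg u v \<inter> W = {u, v}"
    and p: "p \<in> sg x y" "p \<in> sg u v" "p \<notin> W"
  shows "{x, y} = {u, v}"
proof -
  have pX: "p \<in> sg a b" using seg_mono[OF X x] p by blast
  have XX: "x \<in> X" "y \<in> X" "u \<in> X" "v \<in> X" "p \<in> X" using seg_subset[OF X] x u pX by auto
  have W: "x \<in> W" "y \<in> W" "u \<in> W" "v \<in> W" using xy uv by auto
  have ne: "d a p \<noteq> d a z" if "z \<in> W" "z \<in> sg a b" for z
    using seg_eqI[OF X pX that(2)] that p by metis
  note dd = seg_dist[OF X]
  have bx: "\<bar>d a x - d a p\<bar> + \<bar>d a p - d a y\<bar> = \<bar>d a x - d a y\<bar>"
    using seg_dist_add[OF XX(1,2) p(1)] dd[OF x] dd[OF x(1) pX] dd[OF pX x(2)] by simp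
  have bu: "\<bar>d a u - d a p\<bar> + \<bar>d a p - d a v\<bar> = \<bar>d a u - d a v\<bar>"
    using seg_dist_add[OF XX(3,4) p(2)] dd[OF u] dd[OF u(1) pX] dd[OF pX u(2)] by simp
  have *: "z \<in> {r, t}" if z: "z \<in> W" "z \<in> sg a b" and r: "r \<in> sg a b" "t \<in> sg a b" "sg r t \<inter> W = {r, t}"
    and b: "\<bar>d a r - d a z\<bar> + \<bar>d a z - d a t\<bar> = \<bar>d a r - d a t\<bar>" for z r t
  proof -
    have "r \<in> X" "t \<in> X" "z \<in> X" using r z seg_subset[OF X] by auto
    then have "z \<in> sg r t" using dd[OF r(1,2)] dd[OF r(1) z(2)] dd[OF z(2) r(2)] b by (intro dist_add_seg) auto
    then show ?thesis using r(3) z by blast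
  qed
  note n = ne[OF W(1) x(1)] ne[OF W(2) x(2)] ne[OF W(3) u(1)] ne[OF W(4) u(2)]
  consider "d a x < d a p" "d a p < d a y" | "d a y < d a p" "d a p < d a x" using bx n by linarith
  then have xs: "d a x < d a p \<and> d a p < d a y \<or> d a y < d a p \<and> d a p < d a x" by cases auto
  have us: "d a u < d a p \<and> d a p < d a v \<or> d a v < d a p \<and> d a p < d a u" using bu n by linarith
  have eq: "r = z" if "r \<in> sg a b" "z \<in> sg a b" "d a r = d a z" for r z using seg_eqI[OF X that] .
  have lo: "r1 = r2" if r: "r1 \<in> W" "r2 \<in> W" "r1 \<in> sg a b" "r2 \<in> sg a b" "t1 \<in> sg a b" "t2 \<in> sg a b"
    "sg r1 t1 \<inter> W = {r1, t1}" "sg r2 t2 \<inter> W = {r2, t2}"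
    "d a r1 < d a p \<and> d a p < d a t1" "d a r2 < d a p \<and> d a p < d a t2" for r1 r2 t1 t2
  proof (cases "d a r1 \<le> d a r2")
    case True
    then have "r2 \<in> {r1, t1}" using r by (intro *) auto
    then show ?thesis using r by auto
  next
    case False
    then have "r1 \<in> {r2, t2}" using r by (intro *) auto
    then show ?thesis using r by auto
  qed
  have hi: "r1 = r2" if r: "r1 \<in> W" "r2 \<in> W" "r1 \<in> sg a b" "r2 \<in> sg a b" "t1 \<in> sg a b" "t2 \<in> sg a b"
    "sg r1 t1 \<inter> W = {r1, t1}" "sg r2 t2 \<inter> W = {r2, t2}"
    "d a t1 < d a p \<and> d a p < d a r1" "d a t2 < d a p \<and> d a p < d a r2" for r1 r2 t1 t2
  proof (cases "d a r1 \<le> d a r2")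
    case True
    then have "r1 \<in> {r2, t2}" using r by (intro *) auto
    then show ?thesis using r by auto
  next
    case False
    then have "r2 \<in> {r1, t1}" using r by (intro *) auto
    then show ?thesis using r by auto
  qed
  have xy': "sg y x \<inter> W = {y, x}" and uv': "sg v u \<inter> W = {v, u}"
    using xy uv seg_comm[OF XX(1,2)] seg_comm[OF XX(3,4)] by auto
  from xs us show ?thesis
  proof (elim disjE)
    assume o: "d a x < d a p \<and> d a p < d a y" "d a u < d a p \<and> d a p < d a v"
    have "x = u" by (rule lo[OF W(1,3) x(1) u(1) x(2) u(2) xy uv o])
    moreover have "y = v" by (rule hi[OF W(2,4) x(2) u(2) x(1) u(1) xy' uv' o])
    ultimately show ?thesis by simp
  next
    assume o: "d a x < d a p \<and> d a p < d a y" "d a v < d a p \<and> d a p < d a u"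
    have "x = v" by (rule lo[OF W(1,4) x(1) u(2) x(2) u(1) xy uv' o])
    moreover have "y = u" by (rule hi[OF W(2,3) x(2) u(1) x(1) u(2) xy' uv o])
    ultimately show ?thesis by auto
  next
    assume o: "d a y < d a p \<and> d a p < d a x" "d a u < d a p \<and> d a p < d a v"
    have "y = u" by (rule lo[OF W(2,3) x(2) u(1) x(1) u(2) xy' uv o])
    moreover have "x = v" by (rule hi[OF W(1,4) x(1) u(2) x(2) u(1) xy uv' o])
    ultimately show ?thesis by auto
  next
    assume o: "d a y < d a p \<and> d a p < d a x" "d a v < d a p \<and> d a p < d a u"
    have "y = v" by (rule lo[OF W(2,4) x(2) u(2) x(1) u(1) xy' uv' o])
    moreover have "x = u" by (rule hi[OF W(1,3) x(1) u(1) x(2) u(2) xy uv o])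
    ultimately show ?thesis by simp
  qed
qed

end

section \<open>Edges of a simplicial tree\<close>

locale stree = rtree M for M :: "'p metric" +
  fixes V :: "'p set"
  assumes simplicial: "simplicial_structure M V"
begin

abbreviation Ed where "Ed \<equiv> tree_edges M V"

lemma V_X: "V \<subseteq> X"
  and fin_seg: "x \<in> V \<Longrightarrow> y \<in> V \<Longrightarrow> finite (V \<inter> sg x y)"
  and cover: "X = V \<union> (\<Union>(x, y)\<in>Ed. sg x y)"
  using simplicial unfolding simplicial_structure_def by auto

lemma edges_meet:
  "(x, y) \<in> Ed \<Longrightarrow> (u, v) \<in> Ed \<Longrightarrow> {x, y} \<noteq> {u, v} \<Longrightarrow> sg x y \<inter> sg u v \<subseteq> V"
  using simplicial unfolding simplicial_structure_def by fast

lemma edgeD: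
  assumes "(x, y) \<in> Ed"
  shows "x \<in> V" "y \<in> V" "x \<in> X" "y \<in> X" "x \<noteq> y" "sg x y \<inter> V = {x, y}"
  using assms V_X unfolding tree_edges_def by auto

lemma edge_pos: "(x, y) \<in> Ed \<Longrightarrow> d x y > 0"
  using edgeD d_pos by metis

lemma edge_sym:
  assumes "(x, y) \<in> Ed"
  shows "(y, x) \<in> Ed"
proof -
  note E = edgeD[OF assms]
  have "sg y x = sg x y" using seg_comm E by blast
  then show ?thesis using E unfolding tree_edges_def by auto
qed

lemma edge_unique:
  assumes "(x, y) \<in> Ed" "(u, v) \<in> Ed" "p \<in> sg x y" "p \<in> sg u v" "p \<notin> V"
  shows "u = x \<and> v = y \<or> u = y \<and> v = x"
  using edges_meet[OF assms(1,2)] assms(3-5) by (auto simp: doubleton_eq_iff)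

lemma ex_edge:
  assumes "p \<in> X" "p \<notin> V"
  obtains x y where "(x, y) \<in> Ed" "p \<in> sg x y"
proof -
  have "p \<in> (\<Union>(x, y)\<in>Ed. sg x y)" using assms cover by (metis Un_iff)
  then show ?thesis using that by auto
qed

lemma edge_in_seg:
  assumes "u \<in> V" "w \<in> V" "p \<in> sg u w" "p \<notin> V"
  obtains a b where "(a, b) \<in> Ed" "p \<in> sg a b" "a \<in> sg u w" "b \<in> sg u w"
proof -
  have "u \<in> X" "w \<in> X" using assms V_X by auto
  then show ?thesis
    using adjacent_points[of u w V p thesis] fin_seg[OF assms(1,2)] assms that
    unfolding tree_edges_def by blast
qed

text \<open>If the median of \<open>x\<close>, \<open>y\<close>, \<open>z\<close> were interior to
  the edge, the segment from \<open>x\<close> to \<open>z\<close>, being made of whole edges, would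
  contain \<open>y\<close>, and the median would be \<open>y\<close> after all. So the median is an
  end of the edge, and the way from \<open>p\<close> to \<open>z\<close> passes through it.\<close>

lemma exit_vertex:
  assumes e: "(x, y) \<in> Ed" and p: "p \<in> sg x y" and z: "z \<in> V"
  shows "x \<in> sg p z \<or> y \<in> sg p z"
proof -
  note E = edgeD[OF e]
  have zX: "z \<in> X" and pX: "p \<in> X" using z V_X p seg_subset E by auto
  obtain m where m: "m \<in> sg x y" "m \<in> sg x z" "m \<in> sg y z" using median E zX by metis
  have mX: "m \<in> X" using m seg_subset E by auto
  note dm = seg_dist_add[OF E(3,4) m(1)] seg_dist_add[OF E(3) zX m(2)] seg_dist_add[OF E(4) zX m(3)]
  have "m \<in> V"
  proof (rule ccontr)
    assume mV: "m \<notin> V"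
    obtain a b where ab: "(a, b) \<in> Ed" "m \<in> sg a b" "a \<in> sg x z" "b \<in> sg x z"
      using edge_in_seg[OF E(1) z m(2) mV] by blast
    have "a = x \<and> b = y \<or> a = y \<and> b = x" using edge_unique[OF e ab(1) m(1) ab(2) mV] .
    then have "y \<in> sg x z" using ab by auto
    then have "d x y + d y z = d x z" using seg_dist_add E zX by blast
    then have "d m y = 0" using dm d_comm[of m y] mdist_nonneg[of M m y] by linarith
    then show False using mV mX E by simp
  qed
  then have "m = x \<or> m = y" using m E by blast
  then show ?thesis
  proof
    assume "m = x"
    then have "d y p + d p x + d x z = d y z"
      using seg_dist_add[OF E(3,4) p] dm d_comm[of y p] d_comm[of x p] d_comm[of x y] E by simp
    then have "d p x + d x z = d p z"
      using d_triangle[OF E(4) pX zX] d_triangle[OF pX E(3) zX] by linarith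
    then show ?thesis using in_seg pX zX E by blast
  next
    assume "m = y"
    then have "d x p + d p y + d y z = d x z"
      using seg_dist_add[OF E(3,4) p] dm E by simp
    then have "d p y + d y z = d p z"
      using d_triangle[OF E(3) pX zX] d_triangle[OF pX E(4) zX] by linarith
    then show ?thesis using in_seg pX zX E by blast
  qed
qed

lemma seg_antisym:
  assumes "q \<in> X" "z \<in> X" "w \<in> X" "w \<in> sg q z" "q \<in> sg z w"
  shows "q = w"
proof -
  have "d q w = 0"
    using seg_dist_add[OF assms(1,2,4)] seg_dist_add[OF assms(2,3,5)] d_comm[of w z] d_comm[of z q]
      mdist_nonneg[of M q w] by linarith
  then show ?thesis using assms by simp
qed

text \<open>If \<open>q\<close> is not a vertex, it lies on another edge. Were the way to
  \<open>q\<close> to avoid both ends of the first edge, then by \<open>exit_vertex\<close> the ways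
  from \<open>q\<close> on to either end of the second edge would have to meet them. The two edges
  would then have the same ends, although \<open>q\<close> is on only one of them.\<close>

lemma exit_edge:
  assumes e: "(x, y) \<in> Ed" and p: "p \<in> sg x y" and q: "q \<in> X" "q \<notin> sg x y"
  shows "x \<in> sg p q \<or> y \<in> sg p q"
proof (cases "q \<in> V")
  case True
  then show ?thesis using exit_vertex e p by blast
next
  case False
  note E = edgeD[OF e]
  have pX: "p \<in> X" using p seg_subset E by auto
  obtain z w where zw: "(z, w) \<in> Ed" "q \<in> sg z w" using ex_edge q False by blast
  note Z = edgeD[OF zw(1)]
  show ?thesis
  proof (rule ccontr)
    assume neg: "\<not> ?thesis"
    have "x \<in> sg q z \<or> y \<in> sg q z"
      using exit_vertex[OF e p Z(1)] seg_triangle[OF pX q(1) Z(3)] neg by blast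
    then obtain a where a: "a \<in> {x, y}" "a \<in> sg q z" by blast
    have "x \<in> sg q w \<or> y \<in> sg q w"
      using exit_vertex[OF e p Z(2)] seg_triangle[OF pX q(1) Z(4)] neg by blast
    then obtain b where b: "b \<in> {x, y}" "b \<in> sg q w" by blast
    have "sg q z \<subseteq> sg z w" "sg q w \<subseteq> sg z w" using seg_mono[OF Z(3,4) zw(2)] Z by auto
    then have "a \<in> {z, w}" "b \<in> {z, w}" using a b E Z(6) by auto
    moreover have "a \<noteq> w" using seg_antisym[OF q(1) Z(3,4)] a zw(2) False Z by auto
    moreover have "b \<noteq> z" using seg_antisym[OF q(1) Z(4,3)] b zw(2) False Z seg_comm by metis
    ultimately have "a = z" "b = w" by auto
    then have "z = x \<and> w = y \<or> z = y \<and> w = x" using a b Z by auto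
    then have "q \<in> sg x y" using zw(2) seg_comm E by metis
    then show False using q by simp
  qed
qed

lemma two_edges_meet:
  assumes "(v, w) \<in> Ed" "(v, w') \<in> Ed" "w \<noteq> w'"
  shows "sg v w \<inter> sg v w' = {v}"
proof -
  have "p = v" if "p \<in> sg v w" "p \<in> sg v w'" for p
  proof (cases "p \<in> V")
    case True
    then have "p \<in> {v, w}" "p \<in> {v, w'}" using that edgeD(6)[OF assms(1)] edgeD(6)[OF assms(2)] by auto
    then show ?thesis using assms(3) by auto
  next
    case False
    then show ?thesis using edge_unique[OF assms(1,2) that False] assms edgeD by metis
  qed
  then show ?thesis using edgeD[OF assms(1)] edgeD[OF assms(2)] by auto
qed

text \<open>Induction on the number of vertices of the segment: a vertex strictly between the ends
  leaves fewer on each side.\<close>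

lemma seg_induct [consumes 2, case_names refl edge split]:
  assumes "u \<in> V" "w \<in> V"
    and refl: "\<And>u. u \<in> V \<Longrightarrow> P u u"
    and edge: "\<And>u w. (u, w) \<in> Ed \<Longrightarrow> P u w"
    and split: "\<And>u v w. \<lbrakk>u \<in> V; v \<in> V; w \<in> V; v \<in> sg u w; P u v; P v w\<rbrakk> \<Longrightarrow> P u w"
  shows "P u w"
  using assms(1,2)
proof (induction "card (V \<inter> sg u w)" arbitrary: u w rule: less_induct)
  case less
  have X: "u \<in> X" "w \<in> X" using less V_X by auto
  show ?case
  proof (cases "u = w \<or> (u, w) \<in> Ed")
    case True
    then show ?thesis using refl edge less by blast
  next
    case False
    then have "sg u w \<inter> V \<noteq> {u, w}" using less unfolding tree_edges_def by auto
    then obtain v where v: "v \<in> V" "v \<in> sg u w" "v \<noteq> u" "v \<noteq> w" using less X by auto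
    have vX: "v \<in> X" using v V_X by auto
    have sub: "sg u v \<subseteq> sg u w" "sg v w \<subseteq> sg u w" using seg_mono[OF X] X v by auto
    have "w \<notin> sg u v"
      using seg_antisym[OF vX X(1,2)] seg_comm[of v u] v(2,4) X vX by auto
    then have "V \<inter> sg u v \<subset> V \<inter> sg u w" using sub less X by auto
    then have "card (V \<inter> sg u v) < card (V \<inter> sg u w)"
      using fin_seg less by (meson psubset_card_mono)
    then have 1: "P u v" using less v by blast
    have "u \<notin> sg v w"
      using seg_antisym[OF vX X(2,1)] seg_comm[of u w] v(2,3) X vX by auto
    then have "V \<inter> sg v w \<subset> V \<inter> sg u w" using sub less X by auto
    then have "card (V \<inter> sg v w) < card (V \<inter> sg u w)"
      using fin_seg less by (meson psubset_card_mono)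
    then have "P v w" using less v by blast
    then show ?thesis using 1 split less v by blast
  qed
qed

lemma last_edge:
  assumes "u \<in> V" "w \<in> V"
  shows "u \<noteq> w \<longrightarrow> (\<exists>v. v \<in> sg u w \<and> (v, w) \<in> Ed)"
  using assms
proof (induction rule: seg_induct)
  case (edge u w)
  then show ?case using edgeD[OF edge] by (intro impI exI[of _ u]) simp
next
  case (split u v w)
  have X: "u \<in> X" "v \<in> X" "w \<in> X" using split(1-3) V_X by auto
  show ?case
  proof (cases "v = w")
    case True
    then show ?thesis using split by blast
  next
    case False
    then obtain z where z: "z \<in> sg v w" "(z, w) \<in> Ed" using split by blast
    moreover have "sg v w \<subseteq> sg u w" using seg_mono[OF X(1,3) split(4)] X by simp
    ultimately show ?thesis by blast
  qed
qed simp

text \<open>Distances add up along segments of the source, while \<open>r\<close> satisfies the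
  triangle inequality, so a bound on edges propagates. Later \<open>r\<close> is the distance of the
  images in the other tree.\<close>

lemma lipschitz_on_vertices:
  fixes r :: "'p \<Rightarrow> 'p \<Rightarrow> real"
  assumes edge: "\<And>x y. (x, y) \<in> Ed \<Longrightarrow> r x y \<le> L * d x y"
    and refl: "\<And>x. x \<in> V \<Longrightarrow> r x x \<le> 0"
    and tri: "\<And>x y z. \<lbrakk>x \<in> V; y \<in> V; z \<in> V\<rbrakk> \<Longrightarrow> r x z \<le> r x y + r y z"
    and "u \<in> V" "w \<in> V"
  shows "r u w \<le> L * d u w"
  using assms(4,5)
proof (induction rule: seg_induct)
  case (split u v w)
  have "d u v + d v w = d u w" using seg_dist_add split V_X by (meson subsetD)
  then have "L * d u w = L * d u v + L * d v w" by (metis distrib_left)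
  then show ?case using tri[of u v w] split by linarith
qed (use edge refl V_X in auto)

text \<open>Going back along the last edge towards \<open>u\<close> shortens the distance by at
  least \<open>\<delta>\<close>. So each enlargement of the radius by \<open>\<delta>\<close> adds
  only neighbours of vertices already reached.\<close>

lemma finite_ball:
  assumes "\<delta> > 0" "\<And>x y. (x, y) \<in> Ed \<Longrightarrow> d x y \<ge> \<delta>"
    and nbrs: "\<And>v. v \<in> V \<Longrightarrow> finite {w. (v, w) \<in> Ed}" and "u \<in> V"
  shows "finite {w \<in> V. d u w \<le> r}"
proof -
  have *: "finite {w \<in> V. d u w \<le> real n * \<delta>}" for n
  proof (induction n)
    case 0
    have "{w \<in> V. d u w \<le> real 0 * \<delta>} \<subseteq> {u}"
    proof -
      have "w = u" if "w \<in> V" "d u w \<le> 0" for w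
        using that d_pos[of u w] assms V_X by fastforce
      then show ?thesis by auto
    qed
    then show ?case using finite_subset by blast
  next
    case (Suc n)
    have "{w \<in> V. d u w \<le> real (Suc n) * \<delta>} \<subseteq>
      {u} \<union> (\<Union>v\<in>{w \<in> V. d u w \<le> real n * \<delta>}. {w. (v, w) \<in> Ed})"
    proof
      fix w assume "w \<in> {w \<in> V. d u w \<le> real (Suc n) * \<delta>}"
      then have w: "w \<in> V" "d u w \<le> real n * \<delta> + \<delta>" by (auto simp: algebra_simps)
      show "w \<in> {u} \<union> (\<Union>v\<in>{w \<in> V. d u w \<le> real n * \<delta>}. {w. (v, w) \<in> Ed})"
      proof (cases "w = u")
        case False
        then obtain v where v: "v \<in> sg u w" "(v, w) \<in> Ed" using last_edge assms w by blast
        have "d u v + d v w = d u w" using seg_dist_add v assms w V_X by (meson subsetD)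
        then have "d u v \<le> real n * \<delta>" using assms(2)[OF v(2)] w by linarith
        then show ?thesis using v edgeD by blast
      qed simp
    qed
    moreover have "finite ({u} \<union> (\<Union>v\<in>{w \<in> V. d u w \<le> real n * \<delta>}. {w. (v, w) \<in> Ed}))"
      using Suc nbrs by auto
    ultimately show ?case using finite_subset by blast
  qed
  obtain n where "r < real n * \<delta>" using reals_Archimedean3[OF assms(1)] by blast
  then have "{w \<in> V. d u w \<le> r} \<subseteq> {w \<in> V. d u w \<le> real n * \<delta>}" by auto
  then show ?thesis using * finite_subset by blast
qed

end


section \<open>Actions on simplicial trees\<close>

lemma subseq_finite_range:
  fixes f :: "nat \<Rightarrow> 'a"
  assumes "finite S" "\<And>n. f n \<in> S"
  obtains r c where "strict_mono (r :: nat \<Rightarrow> nat)" "\<And>n. f (r n) = c"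
proof -
  have "finite (range f)" using assms finite_subset[of "range f" S] by blast
  then obtain c where "infinite {n. f n = c}"
    using pigeonhole_infinite[of UNIV f] by auto
  then obtain r :: "nat \<Rightarrow> nat" where "strict_mono r" "\<forall>n. r n \<in> {n. f n = c}"
    using infinite_enumerate by blast
  then show ?thesis using that by auto
qed

text \<open>\<open>C r i\<close> stands for convergence of the \<open>i\<close>-th sequence along
  \<open>r\<close>: it can be reached by refinement and survives further refinement. Refining once
  for each of the finitely many indices serves all of them.\<close>

lemma subseq_family:
  fixes C :: "(nat \<Rightarrow> nat) \<Rightarrow> 'a \<Rightarrow> bool"
  assumes "finite S"
    and ex: "\<And>i r. i \<in> S \<Longrightarrow> strict_mono r \<Longrightarrow> \<exists>q :: nat \<Rightarrow> nat. strict_mono q \<and> C (r \<circ> q) i"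
    and mono: "\<And>i r (q :: nat \<Rightarrow> nat). C r i \<Longrightarrow> strict_mono q \<Longrightarrow> C (r \<circ> q) i"
  shows "\<exists>r :: nat \<Rightarrow> nat. strict_mono r \<and> (\<forall>i\<in>S. C r i)"
  using assms(1,2)
proof (induction S rule: finite_induct)
  case empty
  show ?case by (auto intro: exI[of _ id] strict_monoI)
next
  case (insert i S)
  then obtain r where r: "strict_mono r" "\<forall>i\<in>S. C r i" by blast
  obtain q where "strict_mono q" "C (r \<circ> q) i" using insert(4)[of i r] r by blast
  then show ?case using r mono strict_mono_o[of r q] by blast
qed

section \<open>Isometric actions with finite stabilizers\<close>

locale gtree = stree M V for M :: "'p metric" and V +
  fixes F :: "'g monoid" and \<phi> :: "'g \<Rightarrow> 'p \<Rightarrow> 'p"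
  assumes F_group: "group F" and outer: "outer_space F M V \<phi>"
begin

sublocale F: group F by (rule F_group)
sublocale A: group_action F "mspace M" \<phi> using outer unfolding outer_space_def by blast

abbreviation act where "act \<equiv> \<phi>"
abbreviation FF where "FF \<equiv> carrier F"

lemma X_ne: "X \<noteq> {}"
  and act_V_image: "g \<in> FF \<Longrightarrow> act g ` V = V"
  and act_iso: "g \<in> FF \<Longrightarrow> x \<in> X \<Longrightarrow> y \<in> X \<Longrightarrow> d (act g x) (act g y) = d x y"
  and minimal: "minimal_action F M \<phi>"
  and stab_finite: "x \<in> X \<Longrightarrow> finite (stabilizer F \<phi> x)"
  using outer unfolding outer_space_def by auto

lemma act_X: "g \<in> FF \<Longrightarrow> x \<in> X \<Longrightarrow> act g x \<in> X"
  using A.element_image by blast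

lemma act_V: "g \<in> FF \<Longrightarrow> x \<in> V \<Longrightarrow> act g x \<in> V"
  using act_V_image by blast

lemma act_mult: "g \<in> FF \<Longrightarrow> h \<in> FF \<Longrightarrow> x \<in> X \<Longrightarrow> act (g \<otimes>\<^bsub>F\<^esub> h) x = act g (act h x)"
  using A.composition_rule by blast

lemma act_one: "x \<in> X \<Longrightarrow> act \<one>\<^bsub>F\<^esub> x = x"
  using A.id_eq_one by (metis restrict_apply')

lemma act_inv: "g \<in> FF \<Longrightarrow> x \<in> X \<Longrightarrow> act (inv\<^bsub>F\<^esub> g) (act g x) = x"
  using A.orbit_sym_aux by blast

lemma act_inv': "g \<in> FF \<Longrightarrow> x \<in> X \<Longrightarrow> act g (act (inv\<^bsub>F\<^esub> g) x) = x"
  using act_inv[of "inv\<^bsub>F\<^esub> g" x] by simp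

lemma act_inj: "g \<in> FF \<Longrightarrow> x \<in> X \<Longrightarrow> y \<in> X \<Longrightarrow> act g x = act g y \<Longrightarrow> x = y"
  using act_inv by metis

lemma act_seg:
  assumes "g \<in> FF" "x \<in> X" "y \<in> X" "z \<in> sg x y"
  shows "act g z \<in> sg (act g x) (act g y)"
proof -
  have z: "z \<in> X" using assms seg_subset by blast
  show ?thesis
    using seg_dist_add[OF assms(2-4)] act_iso[OF assms(1)] act_X[OF assms(1)] z assms
    by (intro dist_add_seg) auto
qed

lemma act_seg_image:
  assumes "g \<in> FF" "x \<in> X" "y \<in> X"
  shows "act g ` sg x y = sg (act g x) (act g y)"
proof
  show "act g ` sg x y \<subseteq> sg (act g x) (act g y)" using act_seg assms by blast
  show "sg (act g x) (act g y) \<subseteq> act g ` sg x y"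
  proof
    fix z assume z: "z \<in> sg (act g x) (act g y)"
    have zX: "z \<in> X" using z seg_subset act_X assms by blast
    have "act (inv\<^bsub>F\<^esub> g) z \<in> sg x y"
      using act_seg[of "inv\<^bsub>F\<^esub> g" "act g x" "act g y" z] z act_X assms act_inv by simp
    moreover have "z = act g (act (inv\<^bsub>F\<^esub> g) z)" using act_inv' assms zX by simp
    ultimately show "z \<in> act g ` sg x y" by blast
  qed
qed

lemma act_edge:
  assumes "g \<in> FF" "(x, y) \<in> Ed"
  shows "(act g x, act g y) \<in> Ed"
proof -
  note E = edgeD[OF assms(2)]
  have endpt: "p = act g x \<or> p = act g y" if p: "p \<in> sg (act g x) (act g y)" "p \<in> V" for p
  proof -
    obtain q where q: "q \<in> sg x y" "p = act g q" using p act_seg_image assms E by blast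
    obtain q' where q': "q' \<in> V" "p = act g q'" using p act_V_image assms by blast
    have "q \<in> X" "q' \<in> X" using q q' seg_subset E V_X by blast+
    then have "q = q'" using q q' act_inj[OF assms(1)] by metis
    then have "q \<in> {x, y}" using q(1) q'(1) E(6) by blast
    then show ?thesis using q(2) by auto
  qed
  have "act g x \<noteq> act g y" using act_inj assms E by blast
  then show ?thesis
    using endpt act_V[OF assms(1)] act_X[OF assms(1)] E unfolding tree_edges_def by auto
qed

text \<open>If some element carries \<open>x\<close> to \<open>y\<close>, all of them form a coset
  of the finite stabilizer of \<open>x\<close>.\<close>

lemma transporter_finite:
  assumes "x \<in> X"
  shows "finite {g \<in> FF. act g x = y}"
proof (cases "\<exists>h\<in>FF. act h x = y")
  case True
  then obtain h where h: "h \<in> FF" "act h x = y" by blast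
  have "{g \<in> FF. act g x = y} \<subseteq> (\<otimes>\<^bsub>F\<^esub>) h ` stabilizer F \<phi> x"
  proof
    fix g assume "g \<in> {g \<in> FF. act g x = y}"
    then have g: "g \<in> FF" "act g x = y" by auto
    have "act (inv\<^bsub>F\<^esub> h \<otimes>\<^bsub>F\<^esub> g) x = x"
      using g h act_mult[of "inv\<^bsub>F\<^esub> h" g x] act_inv[OF h(1) assms] assms by simp
    then have "inv\<^bsub>F\<^esub> h \<otimes>\<^bsub>F\<^esub> g \<in> stabilizer F \<phi> x" unfolding stabilizer_def using g h by simp
    moreover have "g = h \<otimes>\<^bsub>F\<^esub> (inv\<^bsub>F\<^esub> h \<otimes>\<^bsub>F\<^esub> g)" using g h by (simp add: F.m_assoc[symmetric])
    ultimately show "g \<in> (\<otimes>\<^bsub>F\<^esub>) h ` stabilizer F \<phi> x" by blast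
  qed
  then show ?thesis using stab_finite[OF assms] finite_subset by blast
next
  case False
  then have "{g \<in> FF. act g x = y} = {}" by blast
  then show ?thesis by (simp only: finite.emptyI)
qed

lemma V_ne: "V \<noteq> {}"
proof -
  obtain x where x: "x \<in> X" using X_ne by blast
  show ?thesis
  proof (cases "x \<in> V")
    case False
    then obtain a b where "(a, b) \<in> Ed" using ex_edge x by blast
    then show ?thesis using edgeD by blast
  qed blast
qed

text \<open>An orbit of a finite subgroup is a finite set permuted by it, so the centre of this set
  is fixed.\<close>

lemma finite_subgroup_fixes:
  assumes S: "subgroup S F" "finite S"
  shows "\<exists>b\<in>X. \<forall>g\<in>S. act g b = b"
proof -
  obtain x where x: "x \<in> X" using X_ne by blast
  define Y where "Y = (\<lambda>g. act g x) ` S"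
  have SF: "S \<subseteq> FF" using S subgroup.subset by blast
  have Y: "finite Y" "Y \<noteq> {}" "Y \<subseteq> X"
    using S subgroup.one_closed[OF S(1)] SF act_X x unfolding Y_def by auto
  have img: "act g ` Y = Y" if g: "g \<in> S" for g
  proof -
    have 1: "act g ` Y \<subseteq> Y" if g: "g \<in> S" for g
    proof
      fix z assume "z \<in> act g ` Y"
      then obtain h where h: "h \<in> S" "z = act g (act h x)" unfolding Y_def by blast
      then have "z = act (g \<otimes>\<^bsub>F\<^esub> h) x" using act_mult[OF subsetD[OF SF g] subsetD[OF SF h(1)] x] by simp
      then show "z \<in> Y" unfolding Y_def using subgroup.m_closed[OF S(1) g h(1)] by blast
    qed
    have "Y \<subseteq> act g ` Y"
    proof
      fix z assume z: "z \<in> Y"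
      have "act (inv\<^bsub>F\<^esub> g) z \<in> Y" using 1[of "inv\<^bsub>F\<^esub> g"] subgroup.m_inv_closed[OF S(1) g] z by blast
      moreover have "z = act g (act (inv\<^bsub>F\<^esub> g) z)" 
        using act_inv'[OF subsetD[OF SF g] subsetD[OF Y(3) z]] by simp
      ultimately show "z \<in> act g ` Y" by blast
    qed
    then show ?thesis using 1 g by blast
  qed
  obtain m where m: "m \<in> X"
    "\<forall>f. f ` Y = Y \<longrightarrow> f m \<in> X \<longrightarrow> (\<forall>x\<in>Y. d (f x) (f m) = d x m) \<longrightarrow> f m = m"
    using finite_centre[OF Y] by blast
  have "act g m = m" if g: "g \<in> S" for g
  proof -
    have "act g m \<in> X" using act_X[OF subsetD[OF SF g] m(1)] .
    moreover have "\<forall>x\<in>Y. d (act g x) (act g m) = d x m"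
      using act_iso[OF subsetD[OF SF g] subsetD[OF Y(3)] m(1)] by blast
    ultimately show ?thesis using m(2) img[OF g] by blast
  qed
  then show ?thesis using m(1) by blast
qed

end

section \<open>Cocompactness and properness from finite generation and minimality\<close>

locale fg_gtree = gtree M V F \<phi> for M :: "'p metric" and V and F :: "'g monoid" and \<phi> +
  assumes fg: "finitely_generated_group F"
begin

definition gens where
  "gens = (SOME A. finite A \<and> A \<subseteq> FF \<and> generate F A = FF)"

lemma gens: "finite gens" "gens \<subseteq> FF" "generate F gens = FF"
  using someI_ex[OF fg[unfolded finitely_generated_group_def]] unfolding gens_def by auto

definition base where "base = (SOME x. x \<in> V)"

lemma base: "base \<in> V" "base \<in> X"
  using V_ne V_X some_in_eq[of V] unfolding base_def by auto

definition gen_seg where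
  "gen_seg a = sg base (act a base)"

text \<open>With the identity added, the translates of the generator segments contain the orbit of
  the base point even if \<open>gens\<close> is empty.\<close>

definition igens where "igens = insert \<one>\<^bsub>F\<^esub> gens"

lemma igens: "finite igens" "igens \<subseteq> FF" "\<one>\<^bsub>F\<^esub> \<in> igens"
  using gens unfolding igens_def by auto

lemma gen_seg_X: "a \<in> FF \<Longrightarrow> gen_seg a \<subseteq> X"
  unfolding gen_seg_def using seg_subset base act_X by blast

text \<open>The union of these translates is convex and invariant, hence everything by minimality.\<close>

lemma translates_cover:
  assumes "x \<in> X"
  shows "\<exists>g\<in>FF. \<exists>a\<in>igens. \<exists>z\<in>gen_seg a. x = act g z"
proof -
  define N where "N = {act g z |g z a. g \<in> FF \<and> a \<in> igens \<and> z \<in> gen_seg a}"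
  have iX: "z \<in> X" if "z \<in> gen_seg a" "a \<in> igens" for z a using gen_seg_X igens that by blast
  have NX: "N \<subseteq> X" unfolding N_def using act_X iX by blast
  have inv: "act g x \<in> N" if x: "x \<in> N" "g \<in> FF" for x g
  proof -
    obtain h z a where h: "x = act h z" "h \<in> FF" "a \<in> igens" "z \<in> gen_seg a"
      using x unfolding N_def by blast
    then have "act g x = act (g \<otimes>\<^bsub>F\<^esub> h) z" using act_mult iX x by simp
    then show ?thesis unfolding N_def using h x by blast
  qed
  have in1: "z \<in> N" if "z \<in> gen_seg a" "a \<in> igens" for z a
    unfolding N_def using that act_one[OF iX[OF that]] F.one_closed by force
  have tr: "act g ` sg x y \<subseteq> N" if "sg x y \<subseteq> N" "g \<in> FF" for g x y
    using inv that by blast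
  \<comment> \<open>Induction on words: the segment towards the image under a product is covered by
    the one for the first factor and a translate of the one for the second.\<close>
  have seg_orb: "sg base (act g base) \<subseteq> N" if "g \<in> FF" for g
  proof -
    have "g \<in> generate F gens" using gens that by simp
    then show ?thesis
    proof (induction rule: generate.induct)
      case one
      then show ?case using in1[of _ "\<one>\<^bsub>F\<^esub>"] igens unfolding gen_seg_def by blast
    next
      case (incl h)
      then show ?case using in1[of _ h] unfolding gen_seg_def igens_def by blast
    next
      case (inv h)
      then have h: "h \<in> FF" "h \<in> igens" using gens unfolding igens_def by auto
      have "sg base (act h base) \<subseteq> N" using in1[of _ h] h unfolding gen_seg_def by blast
      then have "act (inv\<^bsub>F\<^esub> h) ` sg base (act h base) \<subseteq> N" using tr h by simp
      then have "sg (act (inv\<^bsub>F\<^esub> h) base) base \<subseteq> N"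
        using act_seg_image[of "inv\<^bsub>F\<^esub> h" base "act h base"] h base act_X act_inv by simp
      then show ?case using seg_comm base act_X h by (metis F.inv_closed)
    next
      case (eng h1 h2)
      have h: "h1 \<in> FF" "h2 \<in> FF" using eng gens by auto
      have "act h1 ` sg base (act h2 base) \<subseteq> N" using tr eng h by simp
      then have "sg (act h1 base) (act (h1 \<otimes>\<^bsub>F\<^esub> h2) base) \<subseteq> N"
        using act_seg_image[of h1 base "act h2 base"] h base act_X act_mult by simp
      moreover have "sg base (act (h1 \<otimes>\<^bsub>F\<^esub> h2) base)
          \<subseteq> sg base (act h1 base) \<union> sg (act h1 base) (act (h1 \<otimes>\<^bsub>F\<^esub> h2) base)"
        using seg_triangle base act_X h by simp
      ultimately show ?case using eng by blast
    qed
  qed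
  have seg_base: "sg base x \<subseteq> N" if x: "x \<in> N" for x
  proof -
    obtain h z a where h: "x = act h z" "h \<in> FF" "a \<in> igens" "z \<in> gen_seg a"
      using x unfolding N_def by blast
    have z: "z \<in> X" using iX h by blast
    have aX: "act a base \<in> X" using h igens act_X base by auto
    have "sg base z \<subseteq> gen_seg a" unfolding gen_seg_def
      using seg_mono[OF base(2) aX] h(4) base aX unfolding gen_seg_def by simp
    then have "sg base z \<subseteq> N" using in1 h by blast
    then have "act h ` sg base z \<subseteq> N" using tr h by simp
    then have "sg (act h base) x \<subseteq> N" using act_seg_image base z h by simp
    then show ?thesis
      using seg_triangle[of base "act h base" x] base act_X h z seg_orb[OF h(2)] by blast
  qed
  have conv: "sg x y \<subseteq> N" if "x \<in> N" "y \<in> N" for x y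
  proof -
    have X: "x \<in> X" "y \<in> X" using that NX by auto
    have "sg x base \<subseteq> N" using seg_base[OF that(1)] seg_comm[of x base] X base by simp
    then show ?thesis using seg_triangle[OF X(1) base(2) X(2)] seg_base[OF that(2)] by blast
  qed
  have "base \<in> N" using in1[of base "\<one>\<^bsub>F\<^esub>"] igens base act_X unfolding gen_seg_def by simp
  moreover have "\<forall>x\<in>N. \<forall>y\<in>N. sg x y \<subseteq> N" "\<forall>g\<in>FF. act g ` N \<subseteq> N" using conv inv by blast+
  ultimately have "N = X" using minimal[unfolded minimal_action_def, rule_format, of N] NX by blast
  then show ?thesis using assms unfolding N_def by blast
qed

text \<open>A finite set meeting every orbit of oriented edges, possibly several times; it is closed
  under reversal.\<close>

definition edge_reps where
  "edge_reps = {(x, y) \<in> Ed. \<exists>a\<in>igens. \<exists>b\<in>igens. x \<in> gen_seg a \<and> y \<in> gen_seg b}"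

lemma edge_reps_Ed: "edge_reps \<subseteq> Ed" unfolding edge_reps_def by auto

lemma edge_reps_finite: "finite edge_reps"
proof -
  define W where "W = (\<Union>a\<in>igens. V \<inter> gen_seg a)"
  have "finite (V \<inter> gen_seg a)" if "a \<in> igens" for a
    unfolding gen_seg_def using fin_seg act_V base igens that by blast
  then have "finite W" unfolding W_def using igens by blast
  moreover have "edge_reps \<subseteq> W \<times> W" unfolding edge_reps_def W_def using edgeD by blast
  ultimately show ?thesis using finite_subset by blast
qed

text \<open>The midpoint of an edge is no vertex and therefore determines the edge. Some translate
  of it lies on a segment \<open>gen_seg a\<close>, and so does the edge around that
  translate.\<close>

lemma edge_reps_cover:
  assumes e: "(x, y) \<in> Ed"
  shows "\<exists>g\<in>FF. \<exists>b c. (b, c) \<in> edge_reps \<and> x = act g b \<and> y = act g c"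
proof -
  note E = edgeD[OF e]
  obtain p where p: "p \<in> sg x y" "d x p = d x y / 2"
    using seg_point[OF E(3,4), of "d x y / 2"] by auto
  have pX: "p \<in> X" using p seg_subset E by blast
  have "d x p > 0" "d p y > 0"
    using p(2) seg_dist_add[OF E(3,4) p(1)] edge_pos[OF e] by linarith+
  then have "p \<noteq> x" "p \<noteq> y" using E by auto
  then have pV: "p \<notin> V" using p E by auto
  obtain g a z where g: "g \<in> FF" "a \<in> igens" "z \<in> gen_seg a" "p = act g z"
    using translates_cover[OF pX] by blast
  have a: "act a base \<in> V" using g igens act_V base by auto
  have zX: "z \<in> X" using g gen_seg_X igens by blast
  have zV: "z \<notin> V" using pV g act_V by blast
  obtain b c where bc: "(b, c) \<in> Ed" "z \<in> sg b c" "b \<in> gen_seg a" "c \<in> gen_seg a"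
    using edge_in_seg[OF base(1) a _ zV] g(3) unfolding gen_seg_def by blast
  note B = edgeD[OF bc(1)]
  have "p \<in> sg (act g b) (act g c)" using act_seg g bc B by blast
  then have "act g b = x \<and> act g c = y \<or> act g b = y \<and> act g c = x"
    using edge_unique[OF e act_edge[OF g(1) bc(1)] p(1)] pV by blast
  moreover have "(b, c) \<in> edge_reps" "(c, b) \<in> edge_reps" unfolding edge_reps_def using bc g edge_sym by auto
  ultimately show ?thesis using g by metis
qed

text \<open>Every edge at \<open>v\<close> is a translate of one of finitely many, and since
  stabilizers are finite, only finitely many elements bring the origin of such an edge to
  \<open>v\<close>.\<close>

lemma nbrs_finite:
  assumes v: "v \<in> V"
  shows "finite {w. (v, w) \<in> Ed}"
proof -
  have "{w. (v, w) \<in> Ed} \<subseteq> (\<Union>(b, c)\<in>edge_reps. (\<lambda>g. act g c) ` {g \<in> FF. act g b = v})"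
  proof
    fix w assume "w \<in> {w. (v, w) \<in> Ed}"
    then obtain g b c where "g \<in> FF" "(b, c) \<in> edge_reps" "v = act g b" "w = act g c"
      using edge_reps_cover by blast
    then show "w \<in> (\<Union>(b, c)\<in>edge_reps. (\<lambda>g. act g c) ` {g \<in> FF. act g b = v})" by blast
  qed
  moreover have "finite (\<Union>(b, c)\<in>edge_reps. (\<lambda>g. act g c) ` {g \<in> FF. act g b = v})"
  proof (rule finite_UN_I[OF edge_reps_finite])
    fix e assume "e \<in> edge_reps"
    then have "fst e \<in> X" using edge_reps_Ed edgeD by (metis prod.collapse subsetD)
    then have "finite {g \<in> FF. act g (fst e) = v}" by (rule transporter_finite)
    then show "finite (case e of (b, c) \<Rightarrow> (\<lambda>g. act g c) ` {g \<in> FF. act g b = v})"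
      by (simp add: case_prod_beta)
  qed
  ultimately show ?thesis using finite_subset by blast
qed

lemma min_edge_length: "\<exists>\<delta>>0. \<forall>(x, y)\<in>Ed. \<delta> \<le> d x y"
proof -
  have "0 < d (fst e) (snd e)" if "e \<in> edge_reps" for e
    using that edge_reps_Ed edge_pos by (metis prod.collapse subsetD)
  then obtain \<delta> where \<delta>: "\<delta> > 0" "\<forall>e\<in>edge_reps. \<delta> < d (fst e) (snd e)"
    using finite_pos_bound[OF edge_reps_finite, of "\<lambda>e. d (fst e) (snd e)"] by blast
  have "\<delta> \<le> d x y" if e: "(x, y) \<in> Ed" for x y
  proof -
    obtain g b c where g: "g \<in> FF" "(b, c) \<in> edge_reps" "x = act g b" "y = act g c"
      using edge_reps_cover[OF e] by blast
    then have "b \<in> X" "c \<in> X" using edge_reps_Ed edgeD by blast+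
    then have "d x y = d b c" using act_iso g by simp
    then show ?thesis using \<delta>(2) g(2) by force
  qed
  then show ?thesis using \<delta>(1) by blast
qed

text \<open>Local finiteness and a positive lower bound for edge lengths leave finitely many
  vertices in a ball, and each of them is the image of the base point under finitely many
  elements.\<close>

lemma proper:
  shows "finite {g \<in> FF. d base (act g base) \<le> r}"
proof -
  obtain \<delta> where \<delta>: "\<delta> > 0" "\<forall>(x, y)\<in>Ed. \<delta> \<le> d x y" using min_edge_length by blast
  have fin: "finite {w \<in> V. d base w \<le> r}"
    by (rule finite_ball[OF \<delta>(1) _ nbrs_finite base(1)]) (use \<delta>(2) in auto)
  have "{g \<in> FF. d base (act g base) \<le> r}
    \<subseteq> (\<Union>w\<in>{w \<in> V. d base w \<le> r}. {g \<in> FF. act g base = w})"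
    using act_V base by blast
  moreover have "finite (\<Union>w\<in>{w \<in> V. d base w \<le> r}. {g \<in> FF. act g base = w})"
    using fin transporter_finite[OF base(2)] by blast
  ultimately show ?thesis using finite_subset by blast
qed

definition diam where "diam = (\<Sum>a\<in>igens. d base (act a base))"

lemma gen_seg_diam:
  assumes "a \<in> igens" "z \<in> gen_seg a"
  shows "d base z \<le> diam"
proof -
  have "d base (act a base) \<le> diam"
    unfolding diam_def using member_le_sum[OF assms(1), of "\<lambda>a. d base (act a base)"] igens by simp
  moreover have "d base z + d z (act a base) = d base (act a base)"
    using assms seg_dist_add base act_X igens unfolding gen_seg_def by blast
  ultimately show ?thesis using mdist_nonneg[of M z "act a base"] by linarith
qed

lemma near_orbit:
  assumes "x \<in> X"
  shows "\<exists>g\<in>FF. d (act g base) x \<le> diam"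
proof -
  obtain g a z where g: "g \<in> FF" "a \<in> igens" "z \<in> gen_seg a" "x = act g z"
    using translates_cover[OF assms] by blast
  then have "z \<in> X" using gen_seg_X igens by blast
  then have "d (act g base) x = d base z" using act_iso g base by simp
  then have "d (act g base) x \<le> diam" using gen_seg_diam g by simp
  then show ?thesis using g by blast
qed

text \<open>By properness only finitely many translates of generator segments meet a ball.
  Infinitely many terms of the sequence thus lie on a single one, where compactness of an interval
  applies.\<close>

lemma bounded_sequence:
  fixes y :: "nat \<Rightarrow> 'p"
  assumes y: "\<And>n. y n \<in> X" "\<And>n. d base (y n) \<le> r"
  shows "\<exists>(q :: nat \<Rightarrow> nat) l. strict_mono q \<and> l \<in> X \<and> (\<lambda>n. d (y (q n)) l) \<longlonglongrightarrow> 0"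
proof -
  have "\<exists>g a. g \<in> FF \<and> a \<in> igens \<and> y n \<in> sg (act g base) (act g (act a base))
      \<and> d base (act g base) \<le> r + diam" for n
  proof -
    obtain g a z where g: "g \<in> FF" "a \<in> igens" "z \<in> gen_seg a" "y n = act g z"
      using translates_cover[OF y(1)] by blast
    have aX: "act a base \<in> X" using g igens act_X base by auto
    have z: "z \<in> X" using g gen_seg_X igens by blast
    have "d (act g base) (y n) = d base z" using act_iso g base z by simp
    then have "d base (act g base) \<le> r + diam"
      using gen_seg_diam[OF g(2,3)] d_triangle[OF base(2) y(1)[of n] act_X[OF g(1) base(2)]] y(2)[of n]
        d_comm[of "y n" "act g base"] by linarith
    moreover have "y n \<in> sg (act g base) (act g (act a base))"
      using act_seg[OF g(1) base(2) aX] g unfolding gen_seg_def by simp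
    ultimately show ?thesis using g by blast
  qed
  then obtain g a where ga: "\<And>n. g n \<in> FF" "\<And>n. a n \<in> igens"
    "\<And>n. y n \<in> sg (act (g n) base) (act (g n) (act (a n) base))"
    "\<And>n. d base (act (g n) base) \<le> r + diam" by metis
  have "finite ({g \<in> FF. d base (act g base) \<le> r + diam} \<times> igens)"
    using proper igens by blast
  moreover have "(g n, a n) \<in> {g \<in> FF. d base (act g base) \<le> r + diam} \<times> igens" for n
    using ga by simp
  ultimately obtain q :: "nat \<Rightarrow> nat" and h where q: "strict_mono q" "\<And>n. (g (q n), a (q n)) = h"
    by (rule subseq_finite_range) (rule that)
  define u where "u = act (fst h) base"
  define w where "w = act (fst h) (act (snd h) base)"
  have h: "fst h \<in> FF" "snd h \<in> FF" using ga(1,2) q(2) igens by (metis fst_conv, metis snd_conv subsetD)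
  have uw: "u \<in> X" "w \<in> X" unfolding u_def w_def using act_X h base by auto
  have yq: "y (q n) \<in> sg u w" for n unfolding u_def w_def using ga(3) q(2) by (metis fst_conv snd_conv)
  have "d u (y (q n)) \<le> d u w" for n
    using seg_dist_add[OF uw yq[of n]] mdist_nonneg[of M "y (q n)" w] by linarith
  then have "\<forall>n. d u (y (q n)) \<in> {0..d u w}" by simp
  then obtain t and k :: "nat \<Rightarrow> nat" where t: "t \<in> {0..d u w}" "strict_mono k"
      "((\<lambda>n. d u (y (q n))) \<circ> k) \<longlonglongrightarrow> t"
    using compact_Icc[of 0 "d u w"] unfolding compact_eq_seq_compact_metric seq_compact_def by meson
  obtain l where l: "l \<in> sg u w" "d u l = t" using seg_point[OF uw, of t] t by auto
  have "d (y ((q \<circ> k) n)) l = \<bar>d u (y (q (k n))) - t\<bar>" for n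
    using seg_dist[OF uw yq l(1)] l(2) by simp
  moreover have "(\<lambda>n. \<bar>d u (y (q (k n))) - t\<bar>) \<longlonglongrightarrow> 0"
    using t(3) by (simp add: o_def LIM_zero_iff tendsto_rabs_zero_iff)
  ultimately have "(\<lambda>n. d (y ((q \<circ> k) n)) l) \<longlonglongrightarrow> 0" by presburger
  moreover have "strict_mono (q \<circ> k)" using q(1) t(2) strict_mono_o by blast
  moreover have "l \<in> X" using l uw seg_subset by auto
  ultimately show ?thesis by blast
qed

end


section \<open>Subdivision\<close>

context gtree
begin

definition mid where
  "mid = {m. \<exists>(x, y)\<in>Ed. (\<exists>g\<in>FF. act g x = y \<and> act g y = x) \<and>
     m \<in> sg x y \<and> d x m = d m y}"

lemma subdivision_eq: "subdivision F M \<phi> V = V \<union> mid"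
  unfolding subdivision_def mid_def ..

lemma midE:
  assumes "m \<in> mid"
  obtains x y where "(x, y) \<in> Ed" "m \<in> sg x y" "d x m = d m y" "m \<notin> V"
proof -
  obtain x y where m: "(x, y) \<in> Ed" "m \<in> sg x y" "d x m = d m y" using assms unfolding mid_def by blast
  note E = edgeD[OF m(1)]
  have "d x m > 0" "d m y > 0" using m(3) edge_pos[OF m(1)] seg_dist_add[OF E(3,4) m(2)] by linarith+
  then have "m \<noteq> x" "m \<noteq> y" using E by auto
  then have "m \<notin> V" using E(6) m(2) by blast
  then show ?thesis using that m by blast
qed

lemma mid_X: "mid \<subseteq> X"
  using midE seg_subset edgeD by (metis subsetD subsetI)

text \<open>A point of \<open>mid\<close> is the midpoint of some edge and is no vertex, so this
  edge is the given one up to orientation.\<close>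

lemma mid_unique:
  assumes e: "(x, y) \<in> Ed" and m: "m \<in> mid" "m \<in> sg x y" and n: "n \<in> mid" "n \<in> sg x y"
  shows "m = n"
proof -
  have *: "d x m = d m y" if m: "m \<in> mid" "m \<in> sg x y" for m
  proof -
    obtain u v where uv: "(u, v) \<in> Ed" "m \<in> sg u v" "d u m = d m v" "m \<notin> V" using midE m by metis
    have "u = x \<and> v = y \<or> u = y \<and> v = x" using edge_unique[OF e uv(1) m(2) uv(2,4)] .
    then show ?thesis using uv(3) d_comm[of m x] d_comm[of m y] by auto
  qed
  show ?thesis using midpoint_unique[OF edgeD(3,4)[OF e] m(2) *[OF m] n(2) *[OF n]] .
qed

lemma mid_finite_seg:
  assumes V: "u \<in> V" "w \<in> V"
  shows "finite ((V \<union> mid) \<inter> sg u w)"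
proof -
  define P where "P = (V \<inter> sg u w) \<times> (V \<inter> sg u w) \<inter> Ed"
  have "finite P" unfolding P_def using fin_seg[OF V] by simp
  moreover have "finite (mid \<inter> sg (fst e) (snd e))" if "e \<in> P" for e
  proof -
    have "(fst e, snd e) \<in> Ed" using that unfolding P_def by simp
    then have "\<forall>m\<in>mid \<inter> sg (fst e) (snd e). \<forall>n\<in>mid \<inter> sg (fst e) (snd e). m = n"
      using mid_unique by blast
    then have "\<exists>m. mid \<inter> sg (fst e) (snd e) \<subseteq> {m}" by blast
    then show ?thesis using finite_subset by blast
  qed
  ultimately have "finite (\<Union>e\<in>P. mid \<inter> sg (fst e) (snd e))" by blast
  moreover have "mid \<inter> sg u w \<subseteq> (\<Union>e\<in>P. mid \<inter> sg (fst e) (snd e))"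
  proof
    fix m assume m: "m \<in> mid \<inter> sg u w"
    then have "m \<notin> V" using midE by (metis IntD1)
    then obtain a b where ab: "(a, b) \<in> Ed" "m \<in> sg a b" "a \<in> sg u w" "b \<in> sg u w"
      using edge_in_seg[OF V] m by blast
    then have "(a, b) \<in> P" unfolding P_def using edgeD by blast
    then show "m \<in> (\<Union>e\<in>P. mid \<inter> sg (fst e) (snd e))" using m ab by force
  qed
  ultimately have "finite (mid \<inter> sg u w)" using finite_subset by blast
  then show ?thesis using fin_seg[OF V] by (simp add: Int_Un_distrib2)
qed

lemma mid_finite_seg':
  assumes x: "x \<in> V \<union> mid" and y: "y \<in> V \<union> mid"
  shows "finite ((V \<union> mid) \<inter> sg x y)"
proof -
  have near: "\<exists>a b. a \<in> V \<and> b \<in> V \<and> x \<in> sg a b" if x: "x \<in> V \<union> mid" for x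
  proof (cases "x \<in> V")
    case True
    then show ?thesis using V_X by (metis seg_ends(1) subsetD)
  next
    case False
    then have "x \<in> mid" using x by blast
    then obtain a b where "(a, b) \<in> Ed" "x \<in> sg a b" by (rule midE)
    then show ?thesis using edgeD by blast
  qed
  obtain a a' where a: "a \<in> V" "a' \<in> V" "x \<in> sg a a'" using near[OF x] by blast
  obtain b b' where b: "b \<in> V" "b' \<in> V" "y \<in> sg b b'" using near[OF y] by blast
  have X: "a \<in> X" "a' \<in> X" "b \<in> X" "b' \<in> X" using a b V_X by auto
  have xy: "x \<in> X" "y \<in> X" using a b seg_subset X by blast+
  have "sg x a \<subseteq> sg a a'" using seg_mono[OF X(1,2) a(3), of a] X by simp
  moreover have "sg b y \<subseteq> sg b b'" using seg_mono[OF X(3,4) _ b(3), of b] X by simp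
  moreover have "sg x y \<subseteq> sg x a \<union> (sg a b \<union> sg b y)"
    using seg_triangle[OF xy(1) X(1) xy(2)] seg_triangle[OF X(1,3) xy(2)] by blast
  ultimately have "(V \<union> mid) \<inter> sg x y
      \<subseteq> ((V \<union> mid) \<inter> sg a a') \<union> ((V \<union> mid) \<inter> sg a b) \<union> ((V \<union> mid) \<inter> sg b b')" by blast
  moreover have "finite (((V \<union> mid) \<inter> sg a a') \<union> ((V \<union> mid) \<inter> sg a b) \<union> ((V \<union> mid) \<inter> sg b b'))"
    using mid_finite_seg a b by simp
  ultimately show ?thesis by (rule finite_subset)
qed

text \<open>A refined edge stays inside one old edge, for otherwise it would contain an old vertex
  in its interior; this is \<open>ends\<close>. Within a single old edge, refined edges are gaps
  between consecutive points, and \<open>adjacent_unique\<close> applies.\<close>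

lemma simplicial_mid: "simplicial_structure M (V \<union> mid)"
proof -
  let ?W = "V \<union> mid"
  have WX: "?W \<subseteq> X" using V_X mid_X by blast
  have E: "x \<in> ?W" "y \<in> ?W" "x \<in> X" "y \<in> X" "x \<noteq> y" "sg x y \<inter> ?W = {x, y}"
    if "(x, y) \<in> tree_edges M ?W" for x y
    using that WX unfolding tree_edges_def by auto
  have edge: "\<exists>x y. (x, y) \<in> tree_edges M ?W \<and> p \<in> sg x y" if p: "p \<in> X" "p \<notin> ?W" for p
  proof -
    have "p \<notin> V" using p by blast
    then obtain a b where ab: "(a, b) \<in> Ed" "p \<in> sg a b" using ex_edge p by blast
    note e = edgeD[OF ab(1)]
    obtain x y where "x \<in> ?W" "y \<in> ?W" "p \<in> sg x y" "x \<noteq> y" "sg x y \<inter> ?W = {x, y}"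
      by (rule adjacent_points[of a b ?W p])
        (use e ab p mid_finite_seg[OF e(1,2)] in auto)
    then show ?thesis unfolding tree_edges_def by blast
  qed
  have ends: "x \<in> sg a b" if xy: "(x, y) \<in> tree_edges M ?W" and ab: "(a, b) \<in> Ed"
    and p: "p \<in> sg x y" "p \<in> sg a b" "p \<notin> ?W" for x y a b p
  proof (rule ccontr)
    assume out: "x \<notin> sg a b"
    note e = E[OF xy] and e' = edgeD[OF ab]
    have pX: "p \<in> X" using p seg_subset e by blast
    obtain z where z: "z \<in> {a, b}" "z \<in> sg p x" using exit_edge[OF ab p(2) e(3) out] by blast
    have zX: "z \<in> X" "z \<in> ?W" "z \<in> sg a b" using z e' by auto
    have "sg p x \<subseteq> sg x y" using seg_mono[OF e(3,4) p(1), of x] e by simp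
    then have "z \<in> {x, y}" using e(6) z zX by blast
    moreover have "z \<noteq> x" using out zX by blast
    ultimately have "y \<in> sg p x" using z by blast
    then have "p = y" using seg_antisym[OF pX e(3,4) _ p(1)] by blast
    then show False using p e by blast
  qed
  have meet: "sg x y \<inter> sg u v \<subseteq> ?W"
    if xy: "(x, y) \<in> tree_edges M ?W" and uv: "(u, v) \<in> tree_edges M ?W" and ne: "{x, y} \<noteq> {u, v}"
    for x y u v
  proof
    fix p assume p: "p \<in> sg x y \<inter> sg u v"
    show "p \<in> ?W"
    proof (rule ccontr)
      assume pW: "p \<notin> ?W"
      note e = E[OF xy] and e' = E[OF uv]
      have yx: "(y, x) \<in> tree_edges M ?W" "(v, u) \<in> tree_edges M ?W"
        using xy uv seg_comm[OF e(3,4)] seg_comm[OF e'(3,4)] unfolding tree_edges_def by auto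
      have p': "p \<in> sg y x" "p \<in> sg v u" using p seg_comm e e' by auto
      have "p \<in> X" using p seg_subset e by blast
      then obtain a b where ab: "(a, b) \<in> Ed" "p \<in> sg a b" using ex_edge pW by blast
      have in1: "x \<in> sg a b" "y \<in> sg a b" "u \<in> sg a b" "v \<in> sg a b"
        using ends[OF xy ab(1) _ ab(2) pW] ends[OF yx(1) ab(1) _ ab(2) pW]
          ends[OF uv ab(1) _ ab(2) pW] ends[OF yx(2) ab(1) _ ab(2) pW] p p' by blast+
      have "{x, y} = {u, v}"
        by (rule adjacent_unique[OF edgeD(3,4)[OF ab(1)] in1 e(6) e'(6) _ _ pW]) (use p in auto)
      then show False using ne by simp
    qed
  qed
  have "X = ?W \<union> (\<Union>(x, y)\<in>tree_edges M ?W. sg x y)"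
  proof
    show "X \<subseteq> ?W \<union> (\<Union>(x, y)\<in>tree_edges M ?W. sg x y)" using edge by blast
    have "sg x y \<subseteq> X" if "(x, y) \<in> tree_edges M ?W" for x y using seg_subset E[OF that] by blast
    then show "?W \<union> (\<Union>(x, y)\<in>tree_edges M ?W. sg x y) \<subseteq> X" using WX by blast
  qed
  then show ?thesis
    unfolding simplicial_structure_def using WX mid_finite_seg' meet by blast
qed

text \<open>Conjugating an inversion by \<open>g\<close> gives an inversion of the translated
  edge.\<close>

lemma mid_act: 
  assumes g: "g \<in> FF"
  shows "act g ` mid \<subseteq> mid"
proof
  fix z assume "z \<in> act g ` mid"
  then obtain m where m: "m \<in> mid" "z = act g m" by blast
  then obtain x y h where xy: "(x, y) \<in> Ed" "h \<in> FF" "act h x = y" "act h y = x"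
    "m \<in> sg x y" "d x m = d m y" unfolding mid_def by blast
  note e = edgeD[OF xy(1)]
  have mX: "m \<in> X" using xy seg_subset e by blast
  define k where "k = g \<otimes>\<^bsub>F\<^esub> h \<otimes>\<^bsub>F\<^esub> inv\<^bsub>F\<^esub> g"
  have k: "k \<in> FF" "act k (act g u) = act g (act h u)" if "u \<in> X" for u
    unfolding k_def using g xy(2) act_mult act_X act_inv that by auto
  have "act k (act g x) = act g y" "act k (act g y) = act g x" "k \<in> FF" using k e xy by auto
  moreover have "z \<in> sg (act g x) (act g y)" unfolding m using act_seg[OF g e(3,4) xy(5)] .
  moreover have "d (act g x) z = d z (act g y)" unfolding m using act_iso[OF g] e mX xy(6) by simp
  ultimately show "z \<in> mid" unfolding mid_def using act_edge[OF g xy(1)] by blast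
qed

lemma outer_space_subdivision: "outer_space F M (subdivision F M \<phi> V) \<phi>"
proof -
  have "act g ` (V \<union> mid) = V \<union> mid" if g: "g \<in> FF" for g
  proof
    show "act g ` (V \<union> mid) \<subseteq> V \<union> mid" using mid_act[OF g] act_V_image[OF g] by blast
    show "V \<union> mid \<subseteq> act g ` (V \<union> mid)"
    proof
      fix z assume z: "z \<in> V \<union> mid"
      have "act (inv\<^bsub>F\<^esub> g) z \<in> V \<union> mid"
        using z act_V[of "inv\<^bsub>F\<^esub> g"] mid_act[of "inv\<^bsub>F\<^esub> g"] g by blast
      moreover have "z = act g (act (inv\<^bsub>F\<^esub> g) z)" using act_inv' g z V_X mid_X by (metis UnE subsetD)
      ultimately show "z \<in> act g ` (V \<union> mid)" by blast
    qed
  qed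
  then show ?thesis
    using outer simplicial_mid unfolding outer_space_def subdivision_eq by blast
qed

end

text \<open>If the basis of the free subgroup were empty, the subgroup would be trivial, hence
  commutative. Otherwise the powers of one basis element give infinitely many reduced words.\<close>

lemma infinite_virtually_nonabelian_free:
  assumes "group F" "virtually_nonabelian_free F"
  shows "infinite (carrier F)"
proof
  assume fin: "finite (carrier F)"
  obtain H where H: "subgroup H F" "free_group (F\<lparr>carrier := H\<rparr>)" "\<not> comm_group (F\<lparr>carrier := H\<rparr>)"
    using assms unfolding virtually_nonabelian_free_def by blast
  let ?H = "F\<lparr>carrier := H\<rparr>"
  obtain Y where Y: "bij_betw (word_value ?H) (reduced_words Y) (carrier ?H)" and gH: "group ?H"
    using H(2) unfolding free_group_def by blast
  have "H \<subseteq> carrier F" using H(1) by (rule subgroup.subset)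
  then have "finite (reduced_words Y)"
    using bij_betw_finite[OF Y] fin finite_subset by auto
  show False
  proof (cases "Y = {}")
    case True
    have "reduced_words Y \<subseteq> {[]}" unfolding reduced_words_def True by auto
    then have "carrier ?H \<subseteq> {word_value ?H []}" using Y unfolding bij_betw_def by blast
    then have "\<And>x y. x \<in> carrier ?H \<Longrightarrow> y \<in> carrier ?H \<Longrightarrow> x = y" by blast
    then have "comm_group ?H" using group.group_comm_groupI[OF gH] by metis
    then show False using H by simp
  next
    case False
    then obtain y where y: "y \<in> Y" by blast
    have "replicate n (y, True) \<in> reduced_words Y" for n
      unfolding reduced_words_def using y by (auto simp: successively_conv_nth)
    moreover have "inj (\<lambda>n. replicate n (y, True))" by (intro injI) (metis length_replicate)
    ultimately show False
      using \<open>finite (reduced_words Y)\<close> infinite_UNIV_nat inj_on_finite by blast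
  qed
qed


section \<open>Legal cyclic words\<close>

lemma map_eq_split:
  assumes "v \<in> f ` set w"
  obtains P a A where "w = P @ a # A" "f a = v"
  using assms by (metis imageE split_list)

lemma not_distinct_map_split:
  assumes "\<not> distinct (map f w)"
  obtains P a A b B where "w = P @ (a # A) @ (b # B)" "f a = f b"
  using assms
proof (induction w arbitrary: thesis)
  case (Cons x w)
  show ?case
  proof (cases "f x \<in> f ` set w")
    case True
    then obtain A b B where "w = A @ b # B" "f b = f x" by (metis map_eq_split)
    then show ?thesis using Cons(2)[of "[]" x A b B] by simp
  next
    case False
    then have "\<not> distinct (map f w)" using Cons(3) by simp
    then obtain P a A b B where "w = P @ (a # A) @ (b # B)" "f a = f b" using Cons(1) by blast
    then show ?thesis using Cons(2)[of "x # P" a A b B] by simp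
  qed
qed simp

lemma count_list_Suc_split:
  assumes "count_list (map f w) v \<ge> Suc n"
  obtains P a A where "w = P @ a # A" "f a = v" "count_list (map f A) v \<ge> n"
  using assms
proof (induction w arbitrary: thesis)
  case (Cons x w)
  show ?case
  proof (cases "f x = v")
    case True
    then show ?thesis using Cons(2)[of "[]" x w] Cons(3) by simp
  next
    case False
    then have "count_list (map f w) v \<ge> Suc n" using Cons(3) by simp
    then obtain P a A where "w = P @ a # A" "f a = v" "count_list (map f A) v \<ge> n"
      using Cons(1) by blast
    then show ?thesis using Cons(2)[of "x # P" a A] by simp
  qed
qed simp

lemma mod_two_cycle:
  assumes "b = Suc a mod n" "a = Suc b mod n" "a < n" "b < n" "a \<noteq> b"
  shows "n = (2::nat)"
proof (cases "Suc a = n")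
  case True
  then have "b = 0" using assms(1) by simp
  then show ?thesis using assms(2,5) True by (cases "n = 1") auto
next
  case False
  then have b: "b = Suc a" using assms(1,3) by simp
  then have n: "Suc b = n" using assms(2,4) by (cases "Suc b = n") auto
  then have "a = 0" using assms(2) by (metis mod_self)
  then show ?thesis using b n by simp
qed

text \<open>\<open>N a b\<close> says that no path in the graph of groups may leave along \<open>b\<close> after arriving along the
  reverse of \<open>a\<close>, whatever vertex group element is inserted. A legal word is a cyclic word all of
  whose turns are allowed.\<close>

locale turns =
  fixes Q :: "('v, 'e, 'g) graph_of_groups" and D :: "'e set" and N :: "'e \<Rightarrow> 'e \<Rightarrow> bool"
  assumes D_finite: "finite D" and D_edges: "D \<subseteq> edges Q"
    and bar_D: "e \<in> D \<Longrightarrow> bar Q e \<in> D"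
    and bar_bar: "e \<in> D \<Longrightarrow> bar Q (bar Q e) = e"
    and bar_ne: "e \<in> D \<Longrightarrow> bar Q e \<noteq> e"
    and N_sym: "\<lbrakk>a \<in> D; b \<in> D; ini Q a = ini Q b; N a b\<rbrakk> \<Longrightarrow> N b a"
    and N_trans: "\<lbrakk>a \<in> D; b \<in> D; c \<in> D; ini Q a = ini Q b; ini Q b = ini Q c; N a b; N b c\<rbrakk> \<Longrightarrow> N a c"
    and N_ex: "a \<in> D \<Longrightarrow> \<exists>b\<in>D. ini Q b = ini Q a \<and> \<not> N a b"
begin

abbreviation i where "i \<equiv> ini Q"
abbreviation r where "r \<equiv> bar Q"
abbreviation t where "t \<equiv> ter Q"
abbreviation rp where "rp \<equiv> rev_path Q"

lemma t_r: "e \<in> D \<Longrightarrow> t (r e) = i e" and t_def: "t e = i (r e)"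
  by (auto simp: ter_def bar_bar)

text \<open>\<open>N\<close> compares two edges leaving a vertex, whereas a path arrives along
  \<open>a\<close>; hence the reversal of \<open>a\<close>.\<close>

definition T where "T a b \<longleftrightarrow> t a = i b \<and> \<not> N (r a) b"

definition legal where
  "legal w \<longleftrightarrow> w \<noteq> [] \<and> set w \<subseteq> D \<and> successively T w \<and> T (last w) (hd w)"

lemma T_rev: "a \<in> D \<Longrightarrow> b \<in> D \<Longrightarrow> T a b \<Longrightarrow> T (r b) (r a)"
  unfolding T_def using N_sym[of b "r a"] bar_D bar_bar t_r t_def by auto

lemma legal_append:
  assumes "A \<noteq> []" "B \<noteq> []"
  shows "legal (A @ B) \<longleftrightarrow> set A \<subseteq> D \<and> set B \<subseteq> D \<and> successively T A \<and> successively T B \<and>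
    T (last A) (hd B) \<and> T (last B) (hd A)"
  using assms unfolding legal_def by (auto simp: successively_append_iff)

lemma legal_rotate: "legal (A @ B) \<Longrightarrow> legal (B @ A)"
  by (cases "A = [] \<or> B = []") (auto simp: legal_append)

lemma rp_simps [simp]:
  "rp [] = []" "rp (A @ B) = rp B @ rp A" "rp [x] = [r x]" "rp A = [] \<longleftrightarrow> A = []"
  "length (rp A) = length A"
  by (auto simp: rev_path_def)

lemma rp_D: "set A \<subseteq> D \<Longrightarrow> set (rp A) \<subseteq> D"
  using bar_D by (auto simp: rev_path_def)

lemma rp_rp: "set A \<subseteq> D \<Longrightarrow> rp (rp A) = A"
proof -
  assume "set A \<subseteq> D"
  then have "map (r \<circ> r) A = A" using bar_bar by (intro map_idI) auto
  then show ?thesis by (simp add: rev_path_def rev_map)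
qed

lemma rp_hd: "A \<noteq> [] \<Longrightarrow> hd (rp A) = r (last A)"
  and rp_last: "A \<noteq> [] \<Longrightarrow> last (rp A) = r (hd A)"
  by (simp_all add: rev_path_def hd_rev last_rev last_map hd_map)

lemma rp_successively:
  assumes "set A \<subseteq> D" "successively T A"
  shows "successively T (rp A)"
  unfolding rev_path_def successively_rev successively_map
  by (rule successively_mono[OF assms(2)]) (use T_rev assms(1) in blast)

text \<open>Each edge has an allowed successor. Following successors in the finite set
  \<open>D\<close>, some edge recurs, and the stretch between two occurrences closes up
  legally.\<close>

lemma legal_exists:
  assumes "D \<noteq> {}"
  shows "\<exists>w. legal w"
proof -
  have "\<exists>b\<in>D. T a b" if "a \<in> D" for a
    unfolding T_def using N_ex[OF bar_D[OF that]] t_def by metis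
  then obtain s where s: "\<And>a. a \<in> D \<Longrightarrow> s a \<in> D \<and> T a (s a)" by metis
  obtain a where a: "a \<in> D" using assms by blast
  define f where "f n = (s ^^ n) a" for n
  have fD: "f n \<in> D" for n by (induction n) (auto simp: f_def a s)
  have fT: "T (f n) (f (Suc n))" for n using s[OF fD[of n]] by (simp add: f_def)
  have "\<not> inj f" using finite_subset[of "range f" D] D_finite fD finite_imageD[of f UNIV] by auto
  then obtain m n where mn: "m < n" "f m = f n"
    unfolding inj_def by (metis linorder_neqE_nat)
  have "legal (map f [m..<n])" unfolding legal_def
  proof (intro conjI)
    show "successively T (map f [m..<n])"
      unfolding successively_conv_nth using fT by auto
    have "last (map f [m..<n]) = f (n - 1)" using mn by (simp add: last_map)
    moreover have "hd (map f [m..<n]) = f n" using mn by (simp add: hd_map)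
    ultimately show "T (last (map f [m..<n])) (hd (map f [m..<n]))"
      using fT[of "n - 1"] mn by simp
  qed (use mn fD in auto)
  then show ?thesis by blast
qed

section \<open>Surgery on shortest legal words\<close>

definition minim where "minim w \<longleftrightarrow> legal w \<and> (\<forall>w'. legal w' \<longrightarrow> length w \<le> length w')"

lemma minim_exists: "D \<noteq> {} \<Longrightarrow> \<exists>w. minim w"
  unfolding minim_def using legal_exists ex_has_least_nat[of legal _ length] by blast

lemma minim_rotate: "minim (A @ B) \<Longrightarrow> minim (B @ A)"
  unfolding minim_def using legal_rotate by auto

lemma last_D: "A \<noteq> [] \<Longrightarrow> set A \<subseteq> D \<Longrightarrow> last A \<in> D"
  and hd_D: "A \<noteq> [] \<Longrightarrow> set A \<subseteq> D \<Longrightarrow> hd A \<in> D"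
  by (auto simp: subset_iff)

text \<open>If the turn closing up one of the two arcs were allowed, that arc alone would be a
  shorter legal word. This is the basic source of \<open>N\<close>-relations between the edges at a
  repeated vertex.\<close>

lemma minim_cut:
  assumes m: "minim (A @ B)" and ne: "A \<noteq> []" "B \<noteq> []" and eq: "i (hd A) = i (hd B)"
  shows "N (r (last A)) (hd A)" "N (r (last B)) (hd B)"
proof -
  have *: "N (r (last A)) (hd A)"
    if m: "minim (A @ B)" and ne: "A \<noteq> []" "B \<noteq> []" and eq: "i (hd A) = i (hd B)" for A B
  proof (rule ccontr)
    assume notN: "\<not> ?thesis"
    have "legal (A @ B)" using m unfolding minim_def by simp
    then have l: "set A \<subseteq> D" "successively T A" "T (last A) (hd B)" unfolding legal_append[OF ne] by auto
    then have "T (last A) (hd A)" using eq notN unfolding T_def by simp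
    then have "legal A" using l ne unfolding legal_def by simp
    then show False using m ne unfolding minim_def by fastforce
  qed
  show "N (r (last A)) (hd A)" using * assms by blast
  show "N (r (last B)) (hd B)" using *[of B A] minim_rotate assms by simp
qed

text \<open>The arcs \<open>A\<close>, \<open>C\<close> and \<open>C @ A\<close> cannot be closed
  up. The three resulting relations link \<open>hd A\<close>, \<open>r (last A)\<close>,
  \<open>hd C\<close> and \<open>r (last C)\<close>, and by transitivity they forbid the turn from
  \<open>C\<close> to \<open>A\<close> that the word itself makes.\<close>

lemma minim_triple:
  assumes m: "minim (A @ B @ C)" and ne: "A \<noteq> []" "B \<noteq> []" "C \<noteq> []"
    and eq: "i (hd A) = i (hd B)" "i (hd B) = i (hd C)"
  shows False
proof -
  have D: "set A \<subseteq> D" "set B \<subseteq> D" "set C \<subseteq> D" "T (last A) (hd B)" "T (last C) (hd A)"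
    using m ne unfolding minim_def legal_def by (auto simp: successively_append_iff)
  have mem: "r (last A) \<in> D" "hd A \<in> D" "r (last C) \<in> D" "hd C \<in> D"
    using bar_D last_D hd_D D(1,3) ne by blast+
  have v: "i (r (last A)) = i (hd A)" "i (r (last C)) = i (hd A)" "i (hd C) = i (hd A)"
    using D(4,5) eq unfolding T_def t_def by auto
  have "N (r (last A)) (hd A)" using minim_cut(1)[OF m] ne eq by simp
  then have 1: "N (hd A) (r (last A))" using N_sym[OF mem(1,2) v(1)] by blast
  have 2: "N (r (last C)) (hd C)"
    using minim_cut(1)[of C "A @ B"] minim_rotate[of "A @ B" C] m ne eq by simp
  have "minim ((C @ A) @ B)" using minim_rotate[of "A @ B" C] m by simp
  then have "N (r (last A)) (hd C)" using minim_cut(1)[of "C @ A" B] ne eq by simp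
  then have "N (hd A) (hd C)" using N_trans[OF mem(2,1,4) _ _ 1] v by metis
  then have "N (hd C) (hd A)" using N_sym[OF mem(2,4)] v by metis
  then have "N (r (last C)) (hd A)" using N_trans[OF mem(3,4,2) _ _ 2] v by metis
  then show False using D T_def by simp
qed

text \<open>If \<open>c\<close> were forbidden after \<open>a\<close>, so would be \<open>b\<close>,
  which is related to \<open>c\<close>. In this form transitivity produces the allowed turns of new
  words.\<close>

lemma N_notT:
  assumes "a \<in> D" "b \<in> D" "c \<in> D" "T a b" "i b = i c" "N b c \<or> N c b"
  shows "\<not> N (r a) c"
proof
  assume 1: "N (r a) c"
  have 2: "N c b" using assms N_sym by metis
  have v: "i (r a) = i c" "i c = i b" using assms(4,5) unfolding T_def t_def by auto
  have "N (r a) b" by (rule N_trans[OF bar_D[OF assms(1)] assms(3,2) v 1 2])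
  then show False using assms(4) T_def by blast
qed

text \<open>Two pairs of visits never interleave: otherwise one arc and the reverse of the opposite arc
  would form a shorter legal word.\<close>

lemma minim_crossing:
  assumes m: "minim (A @ B @ C @ E)" and ne: "A \<noteq> []" "B \<noteq> []" "C \<noteq> []" "E \<noteq> []"
    and eq: "i (hd A) = i (hd C)" "i (hd B) = i (hd E)"
  shows False
proof -
  have D: "set A \<subseteq> D" "set B \<subseteq> D" "set C \<subseteq> D" "set E \<subseteq> D" "T (last A) (hd B)" "T (last B) (hd C)"
    "T (last C) (hd E)" "T (last E) (hd A)" "successively T A" "successively T C"
    using m ne unfolding minim_def legal_def by (auto simp: successively_append_iff)
  note mem = last_D[OF ne(1) D(1)] hd_D[OF ne(1) D(1)] last_D[OF ne(2) D(2)] hd_D[OF ne(2) D(2)]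
    last_D[OF ne(3) D(3)] hd_D[OF ne(3) D(3)] last_D[OF ne(4) D(4)] hd_D[OF ne(4) D(4)]
  \<comment> \<open>The cuts along \<open>B @ C\<close> and \<open>A @ B\<close> relate
    \<open>r (last C)\<close> to \<open>hd B\<close> and \<open>r (last B)\<close> to
    \<open>hd A\<close>. Comparison with the turns of the word then shows that both new turns of
    \<open>A @ rp C\<close> are allowed.\<close>
  have "minim ((B @ C) @ (E @ A))" using minim_rotate[of A "B @ C @ E"] m by simp
  then have 1: "N (r (last C)) (hd B)" using minim_cut(1)[of "B @ C" "E @ A"] ne eq by simp
  have 2: "N (r (last B)) (hd A)" using minim_cut(1)[of "A @ B" "C @ E"] m ne eq by simp
  have "\<not> N (r (last A)) (r (last C))"
    by (rule N_notT[of _ "hd B"]) (use mem D bar_D 1 eq T_def t_def in auto)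
  then have a: "T (last A) (r (last C))" using D(5,7) eq mem unfolding T_def t_def by simp
  have "\<not> N (r (r (hd C))) (hd A)"
  proof
    assume "N (r (r (hd C))) (hd A)"
    then have "N (hd C) (hd A)" using mem bar_bar by simp
    then have "\<not> N (r (last B)) (hd A)"
      using N_notT[of "last B" "hd C" "hd A"] mem D eq by auto
    then show False using 2 by simp
  qed
  then have b: "T (r (hd C)) (hd A)" using eq mem bar_bar unfolding T_def t_def by simp
  have "legal (A @ rp C)"
    using legal_append[of A "rp C"] ne D rp_D rp_successively rp_hd rp_last a b by simp
  then show False using m ne unfolding minim_def by fastforce
qed

text \<open>Two loops \<open>A\<close> and \<open>C\<close> are joined by arcs \<open>B\<close> and
  \<open>E\<close>. Either arc can be replaced by the reverse of the other, the new turns being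
  allowed thanks to the cuts. The word with \<open>E\<close> used twice is not shorter than the
  given one, so \<open>B\<close> is at most as long as \<open>E\<close>, and the word with
  \<open>B\<close> used twice is again shortest.\<close>

lemma minim_barbell:
  assumes m: "minim (A @ B @ C @ E)" and ne: "A \<noteq> []" "B \<noteq> []" "C \<noteq> []" "E \<noteq> []"
    and eq: "i (hd A) = i (hd B)" "i (hd C) = i (hd E)"
  shows "minim (A @ B @ C @ rp B)"
proof -
  have D: "set A \<subseteq> D" "set B \<subseteq> D" "set C \<subseteq> D" "set E \<subseteq> D" "T (last A) (hd B)" "T (last B) (hd C)"
    "T (last C) (hd E)" "T (last E) (hd A)" "successively T A" "successively T B" "successively T C"
    "successively T E"
    using m ne unfolding minim_def legal_def by (auto simp: successively_append_iff)
  note mem = last_D[OF ne(1) D(1)] hd_D[OF ne(1) D(1)] last_D[OF ne(2) D(2)] hd_D[OF ne(2) D(2)]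
    last_D[OF ne(3) D(3)] hd_D[OF ne(3) D(3)] last_D[OF ne(4) D(4)] hd_D[OF ne(4) D(4)]
  have m2: "minim (C @ (E @ A @ B))" using minim_rotate[of "A @ B" "C @ E"] m by simp
  have N1: "N (r (last A)) (hd A)" "N (r (last E)) (hd B)"
    using minim_cut[OF m] ne eq by auto
  have N2: "N (r (last C)) (hd C)" "N (r (last B)) (hd E)"
    using minim_cut[OF m2] ne eq by auto
  have "\<not> N (r (last C)) (r (last B))"
    by (rule N_notT[of _ "hd E"]) (use mem D bar_D N2 eq T_def t_def in auto)
  then have a: "T (last C) (r (last B))" using D eq mem unfolding T_def t_def by simp
  have "\<not> N (r (last A)) (r (last E))"
    by (rule N_notT[of _ "hd B"]) (use mem D bar_D N1 eq T_def t_def in auto)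
  then have b: "T (last A) (r (last E))" using D eq mem unfolding T_def t_def by simp
  have "\<not> N (hd B) (hd A)"
    using N_notT[of "last A" "hd B" "hd A"] mem D eq N1 by auto
  then have c: "T (r (hd B)) (hd A)" using eq mem bar_bar unfolding T_def t_def by simp
  have "\<not> N (hd E) (hd C)"
    using N_notT[of "last C" "hd E" "hd C"] mem D eq N2 by auto
  then have d: "T (r (hd E)) (hd C)" using eq mem bar_bar unfolding T_def t_def by simp
  have l1: "legal (A @ B @ C @ rp B)"
    unfolding legal_def using ne D rp_D[OF D(2)] rp_successively rp_hd rp_last a c
    by (simp add: successively_append_iff)
  have l2: "legal (A @ rp E @ C @ E)"
    unfolding legal_def using ne D rp_D[OF D(4)] rp_successively rp_hd rp_last b d
    by (simp add: successively_append_iff)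
  have "length (A @ B @ C @ E) \<le> length (A @ rp E @ C @ E)" using m l2 unfolding minim_def by blast
  then have "length B \<le> length E" by simp
  then have "length (A @ B @ C @ rp B) \<le> length (A @ B @ C @ E)" by simp
  then show ?thesis using l1 m unfolding minim_def by (meson order_trans)
qed

lemma minim_count:
  assumes m: "minim w"
  shows "count_list (map i w) v \<le> 2"
proof (rule ccontr)
  assume "\<not> ?thesis"
  then have "count_list (map i w) v \<ge> Suc 2" by simp
  then obtain P a A where 1: "w = P @ a # A" "i a = v" "count_list (map i A) v \<ge> 2"
    by (rule count_list_Suc_split)
  then have "count_list (map i A) v \<ge> Suc 1" by simp
  then obtain P1 b B where 2: "A = P1 @ b # B" "i b = v" "count_list (map i B) v \<ge> 1"
    by (rule count_list_Suc_split)
  then have "count_list (map i B) v \<ge> Suc 0" by simp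
  then obtain P2 c C where 3: "B = P2 @ c # C" "i c = v" "count_list (map i C) v \<ge> 0"
    by (rule count_list_Suc_split)
  have "minim ((a # P1) @ (b # P2) @ (c # C @ P))"
    using minim_rotate[of P "a # A"] m 1 2 3 by simp
  then show False using minim_triple[of "a # P1" "b # P2" "c # C @ P"] 1 2 3 by simp
qed

section \<open>Vertex counts along paths\<close>

definition pth where "pth A \<longleftrightarrow> set A \<subseteq> D \<and> successively (\<lambda>e f. t e = i f) A"

lemma successively_pth: "successively T A \<Longrightarrow> set A \<subseteq> D \<Longrightarrow> pth A"
  unfolding pth_def by (auto intro: successively_mono simp: T_def)

lemma pth_edge_path: "pth A \<Longrightarrow> A \<noteq> [] \<Longrightarrow> edge_path Q A"
  unfolding pth_def edge_path_def using D_edges by auto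

text \<open>Each inner vertex is the end of one edge and the start of the next, so the two counts
  differ only through the ends of the path.\<close>

lemma pth_count:
  assumes "pth A" "A \<noteq> []"
  shows "count_list (map t A) v + (if v = i (hd A) then 1 else 0)
    = count_list (map i A) v + (if v = t (last A) then 1 else 0)"
  using assms
proof (induction A)
  case (Cons a A)
  show ?case
  proof (cases "A = []")
    case False
    then have "pth A" "t a = i (hd A)" using Cons(2) by (auto simp: pth_def successively_Cons)
    then show ?thesis using Cons(1) False by (auto split: if_splits)
  qed auto
qed simp

lemma pth_verts:
  assumes "pth A" "A \<noteq> []"
  shows "path_verts Q A = insert (t (last A)) (i ` set A)"
proof -
  have *: "count_list (map t A) v > 0 \<longleftrightarrow> v \<in> t ` set A"
    "count_list (map i A) v > 0 \<longleftrightarrow> v \<in> i ` set A" for v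
    using count_list_0_iff[of "map t A" v] count_list_0_iff[of "map i A" v] by auto
  have "v \<in> t ` set A \<Longrightarrow> v = t (last A) \<or> v \<in> i ` set A" for v
    using pth_count[OF assms, of v] *[of v] by (auto split: if_splits)
  then show ?thesis unfolding path_verts_def using assms(2) by auto
qed

text \<open>Suppose an edge and its reverse both occur. As no vertex repeats, each is the cyclic
  successor of the other, so the path has length two. The exceptional path \<open>[e, r e]\<close>
  is the origin of the degenerate ends.\<close>

lemma closed_simple:
  assumes p: "pth w" "w \<noteq> []" and cl: "t (last w) = i (hd w)" and dist: "distinct (map i w)"
  shows "simple_loop Q w \<or> (\<exists>e\<in>D. w = [e, r e])"
proof (cases "set w \<inter> r ` set w = {}")
  case True
  then show ?thesis unfolding simple_loop_def start_def finish_def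
    using p cl dist pth_edge_path by simp
next
  case False
  let ?n = "length w"
  have n: "?n > 0" using p by simp
  have nxt: "t (w ! k) = i (w ! (Suc k mod ?n))" if "k < ?n" for k
  proof (cases "Suc k = ?n")
    case True
    then have "w ! k = last w" using p(2) by (metis diff_Suc_1 last_conv_nth)
    then show ?thesis using cl True p(2) by (simp add: hd_conv_nth)
  next
    case False
    then have "Suc k < ?n" using that by simp
    then show ?thesis using p(1) successively_nth unfolding pth_def by fastforce
  qed
  have inj: "j = k" if "i (w ! j) = i (w ! k)" "j < ?n" "k < ?n" for j k
    using dist that unfolding distinct_conv_nth by (metis length_map nth_map)
  obtain e where e: "e \<in> set w" "r e \<in> set w" using False p by auto
  then have eD: "e \<in> D" using p unfolding pth_def by blast
  obtain a b where ab: "a < ?n" "e = w ! a" "b < ?n" "r e = w ! b"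
    using e by (metis in_set_conv_nth)
  have "i (w ! b) = i (w ! (Suc a mod ?n))" using nxt[OF ab(1)] ab(2,4) t_def by metis
  then have "b = Suc a mod ?n" using inj ab(3) n by simp
  moreover have "i (w ! a) = i (w ! (Suc b mod ?n))" using nxt[OF ab(3)] ab(2,4) t_r[OF eD] by metis
  then have "a = Suc b mod ?n" using inj ab(1) n by simp
  moreover have "a \<noteq> b" using ab bar_ne[OF eD] by auto
  ultimately have "?n = 2" using ab(1,3) mod_two_cycle by blast
  then obtain x y where w: "w = [x, y]" by (metis (no_types) One_nat_def Suc_1 Suc_length_conv length_0_conv)
  have "a < 2" "b < 2" using ab \<open>?n = 2\<close> by auto
  then have "a = 0 \<and> b = 1 \<or> a = 1 \<and> b = 0" using \<open>a \<noteq> b\<close> by auto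
  then have "y = r x" using ab w bar_bar[OF eD] by auto
  moreover have "x \<in> D" using p w unfolding pth_def by simp
  ultimately show ?thesis using w by blast
qed

text \<open>A common shape for all words with a repeated vertex: closed arcs \<open>A\<close> and
  \<open>Y\<close>, joined by an arc \<open>X\<close> that is run through in both directions.
  \<open>X\<close> may be empty, as in a figure eight, and a closed arc may degenerate to
  \<open>[e, r e]\<close>.\<close>

definition dumbbell where
  "dumbbell A X Y \<longleftrightarrow> minim (A @ X @ Y @ rp X) \<and> A \<noteq> [] \<and> Y \<noteq> [] \<and> distinct (map i A) \<and>
     distinct (map i Y) \<and> i (hd A) = i (hd (X @ Y)) \<and> i (hd Y) = i (hd (rp X @ A))"

lemma dumbbell_D: "dumbbell A X Y \<Longrightarrow> set A \<subseteq> D \<and> set X \<subseteq> D \<and> set Y \<subseteq> D"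
  unfolding dumbbell_def minim_def legal_def by auto

lemma dumbbell_sym:
  assumes db: "dumbbell A X Y"
  shows "dumbbell Y (rp X) A"
proof -
  have "minim ((A @ X) @ (Y @ rp X))" using db unfolding dumbbell_def by simp
  then have "minim ((Y @ rp X) @ (A @ X))" by (rule minim_rotate)
  then show ?thesis using db rp_rp dumbbell_D[OF db] unfolding dumbbell_def by simp
qed

lemma dumbbell_pth:
  assumes db: "dumbbell A X Y"
  shows "pth A" "t (last A) = i (hd A)" "pth X" "X \<noteq> [] \<Longrightarrow> t (last X) = i (hd Y)"
proof -
  have s: "successively T (A @ (X @ Y) @ rp X)" and ne: "A \<noteq> []" "Y \<noteq> []"
    using db unfolding dumbbell_def minim_def legal_def by simp_all
  have s2: "successively T A" "successively T (X @ Y)" "T (last A) (hd ((X @ Y) @ rp X))"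
    using s ne unfolding successively_append_iff[of T A] successively_append_iff[of T "X @ Y"]
    by simp_all
  have l: "successively T A" "successively T X" "T (last A) (hd (X @ Y))"
    "X \<noteq> [] \<Longrightarrow> T (last X) (hd Y)"
    using s2 ne unfolding successively_append_iff[of T X Y] by (auto simp: hd_append)
  show "pth A" "pth X" using successively_pth l dumbbell_D[OF db] by auto
  show "t (last A) = i (hd A)" using l db unfolding T_def dumbbell_def by simp
  show "X \<noteq> [] \<Longrightarrow> t (last X) = i (hd Y)" using l unfolding T_def by simp
qed

lemma dumbbell_verts:
  assumes db: "dumbbell A X Y"
  shows "path_verts Q A = i ` set A"
proof -
  have "A \<noteq> []" using db unfolding dumbbell_def by simp
  then show ?thesis using pth_verts[OF dumbbell_pth(1)[OF db]] dumbbell_pth(2)[OF db] by auto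
qed

text \<open>A common vertex other than the start of \<open>A\<close> would alternate with that start
  along the word, against \<open>minim_crossing\<close>. If the start of \<open>A\<close> lies on
  \<open>Y\<close> and \<open>X\<close> is not empty, it is visited by \<open>A\<close>,
  \<open>X\<close> and \<open>Y\<close>, which is once too often; so \<open>X\<close> is empty and
  \<open>Y\<close> starts there too.\<close>

lemma dumbbell_disjoint:
  assumes db: "dumbbell A X Y"
  shows "path_verts Q A \<inter> path_verts Q Y \<subseteq> {i (hd A)} \<inter> {i (hd Y)}"
proof
  fix v assume v: "v \<in> path_verts Q A \<inter> path_verts Q Y"
  have ne: "A \<noteq> []" "Y \<noteq> []" and m: "minim (A @ X @ Y @ rp X)" and dA: "distinct (map i A)"
    and dY: "distinct (map i Y)" and st: "i (hd A) = i (hd (X @ Y))"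
    using db unfolding dumbbell_def by auto
  have "v \<in> i ` set A" "v \<in> i ` set Y"
    using v dumbbell_verts[OF db] dumbbell_verts[OF dumbbell_sym[OF db]] by auto
  then obtain A1 a A2 Y1 y Y2 where s: "A = A1 @ a # A2" "i a = v" "Y = Y1 @ y # Y2" "i y = v"
    by (metis map_eq_split)
  show "v \<in> {i (hd A)} \<inter> {i (hd Y)}"
  proof (cases "A1 = []")
    case True
    then have vA: "v = i (hd A)" using s by simp
    have "count_list (map i (A @ X @ Y @ rp X)) v \<le> 2" using minim_count m by blast
    moreover have "count_list (map i A) v \<ge> 1" "count_list (map i Y) v \<ge> 1" using s by auto
    moreover have "count_list (map i X) v \<ge> 1" if "X \<noteq> []" using st vA that by (cases X) auto
    ultimately have "X = []" by fastforce
    then show ?thesis using vA st by simp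
  next
    case A1: False
    show ?thesis
    proof (cases "X @ Y1 = []")
      case True
      then show ?thesis using s st by simp
    next
      case False
      have "i (hd A1) = i (hd (X @ Y1))" using st s A1 False by (cases X; cases Y1) auto
      then show ?thesis
        using minim_crossing[of A1 "a # A2" "X @ Y1" "y # Y2 @ rp X"] m s A1 False by simp
    qed
  qed
qed

text \<open>No vertex is visited more than twice, and \<open>X\<close> is run through twice. The
  return passage counts terminal vertices of \<open>X\<close>; \<open>pth_count\<close> converts
  these to initial ones, with corrections at the two ends of \<open>X\<close>.\<close>

lemma dumbbell_count:
  assumes db: "dumbbell A X Y" and X: "X \<noteq> []"
  shows "count_list (map i A) v + 2 * count_list (map i X) v + count_list (map i Y) v
    + (if v = i (hd Y) then 1 else 0) \<le> 2 + (if v = i (hd A) then 1 else (0::nat))"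
proof -
  have "count_list (map i (A @ X @ Y @ rp X)) v \<le> 2" using minim_count db unfolding dumbbell_def by blast
  moreover have "map i (rp X) = rev (map t X)"
    by (simp add: rev_path_def rev_map o_def t_def)
  moreover have "count_list (map t X) v + (if v = i (hd X) then 1 else 0)
    = count_list (map i X) v + (if v = t (last X) then 1 else 0)"
    using pth_count dumbbell_pth(3)[OF db] X by blast
  moreover have "i (hd A) = i (hd X)" using db X unfolding dumbbell_def by simp
  ultimately show ?thesis using dumbbell_pth(4)[OF db X] by simp
qed

lemma count_list_pos: "count_list (map i X) v \<ge> 1 \<longleftrightarrow> v \<in> i ` set X"
  using count_list_0_iff[of "map i X" v] by auto

lemma distinct_count: "(\<And>v. count_list (map f X) v \<le> 1) \<Longrightarrow> distinct (map f X)"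
proof (rule ccontr)
  assume c: "\<And>v. count_list (map f X) v \<le> 1" and "\<not> distinct (map f X)"
  then obtain P a A b B where "X = P @ (a # A) @ (b # B)" "f a = f b" by (metis not_distinct_map_split)
  then show False using c[of "f a"] by simp
qed

text \<open>All claims are read off \<open>dumbbell_count\<close>: at an inner vertex of
  \<open>X\<close> the two passages exhaust the two visits, and at either end of \<open>X\<close>
  there is room only for the one visit by the adjacent loop.\<close>

lemma dumbbell_segment:
  assumes db: "dumbbell A X Y" and X: "X \<noteq> []"
  shows "segment Q X" "path_verts Q X \<inter> path_verts Q A = {i (hd X)}"
    "path_verts Q X \<inter> path_verts Q Y = {i (hd Y)}" "i (hd Y) \<notin> i ` set X" "i (hd A) = i (hd X)"
proof -
  note c = dumbbell_count[OF db X]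
  have ne: "A \<noteq> []" "Y \<noteq> []" and st: "i (hd A) = i (hd X)"
    using db X unfolding dumbbell_def by auto
  have s: "count_list (map i A) (i (hd A)) \<ge> 1" "count_list (map i X) (i (hd A)) \<ge> 1"
    "count_list (map i Y) (i (hd Y)) \<ge> 1"
    unfolding count_list_pos using imageI[OF hd_in_set[OF ne(1)], of i]
      imageI[OF hd_in_set[OF X], of i] imageI[OF hd_in_set[OF ne(2)], of i] st by simp_all
  have neq: "i (hd A) \<noteq> i (hd Y)"
  proof
    assume eq: "i (hd A) = i (hd Y)"
    show False using c[of "i (hd A)"] s eq by simp
  qed
  have f: "count_list (map i X) (i (hd Y)) = 0" "count_list (map i A) (i (hd Y)) = 0"
    using c[of "i (hd Y)"] s neq by auto
  show fX: "i (hd Y) \<notin> i ` set X" using f count_list_pos[of X "i (hd Y)"] by simp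
  show st2: "i (hd A) = i (hd X)" by (rule st)
  have "count_list (map i X) v \<le> 1" for v using c[of v] by (auto split: if_splits)
  then have dX: "distinct (map i X)" by (rule distinct_count)
  show "segment Q X"
    unfolding segment_def finish_def
    using dX fX dumbbell_pth(4)[OF db X] pth_edge_path[OF dumbbell_pth(3)[OF db] X] by auto
  have pX: "path_verts Q X = insert (i (hd Y)) (i ` set X)"
    using pth_verts[OF dumbbell_pth(3)[OF db] X] dumbbell_pth(4)[OF db X] by simp
  have pA: "path_verts Q A = i ` set A" and pY: "path_verts Q Y = i ` set Y"
    using dumbbell_verts[OF db] dumbbell_verts[OF dumbbell_sym[OF db]] by auto
  have X0: "v \<notin> i ` set A \<and> v \<notin> i ` set Y" if "v \<in> i ` set X" "v \<noteq> i (hd A)" for v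
    using c[of v] that count_list_pos[of X v] count_list_pos[of A v] count_list_pos[of Y v]
    by (auto split: if_splits)
  have Y0: "i (hd A) \<notin> i ` set Y"
    using c[of "i (hd A)"] s neq count_list_pos[of Y "i (hd A)"] by auto
  have A0: "i (hd Y) \<notin> i ` set A" using f count_list_pos[of A "i (hd Y)"] by simp
  have hds: "i (hd X) \<in> i ` set A" "i (hd X) \<in> i ` set X" "i (hd Y) \<in> i ` set Y"
    using imageI[OF hd_in_set[OF ne(1)], of i] imageI[OF hd_in_set[OF X], of i]
      imageI[OF hd_in_set[OF ne(2)], of i] st by simp_all
  show "path_verts Q X \<inter> path_verts Q A = {i (hd X)}"
    unfolding pX pA using X0[unfolded st] A0 hds by blast
  show "path_verts Q X \<inter> path_verts Q Y = {i (hd Y)}"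
  proof -
    have "v \<notin> i ` set Y" if "v \<in> i ` set X" for v
      using X0[unfolded st, OF that] Y0[unfolded st] by (cases "v = i (hd X)") auto
    then show ?thesis unfolding pX pY using hds by blast
  qed
qed

lemma dumbbell_cases:
  assumes db: "dumbbell A X Y"
  shows "simple_loop Q A \<or> (\<exists>e\<in>D. A = [e, r e])"
  using closed_simple[of A] dumbbell_pth(1,2)[OF db] db unfolding dumbbell_def by blast

lemma dumbbell_X_Nil: "dumbbell A [] Y \<Longrightarrow> i (hd A) = i (hd Y)"
  unfolding dumbbell_def append_Nil by blast

text \<open>A common edge would have both ends at the common vertex, so \<open>A\<close> and
  \<open>Y\<close> would be single edges. If these are equal, one of them alone is a shorter legal
  word. If they are reverse to each other, the cut relates \<open>f\<close> to \<open>e\<close>,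
  hence \<open>f\<close> to itself by symmetry and transitivity, which forbids a turn of the
  word.\<close>

lemma dumbbell_figure_eight:
  assumes db: "dumbbell A [] Y" and sA: "simple_loop Q A" and sY: "simple_loop Q Y"
  shows "path_verts Q A \<inter> path_verts Q Y = {start Q A}" "set A \<inter> (set Y \<union> r ` set Y) = {}"
proof -
  have ne: "A \<noteq> []" "Y \<noteq> []" and m: "minim (A @ Y)" and dA: "distinct (map i A)"
    and dY: "distinct (map i Y)" using db unfolding dumbbell_def by auto
  note D = dumbbell_D[OF db]
  have st: "i (hd A) = i (hd Y)" using dumbbell_X_Nil[OF db] .
  have "i (hd A) \<in> i ` set A" "i (hd A) \<in> i ` set Y"
    using imageI[OF hd_in_set[OF ne(1)], of i] imageI[OF hd_in_set[OF ne(2)], of i] st by simp_all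
  then show "path_verts Q A \<inter> path_verts Q Y = {start Q A}"
    unfolding start_def using dumbbell_disjoint[OF db] unfolding path_verts_def by auto
  \<comment> \<open>An edge from the start of a closed path back to it leaves no room for other
    edges when no vertex repeats.\<close>
  have one: "B = [e]" if "e \<in> set B" "distinct (map i B)" "i e = v" "t e = v" "pth B" "i (hd B) = v"
    "t (last B) = v" for B e v
  proof -
    obtain B1 B2 where B: "B = B1 @ e # B2" using \<open>e \<in> set B\<close> by (metis split_list)
    then have "B1 = []" using that by (cases B1) auto
    moreover have "B2 = []"
    proof (rule ccontr)
      assume B2: "B2 \<noteq> []"
      then have "i (hd B2) = v" using that B \<open>B1 = []\<close> by (auto simp: pth_def successively_Cons)
      then show False using that B \<open>B1 = []\<close> B2 by (cases B2) auto
    qed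
    ultimately show ?thesis using B by simp
  qed
  note pA = dumbbell_pth(1,2)[OF db] and pY = dumbbell_pth(1,2)[OF dumbbell_sym[OF db]]
  show "set A \<inter> (set Y \<union> r ` set Y) = {}"
  proof (rule ccontr)
    assume "\<not> ?thesis"
    then obtain e f where e: "e \<in> set A" "f \<in> set Y" "e = f \<or> e = r f" by blast
    have fD: "f \<in> D" "e \<in> D" using e D by auto
    have "i e \<in> path_verts Q A" "t e \<in> path_verts Q A" "i f \<in> path_verts Q Y" "t f \<in> path_verts Q Y"
      using e unfolding path_verts_def by auto
    moreover have "{i e, t e} = {i f, t f}" using e(3) t_r[OF fD(1)] t_def by auto
    ultimately have v: "i e = i (hd A)" "t e = i (hd A)" "i f = i (hd A)" "t f = i (hd A)"
      using dumbbell_disjoint[OF db] by (auto simp: doubleton_eq_iff)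
    have A: "A = [e]" using one[OF e(1) dA v(1,2) pA(1)] pA(2) by simp
    have Y: "Y = [f]" using one[OF e(2) dY v(3,4) pY(1)] pY(2) st by simp
    have leg: "T e f" "T f e" using m A Y unfolding minim_def legal_def by auto
    show False
    proof (cases "e = f")
      case True
      then have "legal [e]" unfolding legal_def using leg fD by simp
      then show False using m A Y unfolding minim_def by fastforce
    next
      case False
      then have ef: "e = r f" using e by simp
      have "N (r e) e" using minim_cut(1)[OF m ne st] A by simp
      then have "N f e" using ef bar_bar fD by simp
      then have "\<not> N (r e) f"
        using N_notT[of e f f] leg fD v N_trans[of f e f] N_sym[of f e] by auto
      moreover have "N f f" using N_trans[of f e f] N_sym[of f e] \<open>N f e\<close> fD v by simp
      ultimately show False using ef bar_bar fD by simp
    qed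
  qed
qed

text \<open>The degenerate loop \<open>[y, r y]\<close> is one more step of the arc together with
  its reversal, so \<open>X\<close> is prolonged by \<open>y\<close>. That the new end is a new
  vertex follows from the disjointness known for dumbbells.\<close>

lemma dumbbell_singly:
  assumes db: "dumbbell A X [y, r y]"
  defines "\<sigma> \<equiv> X @ [y]"
  shows "segment Q \<sigma>" "i (hd \<sigma>) = i (hd A)" "path_verts Q \<sigma> \<inter> path_verts Q A = {i (hd A)}"
    "A @ X @ [y, r y] @ rp X = A @ \<sigma> @ rp \<sigma>" "y \<in> D" "set \<sigma> \<subseteq> D"
proof -
  note D = dumbbell_D[OF db]
  show yD: "y \<in> D" "set \<sigma> \<subseteq> D" using D unfolding \<sigma>_def by auto
  have dy: "i y \<noteq> t y" and ne: "A \<noteq> []" and st: "i (hd A) = i (hd (X @ [y, r y]))"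
    using db unfolding dumbbell_def t_def by auto
  show st': "i (hd \<sigma>) = i (hd A)" using st unfolding \<sigma>_def by (cases X) auto
  have pY: "path_verts Q [y, r y] = {i y, t y}" unfolding path_verts_def using t_r yD t_def by auto
  have edge: "y \<in> edges Q" using yD D_edges by auto
  show "A @ X @ [y, r y] @ rp X = A @ \<sigma> @ rp \<sigma>" unfolding \<sigma>_def by simp
  have dis: "path_verts Q A \<inter> {i y, t y} \<subseteq> {i (hd A)} \<inter> {i y}"
    using dumbbell_disjoint[OF db] pY by simp
  have pvs: "path_verts Q \<sigma> = path_verts Q X \<union> {i y, t y}"
    unfolding \<sigma>_def path_verts_def by auto
  have hdA: "i (hd A) \<in> path_verts Q A" using ne unfolding path_verts_def by auto
  show "segment Q \<sigma>"
  proof (cases "X = []")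
    case True
    then show ?thesis unfolding \<sigma>_def segment_def edge_path_def finish_def using edge dy by simp
  next
    case False
    note sX = dumbbell_segment[OF db False]
    have "t y \<notin> path_verts Q X"
    proof
      assume "t y \<in> path_verts Q X"
      then have "t y \<in> {i (hd [y, r y])}" unfolding sX(3)[symmetric] pY by simp
      then show False using dy by simp
    qed
    then have "t y \<notin> i ` set X" unfolding path_verts_def by auto
    then show ?thesis
      using sX(1,4) dy edge dumbbell_pth(4)[OF db False]
      unfolding \<sigma>_def segment_def edge_path_def finish_def by (auto simp: successively_append_iff)
  qed
  show "path_verts Q \<sigma> \<inter> path_verts Q A = {i (hd A)}"
  proof (cases "X = []")
    case True
    then have "i (hd A) = i y" "path_verts Q X = {}" using st by (auto simp: path_verts_def)
    then show ?thesis using pvs dis hdA by auto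
  next
    case False
    note sX = dumbbell_segment[OF db False]
    have "i (hd A) \<in> path_verts Q X" using sX(2,5) by auto
    then have "i (hd A) \<in> path_verts Q \<sigma> \<inter> path_verts Q A" using pvs hdA by simp
    moreover have "v = i (hd A)" if "v \<in> path_verts Q \<sigma>" "v \<in> path_verts Q A" for v
    proof (cases "v \<in> path_verts Q X")
      case True
      then have "v \<in> {i (hd X)}" unfolding sX(2)[symmetric] using that by simp
      then show ?thesis using sX(5) by simp
    next
      case False
      then have "v \<in> path_verts Q A \<inter> {i y, t y}" using that pvs by simp
      then show ?thesis using dis by blast
    qed
    ultimately show ?thesis by blast
  qed
qed

text \<open>Choose \<open>A\<close> as a shortest arc between two visits of a vertex, then
  \<open>Y\<close> as a shortest closed arc in a complement of \<open>A\<close>; minimality makes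
  both free of repetitions. The two arcs between them are both empty or both nonempty, as three
  visits are excluded, and \<open>minim_barbell\<close> turns the second into the reverse of the
  first.\<close>

lemma minim_dumbbell:
  assumes m: "minim w" and nd: "\<not> distinct (map i w)"
  shows "\<exists>A X Y. dumbbell A X Y"
proof -
  define P where "P A \<longleftrightarrow> (\<exists>B. minim (A @ B) \<and> A \<noteq> [] \<and> B \<noteq> [] \<and> i (hd A) = i (hd B))" for A
  obtain W a A b B where w: "w = W @ (a # A) @ (b # B)" "i a = i b"
    using nd by (rule not_distinct_map_split)
  have "minim ((a # A) @ (b # B @ W))" using minim_rotate[of W "(a # A) @ (b # B)"] m w by simp
  then have "P (a # A)" unfolding P_def using w(2) by (intro exI[of _ "b # B @ W"]) simp
  then obtain A where A: "P A" "\<And>A'. P A' \<Longrightarrow> length A \<le> length A'"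
    using ex_has_least_nat[of P _ length] by blast
  obtain B where B: "minim (A @ B)" "A \<noteq> []" "B \<noteq> []" "i (hd A) = i (hd B)"
    using A(1) unfolding P_def by blast
  have dA: "distinct (map i A)"
  proof (rule ccontr)
    assume "\<not> ?thesis"
    then obtain A1 a A2 b A3 where s: "A = A1 @ (a # A2) @ (b # A3)" "i a = i b"
      by (rule not_distinct_map_split)
    have "minim ((a # A2) @ (b # A3 @ B @ A1))" using minim_rotate[of A1 "(a # A2) @ (b # A3) @ B"] B s by simp
    then have "P (a # A2)" unfolding P_def using s(2) by (intro exI[of _ "b # A3 @ B @ A1"]) simp
    then have "length A \<le> length (a # A2)" using A(2) by blast
    then show False using s by simp
  qed
  define R where "R Y \<longleftrightarrow> (\<exists>X Z. minim (A @ X @ Y @ Z) \<and> Y \<noteq> [] \<and> i (hd Y) = i (hd (Z @ A)) \<and>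
    i (hd A) = i (hd (X @ Y)))" for Y
  \<comment> \<open>The whole complement of \<open>A\<close> is a candidate, with both connecting
    arcs empty.\<close>
  have "R B" unfolding R_def using B by (intro exI[of _ "[]"]) simp
  then obtain Y where Y: "R Y" "\<And>Y'. R Y' \<Longrightarrow> length Y \<le> length Y'"
    using ex_has_least_nat[of R _ length] by blast
  obtain X Z where XZ: "minim (A @ X @ Y @ Z)" "Y \<noteq> []" "i (hd Y) = i (hd (Z @ A))"
    "i (hd A) = i (hd (X @ Y))"
    using Y(1) unfolding R_def by blast
  have dY: "distinct (map i Y)"
  proof (rule ccontr)
    assume "\<not> ?thesis"
    then obtain A1 a A2 b A3 where s: "Y = A1 @ (a # A2) @ (b # A3)" "i a = i b"
      by (rule not_distinct_map_split)
    have "i (hd ((X @ A1) @ a # A2)) = i (hd (X @ Y))" using s by (cases X; cases A1) auto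
    then have "R (a # A2)" unfolding R_def using XZ s
      by (intro exI[of _ "X @ A1"] exI[of _ "(b # A3) @ Z"]) simp
    then have "length Y \<le> length (a # A2)" using Y(2) by blast
    then show False using s by simp
  qed
  have "X = [] \<longleftrightarrow> Z = []"
  proof
    assume "X = []"
    show "Z = []"
    proof (rule ccontr)
      assume "Z \<noteq> []"
      then show False using minim_triple[of A Y Z] XZ B(2) \<open>X = []\<close> by simp
    qed
  next
    assume "Z = []"
    show "X = []"
    proof (rule ccontr)
      assume "X \<noteq> []"
      have "i (hd A) = i (hd X)" using XZ(4) \<open>X \<noteq> []\<close> by simp
      moreover have "i (hd Y) = i (hd A)" using XZ(3) \<open>Z = []\<close> by simp
      moreover have "minim (A @ X @ Y)" using XZ(1) \<open>Z = []\<close> by simp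
      ultimately show False using minim_triple[OF _ B(2) \<open>X \<noteq> []\<close> XZ(2)] by metis
    qed
  qed
  then have "dumbbell A X Y"
  proof (cases "X = []")
    case True
    then have "Z = rp X" using \<open>X = [] \<longleftrightarrow> Z = []\<close> by simp
    then show ?thesis using XZ B(2) dA dY unfolding dumbbell_def by blast
  next
    case False
    then have Z: "Z \<noteq> []" using \<open>X = [] \<longleftrightarrow> Z = []\<close> by simp
    have "i (hd A) = i (hd X)" using XZ(4) False by simp
    moreover have "i (hd Y) = i (hd Z)" using XZ(3) Z by simp
    ultimately have mm: "minim (A @ X @ Y @ rp X)"
      using minim_barbell[OF XZ(1) B(2) False XZ(2) Z] by blast
    then have "successively T (A @ X @ Y @ rp X)" unfolding minim_def legal_def by blast
    then have "T (last X) (hd Y)" using False XZ(2) by (simp add: successively_append_iff)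
    then have "t (last X) = i (hd Y)" unfolding T_def by blast
    moreover have "i (hd (rp X @ A)) = t (last X)" using False rp_hd[OF False] t_def by simp
    ultimately have "i (hd Y) = i (hd (rp X @ A))" by simp
    then show ?thesis using mm XZ(2,4) B(2) dA dY unfolding dumbbell_def by blast
  qed
  then show ?thesis by blast
qed

text \<open>A shortest legal word without repeated vertices is a simple loop or
  \<open>[e, r e]\<close>. Otherwise a dumbbell is taken, and its form depends on which of the two
  closed arcs degenerate and on whether the connecting arc is empty.\<close>

theorem legal_form:
  assumes "D \<noteq> {}"
  shows "\<exists>w. legal w \<and>
    (simple_loop Q w \<or>
     (\<exists>\<alpha> \<beta>. w = \<alpha> @ \<beta> \<and>
        simple_loop Q \<alpha> \<and> simple_loop Q \<beta> \<and> start Q \<alpha> = start Q \<beta> \<and>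
        path_verts Q \<alpha> \<inter> path_verts Q \<beta> = {start Q \<alpha>} \<and> set \<alpha> \<inter> (set \<beta> \<union> bar Q ` set \<beta>) = {}) \<or>
     (\<exists>\<alpha> \<sigma> \<beta>. w = \<alpha> @ \<sigma> @ \<beta> @ rev_path Q \<sigma> \<and>
        simple_loop Q \<alpha> \<and> simple_loop Q \<beta> \<and> segment Q \<sigma> \<and>
        start Q \<sigma> = start Q \<alpha> \<and> finish Q \<sigma> = start Q \<beta> \<and> path_verts Q \<alpha> \<inter> path_verts Q \<beta> = {} \<and>
        path_verts Q \<sigma> \<inter> path_verts Q \<alpha> = {start Q \<sigma>} \<and>
        path_verts Q \<sigma> \<inter> path_verts Q \<beta> = {finish Q \<sigma>}) \<or>
     (\<exists>\<alpha> \<sigma>. w = \<alpha> @ \<sigma> @ rev_path Q \<sigma> \<and>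
        simple_loop Q \<alpha> \<and> segment Q \<sigma> \<and> start Q \<sigma> = start Q \<alpha> \<and>
        path_verts Q \<sigma> \<inter> path_verts Q \<alpha> = {start Q \<sigma>}) \<or>
     (\<exists>\<sigma>. w = \<sigma> @ rev_path Q \<sigma> \<and> segment Q \<sigma>))"
    (is "\<exists>w. legal w \<and> (simple_loop Q w \<or> ?fig w \<or> ?barb w \<or> ?sing w \<or> ?doub w)")
proof -
  have loop: ?thesis if "legal w" "simple_loop Q w" for w
    by (rule exI, rule conjI, rule that(1), rule disjI1, rule that(2))
  have fig: ?thesis if "legal w" "?fig w" for w
    by (rule exI, rule conjI, rule that(1), rule disjI2, rule disjI1, rule that(2))
  have barb: ?thesis if "legal w" "?barb w" for w
    by (rule exI, rule conjI, rule that(1), rule disjI2, rule disjI2, rule disjI1, rule that(2))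
  have sing: ?thesis if "legal w" "?sing w" for w
    by (rule exI, rule conjI, rule that(1), rule disjI2, rule disjI2, rule disjI2, rule disjI1,
        rule that(2))
  have doub: ?thesis if "legal w" "?doub w" for w
    by (rule exI, rule conjI, rule that(1), rule disjI2, rule disjI2, rule disjI2, rule disjI2,
        rule that(2))
  obtain w where m: "minim w" using minim_exists assms by blast
  show ?thesis
  proof (cases "distinct (map i w)")
    case True
    have l: "legal w" using m unfolding minim_def by simp
    then have w: "pth w" "w \<noteq> []" "t (last w) = i (hd w)"
      using successively_pth unfolding legal_def T_def by auto
    consider "simple_loop Q w" | e where "e \<in> D" "w = [e, r e]" using closed_simple[OF w True] by blast
    then show ?thesis
    proof cases
      case 1
      with l show ?thesis by (rule loop)
    next
      case 2
      then have "segment Q [e]"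
        using True D_edges unfolding segment_def edge_path_def finish_def t_def by auto
      then have "?doub w" using 2 by (intro exI[of _ "[e]"]) simp
      with l show ?thesis by (rule doub)
    qed
  next
    case False
    then obtain A X Y where db: "dumbbell A X Y" using minim_dumbbell m by blast
    have degen: ?thesis if db: "dumbbell A X Y" and A: "simple_loop Q A" and Y: "Y = [y, r y]" for A X Y y
    proof -
      have l: "legal (A @ X @ Y @ rp X)" using db unfolding dumbbell_def minim_def by simp
      note s = dumbbell_singly[OF db[unfolded Y]]
      have "start Q (X @ [y]) = start Q A"
        "path_verts Q (X @ [y]) \<inter> path_verts Q A = {start Q (X @ [y])}"
        using s(2,3) unfolding start_def by simp_all
      then have "?sing (A @ X @ Y @ rp X)" using s(1,4) A unfolding Y by blast
      with l show ?thesis by (rule sing)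
    qed
    consider "simple_loop Q A" "simple_loop Q Y" | y where "simple_loop Q A" "Y = [y, r y]"
      | a where "simple_loop Q Y" "A = [a, r a]" | a y where "A = [a, r a]" "Y = [y, r y]"
      using dumbbell_cases[OF db] dumbbell_cases[OF dumbbell_sym[OF db]] by blast
    then show ?thesis
    proof cases
      case 1
      have l: "legal (A @ X @ Y @ rp X)" using db unfolding dumbbell_def minim_def by simp
      show ?thesis
      proof (cases "X = []")
        case True
        have w: "A @ X @ Y @ rp X = A @ Y" using True by simp
        have "start Q A = start Q Y" unfolding start_def using dumbbell_X_Nil[OF db[unfolded True]] .
        then have "?fig (A @ X @ Y @ rp X)"
          using dumbbell_figure_eight[OF db[unfolded True] 1] 1 w by blast
        with l show ?thesis by (rule fig)
      next
        case False
        note s = dumbbell_segment[OF db False]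
        have "i (hd X) \<in> i ` set X" using imageI[OF hd_in_set[OF False]] .
        then have "i (hd A) \<noteq> i (hd Y)" using s(4,5) by metis
        then have "path_verts Q A \<inter> path_verts Q Y = {}" using dumbbell_disjoint[OF db] by auto
        moreover have "start Q X = start Q A" "finish Q X = start Q Y"
          "path_verts Q X \<inter> path_verts Q A = {start Q X}"
          "path_verts Q X \<inter> path_verts Q Y = {finish Q X}"
          using s(2,3,5) dumbbell_pth(4)[OF db False] unfolding start_def finish_def by simp_all
        ultimately have "?barb (A @ X @ Y @ rp X)" using s(1) 1 by blast
        with l show ?thesis by (rule barb)
      qed
    next
      case 2
      with db show ?thesis by (rule degen)
    next
      case 3
      with dumbbell_sym[OF db] show ?thesis by (rule degen)
    next
      case 4
      note s = dumbbell_singly[OF db[unfolded 4(2)]]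
      \<comment> \<open>Both closed arcs degenerate. Read from one edge later, the word is a path
        followed by its reverse, and its turning points are the far ends of \<open>a\<close> and
        \<open>y\<close>.\<close>
      define \<sigma> where "\<sigma> = r a # X @ [y]"
      have aD: "a \<in> D" "set X \<subseteq> D" using dumbbell_D[OF db] 4 by auto
      have "legal ([a] @ (r a # X @ Y @ rp X))" using db 4 unfolding dumbbell_def minim_def by simp
      then have "legal ((r a # X @ Y @ rp X) @ [a])" by (rule legal_rotate)
      moreover have "rp \<sigma> = r y # rp X @ [a]"
        using bar_bar[OF aD(1)] rp_simps(2)[of "[r a]" "X @ [y]"] unfolding \<sigma>_def by simp
      ultimately have l: "legal (\<sigma> @ rp \<sigma>)" unfolding \<sigma>_def 4 by simp
      have at: "i a \<noteq> t a" using db 4 unfolding dumbbell_def t_def by auto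
      have "t a \<in> path_verts Q A" unfolding path_verts_def 4 t_def by auto
      have "t a \<notin> path_verts Q (X @ [y])"
      proof
        assume "t a \<in> path_verts Q (X @ [y])"
        with \<open>t a \<in> path_verts Q A\<close> have "t a \<in> {i (hd A)}" unfolding s(3)[symmetric] by simp
        then show False using at 4 by simp
      qed
      then have "t a \<notin> i ` set (X @ [y])" "t a \<noteq> t y" unfolding path_verts_def by auto
      then have "segment Q \<sigma>"
        using s(1,2) 4 aD D_edges bar_D[OF aD(1)] t_r[OF aD(1)] t_def
        unfolding \<sigma>_def segment_def edge_path_def finish_def by (auto simp: successively_Cons)
      then have "?doub (\<sigma> @ rp \<sigma>)" by blast
      with l show ?thesis by (rule doub)
    qed
  qed
qed

end


section \<open>Equivariant maps of least Lipschitz constant\<close>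

locale tree_pair = S: fg_gtree M V F \<phi> + S': fg_gtree M' V' F \<phi>'
  for M :: "'p metric" and V and F :: "'g monoid" and \<phi> and M' :: "'q metric" and V' and \<phi>' +
  assumes F_infinite: "infinite (carrier F)"
begin

abbreviation d where "d \<equiv> S.d"
abbreviation d' where "d' \<equiv> S'.d"
abbreviation X' where "X' \<equiv> S'.X"
abbreviation FF where "FF \<equiv> carrier F"
abbreviation Ed where "Ed \<equiv> S.Ed"

text \<open>Only vertices are mapped; \<open>extension\<close> later fills in the edges
  affinely.\<close>

definition equivariant where
  "equivariant f \<longleftrightarrow> (\<forall>v\<in>V. f v \<in> X') \<and> (\<forall>g\<in>FF. \<forall>v\<in>V. f (\<phi> g v) = \<phi>' g (f v))"

definition lipV where
  "lipV f L \<longleftrightarrow> (\<forall>(x, y)\<in>Ed. d' (f x) (f y) \<le> L * d x y)"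

lemma equivX: "equivariant f \<Longrightarrow> v \<in> V \<Longrightarrow> f v \<in> X'"
  and equiv_act: "equivariant f \<Longrightarrow> g \<in> FF \<Longrightarrow> v \<in> V \<Longrightarrow> f (\<phi> g v) = \<phi>' g (f v)"
  unfolding equivariant_def by auto

lemma orbit_act:
  assumes "g \<in> FF" "v \<in> S.X"
  shows "orbit F \<phi> (\<phi> g v) = orbit F \<phi> v"
proof -
  have *: "orbit F \<phi> (\<phi> g v) \<subseteq> orbit F \<phi> v" if "g \<in> FF" "v \<in> S.X" for g v
    unfolding orbit_def using S.act_mult[OF _ that] that S.F.m_closed by (smt (verit) Collect_mono_iff)
  have "orbit F \<phi> v = orbit F \<phi> (\<phi> (inv\<^bsub>F\<^esub> g) (\<phi> g v))" using S.act_inv assms by simp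
  also have "\<dots> \<subseteq> orbit F \<phi> (\<phi> g v)" using * assms S.act_X by simp
  finally show ?thesis using *[OF assms] by blast
qed

text \<open>Vertex stabilizers are finite, so they fix points of the target tree; these may serve as
  images of orbit representatives.\<close>

lemma equivariant_exists: "\<exists>f. equivariant f"
proof -
  define \<rho> where "\<rho> v = (SOME r. r \<in> orbit F \<phi> v)" for v
  define \<gamma> where "\<gamma> v = (SOME g. g \<in> FF \<and> \<phi> g (\<rho> v) = v)" for v
  define b where "b x = (SOME b. b \<in> X' \<and> (\<forall>g\<in>stabilizer F \<phi> x. \<phi>' g b = b))" for x
  have b: "b x \<in> X'" "\<And>g. g \<in> stabilizer F \<phi> x \<Longrightarrow> \<phi>' g (b x) = b x" if "x \<in> S.X" for x
  proof -
    have "\<exists>b. b \<in> X' \<and> (\<forall>g\<in>stabilizer F \<phi> x. \<phi>' g b = b)"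
      using S'.finite_subgroup_fixes[OF S.A.stabilizer_subgroup[OF that] S.stab_finite[OF that]] by blast
    from someI_ex[OF this] show "b x \<in> X'" "\<And>g. g \<in> stabilizer F \<phi> x \<Longrightarrow> \<phi>' g (b x) = b x"
      unfolding b_def by auto
  qed
  have \<rho>: "\<rho> v \<in> orbit F \<phi> v" if "v \<in> S.X" for v
    unfolding \<rho>_def using S.A.orbit_refl[OF that] by (rule someI)
  have \<rho>X: "\<rho> v \<in> S.X" if "v \<in> S.X" for v
    using \<rho>[OF that] that S.act_X unfolding orbit_def by auto
  have \<gamma>: "\<gamma> v \<in> FF \<and> \<phi> (\<gamma> v) (\<rho> v) = v" if v: "v \<in> S.X" for v
  proof -
    obtain g where "g \<in> FF" "\<rho> v = \<phi> g v" using \<rho>[OF v] unfolding orbit_def by auto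
    then have "inv\<^bsub>F\<^esub> g \<in> FF \<and> \<phi> (inv\<^bsub>F\<^esub> g) (\<rho> v) = v" using S.act_inv v by simp
    then show ?thesis unfolding \<gamma>_def by (rule someI)
  qed
  define f where "f v = \<phi>' (\<gamma> v) (b (\<rho> v))" for v
  have "equivariant f" unfolding equivariant_def
  proof (intro conjI ballI)
    fix v assume "v \<in> V"
    then have v: "v \<in> S.X" using S.V_X by auto
    show "f v \<in> X'" unfolding f_def using S'.act_X \<gamma>[OF v] b(1)[OF \<rho>X[OF v]] by blast
    fix g assume g: "g \<in> FF"
    have gv: "\<phi> g v \<in> S.X" using S.act_X g v by blast
    have r: "\<rho> (\<phi> g v) = \<rho> v" unfolding \<rho>_def orbit_act[OF g v] ..
    \<comment> \<open>The elements used to transport to \<open>v\<close> and to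
      \<open>\<phi> g v\<close> differ from \<open>g\<close> by \<open>k\<close>, which stabilizes
      the orbit representative and therefore fixes its image.\<close>
    define k where "k = inv\<^bsub>F\<^esub> (\<gamma> (\<phi> g v)) \<otimes>\<^bsub>F\<^esub> (g \<otimes>\<^bsub>F\<^esub> \<gamma> v)"
    note G = \<gamma>[OF v] \<gamma>[OF gv, unfolded r]
    have kF: "k \<in> FF" unfolding k_def using G g by simp
    have "\<phi> (g \<otimes>\<^bsub>F\<^esub> \<gamma> v) (\<rho> v) = \<phi> g v" using S.act_mult[OF g _ \<rho>X[OF v]] G by simp
    then have "\<phi> k (\<rho> v) = \<phi> (inv\<^bsub>F\<^esub> (\<gamma> (\<phi> g v))) (\<phi> (\<gamma> (\<phi> g v)) (\<rho> v))"
      unfolding k_def using S.act_mult[OF _ _ \<rho>X[OF v]] G g by simp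
    also have "\<dots> = \<rho> v" using S.act_inv G \<rho>X[OF v] by blast
    finally have "k \<in> stabilizer F \<phi> (\<rho> v)" unfolding stabilizer_def using kF by simp
    then have kb: "\<phi>' k (b (\<rho> v)) = b (\<rho> v)" using b(2) \<rho>X[OF v] by blast
    have bX: "b (\<rho> v) \<in> X'" using b(1)[OF \<rho>X[OF v]] .
    have "f (\<phi> g v) = \<phi>' (\<gamma> (\<phi> g v)) (\<phi>' k (b (\<rho> v)))" unfolding f_def r kb ..
    also have "\<dots> = \<phi>' (\<gamma> (\<phi> g v) \<otimes>\<^bsub>F\<^esub> k) (b (\<rho> v))" using S'.act_mult bX G kF by simp
    also have "\<gamma> (\<phi> g v) \<otimes>\<^bsub>F\<^esub> k = g \<otimes>\<^bsub>F\<^esub> \<gamma> v"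
      unfolding k_def using G g by (simp add: S.F.m_assoc[symmetric])
    also have "\<phi>' (g \<otimes>\<^bsub>F\<^esub> \<gamma> v) (b (\<rho> v)) = \<phi>' g (f v)" unfolding f_def using S'.act_mult bX G g by simp
    finally show "f (\<phi> g v) = \<phi>' g (f v)" .
  qed
  then show ?thesis by blast
qed

lemma equiv_dist:
  assumes "equivariant f" "g \<in> FF" "u \<in> V" "v \<in> V"
  shows "d' (f (\<phi> g u)) (f (\<phi> g v)) = d' (f u) (f v)"
  using S'.act_iso[OF assms(2) equivX[OF assms(1,3)] equivX[OF assms(1,4)]]
    equiv_act[OF assms(1,2,3)] equiv_act[OF assms(1,2,4)] by simp

text \<open>Lengths of edges and of their images are invariant under the group, so a property of the
  two lengths need only be checked on finitely many edges.\<close>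

lemma edge_reps_all:
  assumes f: "equivariant f" and edge_reps: "\<And>b c. (b, c) \<in> S.edge_reps \<Longrightarrow> P (d' (f b) (f c)) (d b c)"
    and e: "(x, y) \<in> Ed"
  shows "P (d' (f x) (f y)) (d x y)"
proof -
  obtain g b c where g: "g \<in> FF" "(b, c) \<in> S.edge_reps" "x = \<phi> g b" "y = \<phi> g c"
    using S.edge_reps_cover[OF e] by blast
  then have bc: "b \<in> V" "c \<in> V" "b \<in> S.X" "c \<in> S.X" using S.edge_reps_Ed S.edgeD by blast+
  show ?thesis using edge_reps[OF g(2)] equiv_dist[OF f g(1)] S.act_iso[OF g(1)] bc g(3,4) by simp
qed

lemma lipV_exists:
  assumes f: "equivariant f"
  shows "\<exists>L\<ge>0. lipV f L"
proof -
  define k where "k e = d' (f (fst e)) (f (snd e)) / d (fst e) (snd e)" for e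
  define L where "L = (\<Sum>e\<in>S.edge_reps. k e)"
  have k0: "k e \<ge> 0" for e unfolding k_def by simp
  have "d' (f x) (f y) \<le> L * d x y" if "(x, y) \<in> Ed" for x y
  proof (rule edge_reps_all[OF f _ that])
    fix b c assume bc: "(b, c) \<in> S.edge_reps"
    then have pos: "d b c > 0" using S.edge_reps_Ed S.edge_pos by blast
    have "k (b, c) \<le> L" unfolding L_def using member_le_sum[OF bc] k0 S.edge_reps_finite by blast
    then show "d' (f b) (f c) \<le> L * d b c" using pos unfolding k_def by (simp add: field_simps)
  qed
  moreover have "L \<ge> 0" unfolding L_def using k0 by (simp add: sum_nonneg)
  ultimately show ?thesis unfolding lipV_def by blast
qed

lemma lipV_all:
  assumes f: "equivariant f" "lipV f L" and "u \<in> V" "w \<in> V"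
  shows "d' (f u) (f w) \<le> L * d u w"
  by (rule S.lipschitz_on_vertices[of "\<lambda>u w. d' (f u) (f w)"])
    (use assms equivX S'.d_triangle in \<open>auto simp: lipV_def\<close>)

text \<open>The infimum over vertex maps. That it equals \<open>Lip\<close> is seen only in
  \<open>Lip_eqI\<close>, with the help of a suitable element of the group.\<close>

definition \<Lambda> where "\<Lambda> = Inf {L. L \<ge> 0 \<and> (\<exists>f. equivariant f \<and> lipV f L)}"

lemma \<Lambda>_set: "{L. L \<ge> 0 \<and> (\<exists>f. equivariant f \<and> lipV f L)} \<noteq> {}"
  "bdd_below {L. L \<ge> 0 \<and> (\<exists>f. equivariant f \<and> lipV f L)}"
proof -
  obtain f where f: "equivariant f" using equivariant_exists by blast
  then show "{L. L \<ge> 0 \<and> (\<exists>f. equivariant f \<and> lipV f L)} \<noteq> {}" using lipV_exists[OF f] by blast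
  show "bdd_below {L. L \<ge> 0 \<and> (\<exists>f. equivariant f \<and> lipV f L)}" by (rule bdd_belowI[of _ 0]) simp
qed

lemma \<Lambda>_nonneg: "\<Lambda> \<ge> 0"
  unfolding \<Lambda>_def using \<Lambda>_set(1) by (rule cInf_greatest) simp

lemma \<Lambda>_le: "equivariant f \<Longrightarrow> lipV f L \<Longrightarrow> L \<ge> 0 \<Longrightarrow> \<Lambda> \<le> L"
  unfolding \<Lambda>_def using \<Lambda>_set(2) by (intro cInf_lower) auto

text \<open>A vertex other than the base point is an end of some edge. The base point is listed
  separately, since a priori the tree might have no edge.\<close>

lemma vertex_reps:
  assumes v: "v \<in> V"
  shows "\<exists>g\<in>FF. \<exists>w\<in>insert S.base (fst ` S.edge_reps). v = \<phi> g w"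
proof (cases "v = S.base")
  case True
  then have "v = \<phi> \<one>\<^bsub>F\<^esub> S.base" using S.act_one S.base by simp
  then show ?thesis using S.F.one_closed by blast
next
  case False
  then obtain w where "(w, v) \<in> Ed" using S.last_edge[OF S.base(1) v] by blast
  then have "(v, w) \<in> Ed" by (rule S.edge_sym)
  then obtain g b c where "g \<in> FF" "(b, c) \<in> S.edge_reps" "v = \<phi> g b" using S.edge_reps_cover by blast
  then show ?thesis by force
qed

lemma lim_unique:
  assumes X: "\<And>n. x n \<in> X'" "l \<in> X'" "m \<in> X'"
    and l: "(\<lambda>n. d' (x n) l) \<longlonglongrightarrow> 0" and m: "(\<lambda>n. d' (x n) m) \<longlonglongrightarrow> 0"
  shows "l = m"
proof -
  have lim: "(\<lambda>n. d' (x n) l + d' (x n) m) \<longlonglongrightarrow> 0" using tendsto_add[OF l m] by simp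
  have "d' l m \<le> d' (x n) l + d' (x n) m" for n
    using S'.d_triangle[OF X(2) X(1)[of n] X(3)] S'.d_comm[of l "x n"] by simp
  then have "d' l m \<le> 0" by (intro LIMSEQ_le_const[OF lim]) blast
  then show ?thesis using S'.d_pos[OF X(2,3)] by (cases "l = m") auto
qed

text \<open>Vertex maps whose Lipschitz constants approach the infimum move the base point a bounded
  distance only after a translation; that translation can be taken to be central, so it may be
  undone without losing equivariance.\<close>

lemma minimizer_exists: "\<exists>f. equivariant f \<and> lipV f \<Lambda>"
proof -
  define C where "C = \<Lambda> + 1"
  have "\<exists>f. equivariant f \<and> lipV f (\<Lambda> + 1 / real (Suc n))" for n
  proof -
    have "Inf {L. L \<ge> 0 \<and> (\<exists>f. equivariant f \<and> lipV f L)} < \<Lambda> + 1 / real (Suc n)"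
      unfolding \<Lambda>_def[symmetric] by simp
    then obtain L f where L: "L < \<Lambda> + 1 / real (Suc n)" "equivariant f" "lipV f L"
      using cInf_lessD[OF \<Lambda>_set(1)] by blast
    have "d' (f x) (f y) \<le> (\<Lambda> + 1 / real (Suc n)) * d x y" if "(x, y) \<in> Ed" for x y
    proof -
      have "L * d x y \<le> (\<Lambda> + 1 / real (Suc n)) * d x y" using L(1) by (intro mult_right_mono) auto
      moreover have "d' (f x) (f y) \<le> L * d x y" using L(3) that unfolding lipV_def by blast
      ultimately show ?thesis by linarith
    qed
    then show ?thesis using L(2) unfolding lipV_def by blast
  qed
  then obtain f where f: "\<And>n. equivariant (f n)" "\<And>n. lipV (f n) (\<Lambda> + 1 / real (Suc n))" by metis
  have fL: "d' (f n u) (f n w) \<le> (\<Lambda> + 1 / real (Suc n)) * d u w" if "u \<in> V" "w \<in> V" for n u w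
    using lipV_all f that by blast
  have fC: "d' (f n u) (f n w) \<le> C * d u w" if "u \<in> V" "w \<in> V" for n u w
  proof -
    have "(\<Lambda> + 1 / real (Suc n)) * d u w \<le> C * d u w"
      unfolding C_def by (intro mult_right_mono) auto
    then show ?thesis using fL[OF that, of n] by linarith
  qed
  let ?b = "S.base" and ?b' = "S'.base"
  note base = S.base S'.base
  have fX: "f n v \<in> X'" if "v \<in> V" for n v using equivX f that by blast
  obtain h where h: "\<And>n. h n \<in> FF" "\<And>n. d' (\<phi>' (h n) ?b') (f n ?b) \<le> S'.diam"
    using S'.near_orbit[OF fX[OF base(1)]] by metis
  \<comment> \<open>\<open>k n s\<close> is the generator \<open>s\<close> as seen from the
    translate of the base point by \<open>h n\<close>. Its displacement is bounded by the way to
    \<open>f n ?b\<close>, the displacement there, and the way back; these are the three terms of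
    \<open>R\<close>. By properness only finitely many elements can occur.\<close>
  define k where "k n s = inv\<^bsub>F\<^esub> (h n) \<otimes>\<^bsub>F\<^esub> s \<otimes>\<^bsub>F\<^esub> h n" for n s
  define R where "R = S'.diam + C * S.diam + S'.diam"
  define P where "P = {g \<in> FF. d' ?b' (\<phi>' g ?b') \<le> R}"
  have C0: "C \<ge> 0" unfolding C_def using \<Lambda>_nonneg by simp
  have kP: "k n s \<in> P" if s: "s \<in> S.gens" for n s
  proof -
    have sF: "s \<in> FF" using S.gens s by auto
    have hb: "\<phi>' (h n) ?b' \<in> X'" using S'.act_X h base by blast
    have hs: "\<phi>' s (\<phi>' (h n) ?b') \<in> X'" "\<phi>' s (f n ?b) \<in> X'" using S'.act_X hb sF fX base by auto
    have "\<phi>' (k n s) ?b' = \<phi>' (inv\<^bsub>F\<^esub> (h n)) (\<phi>' s (\<phi>' (h n) ?b'))"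
      unfolding k_def using S'.act_mult sF h base hb by simp
    moreover have "?b' = \<phi>' (inv\<^bsub>F\<^esub> (h n)) (\<phi>' (h n) ?b')" using S'.act_inv h base by simp
    ultimately have "d' ?b' (\<phi>' (k n s) ?b') = d' (\<phi>' (h n) ?b') (\<phi>' s (\<phi>' (h n) ?b'))"
      using S'.act_iso[of "inv\<^bsub>F\<^esub> (h n)"] h hb hs by (metis S.F.inv_closed)
    also have "\<dots> \<le> d' (\<phi>' (h n) ?b') (f n ?b) + d' (f n ?b) (\<phi>' s (f n ?b))
        + d' (\<phi>' s (f n ?b)) (\<phi>' s (\<phi>' (h n) ?b'))"
      using S'.d_triangle[OF hb fX[OF base(1), of n] hs(1)] S'.d_triangle[OF fX[OF base(1), of n] hs(2,1)]
      by linarith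
    also have "d' (f n ?b) (\<phi>' s (f n ?b)) \<le> C * S.diam"
    proof -
      have "\<phi>' s (f n ?b) = f n (\<phi> s ?b)" using equiv_act f sF base by metis
      then have "d' (f n ?b) (\<phi>' s (f n ?b)) \<le> C * d ?b (\<phi> s ?b)" using fC base S.act_V sF by simp
      moreover have "\<phi> s ?b \<in> S.gen_seg s" unfolding S.gen_seg_def using S.act_X sF base by simp
      then have "d ?b (\<phi> s ?b) \<le> S.diam" using S.gen_seg_diam[of s] s unfolding S.igens_def by blast
      then have "C * d ?b (\<phi> s ?b) \<le> C * S.diam" using C0 by (intro mult_left_mono)
      ultimately show ?thesis by linarith
    qed
    also have "d' (\<phi>' s (f n ?b)) (\<phi>' s (\<phi>' (h n) ?b')) = d' (\<phi>' (h n) ?b') (f n ?b)"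
      using S'.act_iso sF fX base hb S'.d_comm by metis
    finally have "d' ?b' (\<phi>' (k n s) ?b') \<le> R" using h(2)[of n] unfolding R_def by linarith
    moreover have "k n s \<in> FF" unfolding k_def using h sF by simp
    ultimately show ?thesis unfolding P_def by simp
  qed
  have "finite P" unfolding P_def by (rule S'.proper)
  then have "finite (PiE S.gens (\<lambda>_. P))" using S.gens by (intro finite_PiE) auto
  moreover have "restrict (k n) S.gens \<in> PiE S.gens (\<lambda>_. P)" for n using kP by auto
  ultimately obtain q :: "nat \<Rightarrow> nat" and kk where
    q: "strict_mono q" "\<And>n. restrict (k (q n)) S.gens = kk"
    by (rule subseq_finite_range) (rule that)
  have kq: "k (q n) s = k (q 0) s" if "s \<in> S.gens" for n s
    using q(2)[of n] q(2)[of 0] that by (metis restrict_apply')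
  \<comment> \<open>Along the subsequence, \<open>h (q n)\<close> and \<open>h (q 0)\<close>
    conjugate each generator to the same element, so their quotient commutes with all
    generators.\<close>
  define z where "z n = h (q n) \<otimes>\<^bsub>F\<^esub> inv\<^bsub>F\<^esub> (h (q 0))" for n
  have zF: "z n \<in> FF" for n unfolding z_def using h by simp
  have zgen: "s \<otimes>\<^bsub>F\<^esub> z n = z n \<otimes>\<^bsub>F\<^esub> s" if s: "s \<in> S.gens" for n s
  proof -
    have sF: "s \<in> FF" using S.gens s by auto
    have "h (q n) \<otimes>\<^bsub>F\<^esub> k (q n) s \<otimes>\<^bsub>F\<^esub> inv\<^bsub>F\<^esub> (h (q 0)) = s \<otimes>\<^bsub>F\<^esub> z n"
      unfolding k_def z_def using h sF by (simp add: S.F.m_assoc[symmetric])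
    moreover have "h (q n) \<otimes>\<^bsub>F\<^esub> k (q 0) s \<otimes>\<^bsub>F\<^esub> inv\<^bsub>F\<^esub> (h (q 0)) = z n \<otimes>\<^bsub>F\<^esub> s"
      unfolding k_def z_def using h sF by (simp add: S.F.m_assoc)
    ultimately show ?thesis using kq[OF s, of n] by simp
  qed
  have zcomm: "g \<otimes>\<^bsub>F\<^esub> z n = z n \<otimes>\<^bsub>F\<^esub> g" if "g \<in> FF" for n g
  proof -
    have "g \<in> generate F S.gens" using S.gens that by simp
    then show ?thesis
    proof (induction rule: generate.induct)
      case one
      then show ?case using zF by simp
    next
      case (incl s)
      then show ?case using zgen by blast
    next
      case (inv s)
      then have sF: "s \<in> FF" using S.gens by auto
      have "inv\<^bsub>F\<^esub> s \<otimes>\<^bsub>F\<^esub> z n = inv\<^bsub>F\<^esub> s \<otimes>\<^bsub>F\<^esub> (z n \<otimes>\<^bsub>F\<^esub> s) \<otimes>\<^bsub>F\<^esub> inv\<^bsub>F\<^esub> s"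
        using sF zF by (simp add: S.F.m_assoc)
      also have "\<dots> = inv\<^bsub>F\<^esub> s \<otimes>\<^bsub>F\<^esub> (s \<otimes>\<^bsub>F\<^esub> z n) \<otimes>\<^bsub>F\<^esub> inv\<^bsub>F\<^esub> s" using zgen[OF inv] by simp
      also have "\<dots> = z n \<otimes>\<^bsub>F\<^esub> inv\<^bsub>F\<^esub> s" using sF zF by (simp add: S.F.m_assoc[symmetric])
      finally show ?case .
    next
      case (eng g1 g2)
      then have g: "g1 \<in> FF" "g2 \<in> FF" using S.gens by auto
      then show ?case using eng zF by (metis S.F.m_assoc)
    qed
  qed
  define f' where "f' n v = \<phi>' (inv\<^bsub>F\<^esub> (z n)) (f (q n) v)" for n v
  have f'X: "f' n v \<in> X'" if "v \<in> V" for n v unfolding f'_def using S'.act_X zF fX that by simp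
  have f'act: "f' n (\<phi> g v) = \<phi>' g (f' n v)" if "g \<in> FF" "v \<in> V" for n g v
  proof -
    have "inv\<^bsub>F\<^esub> (z n) \<otimes>\<^bsub>F\<^esub> g = inv\<^bsub>F\<^esub> (z n) \<otimes>\<^bsub>F\<^esub> (g \<otimes>\<^bsub>F\<^esub> z n) \<otimes>\<^bsub>F\<^esub> inv\<^bsub>F\<^esub> (z n)"
      using zF that by (simp add: S.F.m_assoc)
    also have "\<dots> = g \<otimes>\<^bsub>F\<^esub> inv\<^bsub>F\<^esub> (z n)"
      unfolding zcomm[OF that(1)] using zF that by (simp add: S.F.m_assoc[symmetric])
    finally have c: "inv\<^bsub>F\<^esub> (z n) \<otimes>\<^bsub>F\<^esub> g = g \<otimes>\<^bsub>F\<^esub> inv\<^bsub>F\<^esub> (z n)" .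
    have "f' n (\<phi> g v) = \<phi>' (inv\<^bsub>F\<^esub> (z n)) (\<phi>' g (f (q n) v))" unfolding f'_def using equiv_act f that by simp
    also have "\<dots> = \<phi>' (inv\<^bsub>F\<^esub> (z n) \<otimes>\<^bsub>F\<^esub> g) (f (q n) v)" using S'.act_mult zF that fX by simp
    also have "\<dots> = \<phi>' g (f' n v)" unfolding c f'_def using S'.act_mult zF that fX by simp
    finally show ?thesis .
  qed
  have f'dist: "d' (f' n u) (f' n w) = d' (f (q n) u) (f (q n) w)" if "u \<in> V" "w \<in> V" for n u w
    unfolding f'_def using S'.act_iso zF fX that by simp
  \<comment> \<open>Once the central translations are undone, all images of the base point stay near
    one point.\<close>
  define c where "c = \<phi>' (h (q 0)) ?b'"
  have cX: "c \<in> X'" unfolding c_def using S'.act_X h base by simp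
  have f'base: "d' c (f' n ?b) \<le> S'.diam" for n
  proof -
    have "z n \<otimes>\<^bsub>F\<^esub> h (q 0) = h (q n)" unfolding z_def using h by (simp add: S.F.m_assoc)
    then have "\<phi>' (z n) c = \<phi>' (h (q n)) ?b'"
      unfolding c_def using S'.act_mult[OF zF h(1) base(4)] by metis
    moreover have "\<phi>' (z n) (f' n ?b) = f (q n) ?b"
      unfolding f'_def using S'.act_inv' zF fX base by simp
    ultimately have "d' c (f' n ?b) = d' (\<phi>' (h (q n)) ?b') (f (q n) ?b)"
      using S'.act_iso[OF zF cX f'X[OF base(1)]] by metis
    then show ?thesis using h(2) by simp
  qed
  have f'bound: "d' ?b' (f' n v) \<le> d' ?b' c + S'.diam + C * d ?b v" if v: "v \<in> V" for n v
  proof -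
    have "d' (f' n ?b) (f' n v) \<le> C * d ?b v" using f'dist fC v base by simp
    then show ?thesis
      using f'base[of n] S'.d_triangle[OF base(4) cX f'X[OF v, of n]]
        S'.d_triangle[OF cX f'X[OF base(1), of n] f'X[OF v, of n]] by linarith
  qed
  define W where "W = insert ?b (fst ` S.edge_reps)"
  have W: "finite W" "W \<subseteq> V" unfolding W_def using S.edge_reps_finite base S.edge_reps_Ed S.edgeD by auto
  define cv where "cv r w \<longleftrightarrow> (\<exists>l\<in>X'. (\<lambda>n. d' (f' (r n) w) l) \<longlonglongrightarrow> 0)" for r :: "nat \<Rightarrow> nat" and w
  \<comment> \<open>Convergence is needed at finitely many vertices only; equivariance spreads it to
    all others.\<close>
  have "\<exists>r. strict_mono r \<and> (\<forall>w\<in>W. cv r w)"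
  proof (rule subseq_family[OF W(1)])
    fix w and r :: "nat \<Rightarrow> nat" assume "w \<in> W" "strict_mono r"
    then have w: "w \<in> V" using W by auto
    have "\<exists>(p :: nat \<Rightarrow> nat) l. strict_mono p \<and> l \<in> X' \<and> (\<lambda>n. d' (f' (r (p n)) w) l) \<longlonglongrightarrow> 0"
      by (rule S'.bounded_sequence[of "\<lambda>n. f' (r n) w"]) (rule f'X[OF w], rule f'bound[OF w])
    then show "\<exists>p. strict_mono p \<and> cv (r \<circ> p) w" unfolding cv_def o_def by blast
  next
    fix w and r p :: "nat \<Rightarrow> nat" assume "cv r w" "strict_mono p"
    then show "cv (r \<circ> p) w" unfolding cv_def using LIMSEQ_subseq_LIMSEQ[of _ 0 p]
      by (fastforce simp: o_def)
  qed
  then obtain r :: "nat \<Rightarrow> nat" where r: "strict_mono r" "\<And>w. w \<in> W \<Longrightarrow> cv r w" by blast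
  have actlim: "(\<lambda>n. d' (f' (r n) (\<phi> g v)) (\<phi>' g l)) \<longlonglongrightarrow> 0"
    if "g \<in> FF" "v \<in> V" "l \<in> X'" "(\<lambda>n. d' (f' (r n) v) l) \<longlonglongrightarrow> 0" for g v l
    using that f'act S'.act_iso f'X by simp
  have "\<exists>l. l \<in> X' \<and> (\<lambda>n. d' (f' (r n) v) l) \<longlonglongrightarrow> 0" if v: "v \<in> V" for v
  proof -
    obtain g w where g: "g \<in> FF" "w \<in> W" "v = \<phi> g w" using vertex_reps[OF v] unfolding W_def by blast
    obtain l where "l \<in> X'" "(\<lambda>n. d' (f' (r n) w) l) \<longlonglongrightarrow> 0" using r(2)[OF g(2)] unfolding cv_def by blast
    then have "\<phi>' g l \<in> X'" "(\<lambda>n. d' (f' (r n) v) (\<phi>' g l)) \<longlonglongrightarrow> 0"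
      using actlim g W S'.act_X by auto
    then show ?thesis by blast
  qed
  then obtain l where l: "\<And>v. v \<in> V \<Longrightarrow> l v \<in> X'" "\<And>v. v \<in> V \<Longrightarrow> (\<lambda>n. d' (f' (r n) v) (l v)) \<longlonglongrightarrow> 0"
    by metis
  have "equivariant l" unfolding equivariant_def
  proof (intro conjI ballI)
    fix g v assume g: "g \<in> FF" and v: "v \<in> V"
    show "l (\<phi> g v) = \<phi>' g (l v)"
      by (rule lim_unique[of "\<lambda>n. f' (r n) (\<phi> g v)"])
        (use f'X l S.act_V S'.act_X g v actlim in auto)
  qed (use l in auto)
  moreover have "d' (l x) (l y) \<le> \<Lambda> * d x y" if "(x, y) \<in> Ed" for x y
  proof -
    have V: "x \<in> V" "y \<in> V" using S.edgeD that by auto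
    have le: "d' (l x) (l y) \<le> d' (f' (r n) x) (l x) + (\<Lambda> + 1 / real (Suc n)) * d x y + d' (f' (r n) y) (l y)" for n
    proof -
      \<comment> \<open>The Lipschitz constant belongs to the index \<open>q (r n)\<close> of the
        original sequence, which is at least \<open>n\<close>.\<close>
      have "n \<le> q (r n)" using seq_suble[OF r(1), of n] seq_suble[OF q(1), of "r n"] by linarith
      then have "1 / real (Suc (q (r n))) \<le> 1 / real (Suc n)" by (simp add: frac_le)
      then have "(\<Lambda> + 1 / real (Suc (q (r n)))) * d x y \<le> (\<Lambda> + 1 / real (Suc n)) * d x y"
        by (intro mult_right_mono) auto
      moreover have "d' (f' (r n) x) (f' (r n) y) \<le> (\<Lambda> + 1 / real (Suc (q (r n)))) * d x y"
        using f'dist fL V by simp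
      ultimately show ?thesis
        using S'.d_triangle[OF l(1)[OF V(1)] f'X[OF V(1), of "r n"] l(1)[OF V(2)]]
          S'.d_triangle[OF f'X[OF V(1), of "r n"] f'X[OF V(2), of "r n"] l(1)[OF V(2)]]
          S'.d_comm[of "l x" "f' (r n) x"] by linarith
    qed
    have "(\<lambda>n. d' (f' (r n) x) (l x) + (\<Lambda> + 1 / real (Suc n)) * d x y + d' (f' (r n) y) (l y))
        \<longlonglongrightarrow> 0 + (\<Lambda> + 0) * d x y + 0"
      using l(2)[OF V(1)] l(2)[OF V(2)] LIMSEQ_inverse_real_of_nat
      by (intro tendsto_intros) (auto simp: inverse_eq_divide)
    then have "d' (l x) (l y) \<le> 0 + (\<Lambda> + 0) * d x y + 0" by (rule LIMSEQ_le_const) (use le in blast)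
    then show ?thesis by simp
  qed
  ultimately show ?thesis unfolding lipV_def by blast
qed

text \<open>Otherwise a minimizer would send all translates of the base point to one point, fixed by
  the whole group; but stabilizers are finite and the group is not.\<close>

lemma \<Lambda>_pos: "\<Lambda> > 0"
proof (rule ccontr)
  assume "\<not> ?thesis"
  then have z: "\<Lambda> = 0" using \<Lambda>_nonneg by simp
  obtain f where f: "equivariant f" "lipV f \<Lambda>" using minimizer_exists by blast
  have fb: "f S.base \<in> X'" using equivX f S.base by blast
  have "\<phi>' g (f S.base) = f S.base" if g: "g \<in> FF" for g
  proof -
    have gb: "\<phi> g S.base \<in> V" using S.act_V S.base g by blast
    have "d' (f (\<phi> g S.base)) (f S.base) \<le> 0"
      using lipV_all[OF f gb S.base(1)] z by simp
    then have "f (\<phi> g S.base) = f S.base"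
      using S'.d_pos[OF equivX[OF f(1) gb] fb] by (cases "f (\<phi> g S.base) = f S.base") auto
    then show ?thesis using equiv_act f g S.base by simp
  qed
  then have "stabilizer F \<phi>' (f S.base) = FF" unfolding stabilizer_def by blast
  then show False using S'.stab_finite[OF fb] F_infinite by simp
qed

section \<open>Tension edges of a minimizing vertex map\<close>

definition \<Delta> where "\<Delta> f = {(x, y) \<in> Ed. d' (f x) (f y) = \<Lambda> * d x y}"

lemma \<Delta>_Ed: "(x, y) \<in> \<Delta> f \<Longrightarrow> (x, y) \<in> Ed"
  and \<Delta>_eq: "(x, y) \<in> \<Delta> f \<Longrightarrow> d' (f x) (f y) = \<Lambda> * d x y"
  unfolding \<Delta>_def by auto

lemma \<Delta>_sym: "(x, y) \<in> \<Delta> f \<Longrightarrow> (y, x) \<in> \<Delta> f"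
  unfolding \<Delta>_def using S.edge_sym S.d_comm S'.d_comm by auto

lemma \<Delta>_act:
  assumes "equivariant f" "g \<in> FF" "(x, y) \<in> \<Delta> f"
  shows "(\<phi> g x, \<phi> g y) \<in> \<Delta> f"
  using assms S.act_edge equiv_dist S.act_iso S.edgeD unfolding \<Delta>_def by auto

lemma \<Delta>_lt:
  assumes "lipV f \<Lambda>" "(x, y) \<in> Ed" "(x, y) \<notin> \<Delta> f"
  shows "d' (f x) (f y) < \<Lambda> * d x y"
  using assms unfolding lipV_def \<Delta>_def by fastforce

text \<open>If no representative were stretched by \<open>\<Lambda>\<close>, the largest of the
  finitely many stretching factors would be a smaller Lipschitz constant for the same map.\<close>

lemma \<Delta>_nonempty:
  assumes f: "equivariant f" "lipV f \<Lambda>"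
  shows "\<Delta> f \<inter> S.edge_reps \<noteq> {}"
proof
  assume emp: "\<Delta> f \<inter> S.edge_reps = {}"
  define k where "k e = d' (f (fst e)) (f (snd e)) / d (fst e) (snd e)" for e
  \<comment> \<open>Inserting \<open>0\<close> keeps the maximum nonnegative and meaningful when
    there are no edges.\<close>
  define L where "L = Max (insert 0 (k ` S.edge_reps))"
  have fin: "finite (insert 0 (k ` S.edge_reps))" using S.edge_reps_finite by simp
  have "k e < \<Lambda>" if e: "e \<in> S.edge_reps" for e
  proof -
    obtain x y where xy: "e = (x, y)" by (cases e)
    have "(x, y) \<in> Ed" using e xy S.edge_reps_Ed by blast
    moreover have "(x, y) \<notin> \<Delta> f" using e xy emp by blast
    ultimately show ?thesis using \<Delta>_lt[OF f(2)] S.edge_pos[of x y] unfolding k_def xy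
      by (simp add: divide_less_eq)
  qed
  then have "L < \<Lambda>" unfolding L_def using fin \<Lambda>_pos by auto
  moreover have "L \<ge> 0" unfolding L_def using fin by simp
  moreover have "lipV f L" unfolding lipV_def
  proof safe
    fix x y assume e: "(x, y) \<in> Ed"
    show "d' (f x) (f y) \<le> L * d x y"
    proof (rule edge_reps_all[OF f(1) _ e])
      fix b c assume bc: "(b, c) \<in> S.edge_reps"
      have "k (b, c) \<le> L" unfolding L_def using fin bc by simp
      then show "d' (f b) (f c) \<le> L * d b c"
        using S.edge_pos[of b c] bc S.edge_reps_Ed unfolding k_def by (auto simp: divide_le_eq)
    qed
  qed
  ultimately show False using \<Lambda>_le[OF f(1)] by fastforce
qed

text \<open>Tension edges are counted within \<open>edge_reps\<close> instead of by orbits. An orbit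
  that is relaxed has a member there, so the number drops all the same.\<close>

definition opt where
  "opt f \<longleftrightarrow> equivariant f \<and> lipV f \<Lambda> \<and>
     (\<forall>f'. equivariant f' \<and> lipV f' \<Lambda> \<longrightarrow> card (\<Delta> f \<inter> S.edge_reps) \<le> card (\<Delta> f' \<inter> S.edge_reps))"

lemma opt_exists: "\<exists>f. opt f"
  unfolding opt_def using minimizer_exists
    ex_has_least_nat[of "\<lambda>f. equivariant f \<and> lipV f \<Lambda>" _ "\<lambda>f. card (\<Delta> f \<inter> S.edge_reps)"] by blast

text \<open>The new value \<open>b\<close> is transported along the orbit of \<open>v\<close>. Since
  the stabilizer of \<open>v\<close> fixes \<open>b\<close>, the result does not depend on the
  transporting element.\<close>

lemma move_vertex:
  assumes f: "equivariant f" and v: "v \<in> V" and b: "b \<in> X'"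
    and stab: "\<And>g. g \<in> FF \<Longrightarrow> \<phi> g v = v \<Longrightarrow> \<phi>' g b = b"
  obtains f' where "equivariant f'" "\<And>g. g \<in> FF \<Longrightarrow> f' (\<phi> g v) = \<phi>' g b"
    "\<And>u. u \<notin> orbit F \<phi> v \<Longrightarrow> f' u = f u"
proof -
  have vX: "v \<in> S.X" using v S.V_X by auto
  define \<gamma> where "\<gamma> u = (SOME g. g \<in> FF \<and> \<phi> g v = u)" for u
  define f' where "f' u = (if u \<in> orbit F \<phi> v then \<phi>' (\<gamma> u) b else f u)" for u
  have f'v: "f' (\<phi> g v) = \<phi>' g b" if g: "g \<in> FF" for g
  proof -
    have \<gamma>: "\<gamma> (\<phi> g v) \<in> FF \<and> \<phi> (\<gamma> (\<phi> g v)) v = \<phi> g v"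
      unfolding \<gamma>_def by (rule someI[of _ g]) (use g in simp)
    define k where "k = inv\<^bsub>F\<^esub> g \<otimes>\<^bsub>F\<^esub> \<gamma> (\<phi> g v)"
    have k: "k \<in> FF" "\<phi> k v = v" unfolding k_def using S.act_mult S.act_inv \<gamma> g vX by auto
    have "\<phi>' g (\<phi>' k b) = \<phi>' (\<gamma> (\<phi> g v)) b"
      using S'.act_mult[OF g k(1) b] g \<gamma> unfolding k_def by (simp add: S.F.m_assoc[symmetric])
    then have "\<phi>' (\<gamma> (\<phi> g v)) b = \<phi>' g b" using stab k by simp
    moreover have "\<phi> g v \<in> orbit F \<phi> v" unfolding orbit_def using g by blast
    ultimately show ?thesis unfolding f'_def by simp
  qed
  have out: "f' u = f u" if "u \<notin> orbit F \<phi> v" for u unfolding f'_def using that by simp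
  have "equivariant f'" unfolding equivariant_def
  proof (intro conjI ballI)
    fix u assume u: "u \<in> V"
    then have uX: "u \<in> S.X" using S.V_X by auto
    show "f' u \<in> X'"
    proof (cases "u \<in> orbit F \<phi> v")
      case True
      then obtain g where "g \<in> FF" "u = \<phi> g v" unfolding orbit_def by auto
      then show ?thesis using f'v S'.act_X b by simp
    qed (use out equivX f u in simp)
    fix g assume g: "g \<in> FF"
    show "f' (\<phi> g u) = \<phi>' g (f' u)"
    proof (cases "u \<in> orbit F \<phi> v")
      case True
      then obtain k where k: "k \<in> FF" "u = \<phi> k v" unfolding orbit_def by auto
      then have "\<phi> g u = \<phi> (g \<otimes>\<^bsub>F\<^esub> k) v" using S.act_mult g vX by simp
      then show ?thesis using f'v k g S'.act_mult b by simp
    next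
      case False
      have "\<phi> g u \<notin> orbit F \<phi> v"
      proof
        assume "\<phi> g u \<in> orbit F \<phi> v"
        then obtain k where k: "k \<in> FF" "\<phi> g u = \<phi> k v" unfolding orbit_def by auto
        then have "u = \<phi> (inv\<^bsub>F\<^esub> g) (\<phi> k v)" using S.act_inv[OF g uX] by simp
        then have "u = \<phi> (inv\<^bsub>F\<^esub> g \<otimes>\<^bsub>F\<^esub> k) v" using S.act_mult g k vX by simp
        then show False using False g k unfolding orbit_def by auto
      qed
      then show ?thesis using out False equiv_act f g u by simp
    qed
  qed
  then show ?thesis using that f'v out by blast
qed

end


section \<open>Tension edges and affine extension\<close>

context tree_pair
begin

text \<open>If all tension edges at \<open>v\<close> pointed in the same direction of the target tree, moving \<open>f v\<close> a
  little in this direction would relax them without creating new ones.\<close>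

lemma gates:
  assumes opt: "opt f" and w0: "(v, w0) \<in> \<Delta> f"
  shows "\<exists>w. (v, w) \<in> \<Delta> f \<and> S'.sg (f v) (f w0) \<inter> S'.sg (f v) (f w) = {f v}"
proof (rule ccontr)
  assume neg: "\<not> ?thesis"
  have f: "equivariant f" "lipV f \<Lambda>" using opt unfolding opt_def by auto
  define W where "W = {w. (v, w) \<in> \<Delta> f}"
  note E = S.edgeD[OF \<Delta>_Ed[OF w0]]
  have WE: "(v, w) \<in> Ed" if "w \<in> W" for w using that \<Delta>_Ed unfolding W_def by blast
  have WV: "w \<in> V" if "w \<in> W" for w using WE[OF that] S.edgeD by blast
  have "W \<subseteq> {w. (v, w) \<in> Ed}" using WE by blast
  then have Wfin: "finite W" using S.nbrs_finite[OF E(1)] finite_subset by blast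
  have fv: "f v \<in> X'" using equivX f E by blast
  have fw: "f w \<in> X'" if "w \<in> W" for w using equivX f WV that by blast
  have w0W: "w0 \<in> W" using w0 unfolding W_def by simp
  \<comment> \<open>By the assumption to be refuted, the images of all tension edges at
    \<open>v\<close> start along the one towards \<open>f w0\<close>.\<close>
  have "\<exists>p. p \<in> S'.sg (f v) (f w0) \<and> p \<in> S'.sg (f v) (f w) \<and> p \<noteq> f v" if "w \<in> W" for w
  proof -
    have "f v \<in> S'.sg (f v) (f w0) \<inter> S'.sg (f v) (f w)" using fv fw w0W that by simp
    then show ?thesis using neg that unfolding W_def by blast
  qed
  then obtain p where p: "\<And>w. w \<in> W \<Longrightarrow> p w \<in> S'.sg (f v) (f w0)"
    "\<And>w. w \<in> W \<Longrightarrow> p w \<in> S'.sg (f v) (f w)" "\<And>w. w \<in> W \<Longrightarrow> p w \<noteq> f v" by metis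
  have pX: "p w \<in> X'" if "w \<in> W" for w using p(2)[OF that] S'.seg_subset[OF fv fw[OF that]] by blast
  have "0 < d' (f v) (p w)" if "w \<in> W" for w using S'.d_pos[OF fv pX[OF that]] p(3)[OF that] by metis
  then obtain \<epsilon>1 where e1: "\<epsilon>1 > 0" "\<forall>w\<in>W. \<epsilon>1 < d' (f v) (p w)"
    using finite_pos_bound[OF Wfin, of "\<lambda>w. d' (f v) (p w)"] by blast
  \<comment> \<open>Half of the slack, because both ends of an edge may be moved by
    \<open>\<epsilon>\<close>.\<close>
  define sl where "sl e = (\<Lambda> * d (fst e) (snd e) - d' (f (fst e)) (f (snd e))) / 2" for e
  have "0 < sl e" if "e \<in> S.edge_reps - \<Delta> f" for e
  proof -
    obtain x y where e: "e = (x, y)" by (cases e)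
    then have "(x, y) \<in> Ed" "(x, y) \<notin> \<Delta> f" using that S.edge_reps_Ed by auto
    then show ?thesis using \<Delta>_lt[OF f(2)] unfolding sl_def e by simp
  qed
  moreover have "finite (S.edge_reps - \<Delta> f)" using S.edge_reps_finite by simp
  ultimately obtain \<epsilon>2 where e2: "\<epsilon>2 > 0" "\<forall>e\<in>S.edge_reps - \<Delta> f. \<epsilon>2 < sl e"
    using finite_pos_bound[of "S.edge_reps - \<Delta> f" sl] by blast
  define \<epsilon> where "\<epsilon> = min \<epsilon>1 \<epsilon>2"
  have eps: "\<epsilon> > 0" "\<And>w. w \<in> W \<Longrightarrow> \<epsilon> < d' (f v) (p w)"
    "\<And>e. e \<in> S.edge_reps - \<Delta> f \<Longrightarrow> \<epsilon> < sl e"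
    unfolding \<epsilon>_def min_less_iff_disj using e1 e2 by simp_all
  have pd: "d' (f v) (p w) \<le> d' (f v) (f w)" if "w \<in> W" for w
    using S'.seg_dist_add[OF fv fw[OF that] p(2)[OF that]] mdist_nonneg[of M' "p w" "f w"] by linarith
  have epsD: "\<epsilon> < d' (f v) (f w)" if "w \<in> W" for w using eps(2)[OF that] pd[OF that] by linarith
  obtain b where b: "b \<in> S'.sg (f v) (f w0)" "d' (f v) b = \<epsilon>"
    using S'.seg_point[OF fv fw[OF w0W], of \<epsilon>] eps(1) epsD[OF w0W] by (metis less_imp_le)
  have bX: "b \<in> X'" using b S'.seg_subset[OF fv fw[OF w0W]] by blast
  have bw: "b \<in> S'.sg (f v) (f w)" if w: "w \<in> W" for w
  proof -
    have "b \<in> S'.sg (f v) (p w)"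
      using S'.seg_order(1)[OF fv fw[OF w0W] b(1) p(1)[OF w]] b(2) eps(2)[OF w] by simp
    moreover have "S'.sg (f v) (p w) \<subseteq> S'.sg (f v) (f w)"
      using S'.seg_mono[OF fv fw[OF w] _ p(2)[OF w]] fv fw[OF w] by simp
    ultimately show ?thesis by blast
  qed
  \<comment> \<open>A stabilizing element permutes the tension edges at \<open>v\<close>, and the
    images of all of them share the point at distance \<open>\<epsilon>\<close> from
    \<open>f v\<close>.\<close>
  have bfix: "\<phi>' g b = b" if g: "g \<in> FF" "\<phi> g v = v" for g
  proof -
    have gW: "\<phi> g w0 \<in> W" using \<Delta>_act[OF f(1) g(1) w0] g unfolding W_def by simp
    have fg: "\<phi>' g (f v) = f v" "\<phi>' g (f w0) = f (\<phi> g w0)"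
      using equiv_act[OF f(1) g(1)] E g by metis+
    have "\<phi>' g b \<in> S'.sg (f v) (f (\<phi> g w0))" using S'.act_seg[OF g(1) fv fw[OF w0W] b(1)] fg by simp
    moreover have "d' (f v) (\<phi>' g b) = d' (f v) b" using S'.act_iso[OF g(1) fv bX] fg by simp
    ultimately show ?thesis using S'.seg_eqI[OF fv fw[OF gW] _ bw[OF gW]] by simp
  qed
  obtain f' where f': "equivariant f'" "\<And>g. g \<in> FF \<Longrightarrow> f' (\<phi> g v) = \<phi>' g b"
    "\<And>u. u \<notin> orbit F \<phi> v \<Longrightarrow> f' u = f u"
    using move_vertex[OF f(1) E(1) bX bfix] by blast
  have close: "d' (f' u) (f u) \<le> \<epsilon>" if u: "u \<in> V" for u
  proof (cases "u \<in> orbit F \<phi> v")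
    case True
    then obtain g where g: "g \<in> FF" "u = \<phi> g v" unfolding orbit_def by auto
    have "d' (\<phi>' g b) (\<phi>' g (f v)) = d' (f v) b" using S'.act_iso[OF g(1) bX fv] S'.d_comm by simp
    then show ?thesis using f'(2)[OF g(1)] equiv_act[OF f(1) g(1) E(1)] g b(2) by simp
  next
    case False
    then show ?thesis using f'(3) equivX[OF f(1) u] eps(1) by simp
  qed
  have push: "f' x \<in> S'.sg (f x) (f y) \<and> d' (f x) (f' x) = \<epsilon> \<and> \<epsilon> < d' (f x) (f y)"
    if xy: "(x, y) \<in> \<Delta> f" and x: "x \<in> orbit F \<phi> v" for x y
  proof -
    obtain g where g: "g \<in> FF" "x = \<phi> g v" using x unfolding orbit_def by auto
    define w where "w = \<phi> (inv\<^bsub>F\<^esub> g) y"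
    have yX: "y \<in> S.X" using S.edgeD[OF \<Delta>_Ed[OF xy]] by blast
    have y: "y = \<phi> g w" unfolding w_def using S.act_inv'[OF g(1) yX] by simp
    have "(\<phi> (inv\<^bsub>F\<^esub> g) x, w) \<in> \<Delta> f" unfolding w_def using \<Delta>_act[OF f(1) _ xy] g by simp
    then have w: "w \<in> W" unfolding W_def using g S.act_inv[OF g(1) E(3)] by simp
    have fx: "f x = \<phi>' g (f v)" "f y = \<phi>' g (f w)" "f' x = \<phi>' g b"
      using equiv_act[OF f(1) g(1)] E WV[OF w] f'(2)[OF g(1)] g y by simp_all
    show ?thesis unfolding fx
      using S'.act_seg[OF g(1) fv fw[OF w] bw[OF w]] S'.act_iso[OF g(1) fv bX]
        S'.act_iso[OF g(1) fv fw[OF w]] b(2) epsD[OF w] by simp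
  qed
  have less1: "d' (f' x) (f' y) < d' (f x) (f y)"
    if xy: "(x, y) \<in> \<Delta> f" and x: "x \<in> orbit F \<phi> v" for x y
  proof -
    note e = S.edgeD[OF \<Delta>_Ed[OF xy]]
    have X: "f x \<in> X'" "f y \<in> X'" using equivX f e by auto
    note px = push[OF xy x]
    have f'x: "f' x \<in> S'.sg (f x) (f y)" using px by blast
    show ?thesis
    proof (cases "y \<in> orbit F \<phi> v")
      case False
      then show ?thesis using f'(3)[OF False] S'.seg_dist_add[OF X f'x] px eps(1) by simp
    next
      case True
      \<comment> \<open>Both ends are pushed inwards, possibly past each other. The new length is
        the absolute value of the old one minus \<open>2 * \<epsilon>\<close>, and this is smaller
        because \<open>\<epsilon>\<close> is less than the old length.\<close>
      note py = push[OF \<Delta>_sym[OF xy] True]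
      have f'y: "f' y \<in> S'.sg (f x) (f y)" using py S'.seg_comm[OF X] by simp
      have "d' (f x) (f' y) = d' (f x) (f y) - \<epsilon>"
        using S'.seg_dist_add[OF X f'y] py S'.d_comm[of "f y" "f' y"] by simp
      then show ?thesis using S'.seg_dist[OF X f'x f'y] px eps(1) by linarith
    qed
  qed
  have slack: "d' (f x) (f y) = \<Lambda> * d x y \<or> d' (f x) (f y) + 2 * \<epsilon> < \<Lambda> * d x y"
    if e: "(x, y) \<in> Ed" for x y
  proof (rule edge_reps_all[OF f(1) _ e, where P = "\<lambda>s t. s = \<Lambda> * t \<or> s + 2 * \<epsilon> < \<Lambda> * t"])
    fix b c assume bc: "(b, c) \<in> S.edge_reps"
    show "d' (f b) (f c) = \<Lambda> * d b c \<or> d' (f b) (f c) + 2 * \<epsilon> < \<Lambda> * d b c"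
    proof (cases "(b, c) \<in> \<Delta> f")
      case True
      then show ?thesis using \<Delta>_eq by blast
    next
      case False
      then have "\<epsilon> < sl (b, c)" using eps(3) bc by blast
      then show ?thesis unfolding sl_def by simp
    qed
  qed
  have main: "d' (f' x) (f' y) \<le> \<Lambda> * d x y \<and>
      (d' (f' x) (f' y) = \<Lambda> * d x y \<longrightarrow> (x, y) \<in> \<Delta> f \<and> x \<notin> orbit F \<phi> v)"
    if e: "(x, y) \<in> Ed" for x y
  proof (cases "(x, y) \<in> \<Delta> f")
    case False
    note ed = S.edgeD[OF e]
    have X: "f x \<in> X'" "f y \<in> X'" "f' x \<in> X'" "f' y \<in> X'" using equivX f f' ed by auto
    have "d' (f x) (f y) + 2 * \<epsilon> < \<Lambda> * d x y" using slack[OF e] False e unfolding \<Delta>_def by auto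
    then have "d' (f' x) (f' y) < \<Lambda> * d x y"
      using close[OF ed(1)] close[OF ed(2)] S'.d_comm[of "f' y" "f y"]
        S'.d_triangle[OF X(3,1,4)] S'.d_triangle[OF X(1,2,4)] by linarith
    then show ?thesis by simp
  next
    case True
    note eq = \<Delta>_eq[OF True]
    consider "x \<in> orbit F \<phi> v" | "x \<notin> orbit F \<phi> v" "y \<in> orbit F \<phi> v"
      | "x \<notin> orbit F \<phi> v" "y \<notin> orbit F \<phi> v" by blast
    then show ?thesis
    proof cases
      case 1
      then show ?thesis using less1[OF True 1] eq by simp
    next
      case 2
      then show ?thesis using less1[OF \<Delta>_sym[OF True] 2(2)] eq S'.d_comm[of "f' x" "f' y"]
          S'.d_comm[of "f x" "f y"] True by simp
    next
      case 3
      then show ?thesis using f'(3) eq True by simp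
    qed
  qed
  then have lip': "lipV f' \<Lambda>" unfolding lipV_def by blast
  have sub: "\<Delta> f' \<subseteq> \<Delta> f" using main unfolding \<Delta>_def[of f'] by blast
  \<comment> \<open>The relaxed edge from \<open>v\<close> to \<open>w0\<close> has a translate in
    \<open>edge_reps\<close>, which makes the count drop strictly.\<close>
  obtain g x y where g: "g \<in> FF" "(x, y) \<in> S.edge_reps" "v = \<phi> g x" "w0 = \<phi> g y"
    using S.edge_reps_cover[OF \<Delta>_Ed[OF w0]] by blast
  have xE: "(x, y) \<in> Ed" using g S.edge_reps_Ed by blast
  note xD = S.edgeD[OF xE]
  have inv: "x = \<phi> (inv\<^bsub>F\<^esub> g) v" "y = \<phi> (inv\<^bsub>F\<^esub> g) w0" using S.act_inv[OF g(1)] xD g by auto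
  have "(x, y) \<in> \<Delta> f" unfolding inv using \<Delta>_act[OF f(1) _ w0] g by simp
  moreover have "x \<in> orbit F \<phi> v" unfolding orbit_def using inv g by auto
  then have "(x, y) \<notin> \<Delta> f'" using main[OF xE] unfolding \<Delta>_def by blast
  ultimately have "\<Delta> f' \<inter> S.edge_reps \<subset> \<Delta> f \<inter> S.edge_reps" using sub g by blast
  then have "card (\<Delta> f' \<inter> S.edge_reps) < card (\<Delta> f \<inter> S.edge_reps)" using S.edge_reps_finite by (intro psubset_card_mono) auto
  then show False using opt f'(1) lip' unfolding opt_def by fastforce
qed

section \<open>Affine extension over the edges and the value of \<open>Lip\<close>\<close>

text \<open>\<open>on_edge f x y p q\<close>: under the map that is affine on the edge from \<open>x\<close> to \<open>y\<close>, the point \<open>p\<close>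
  goes to \<open>q\<close>.\<close>

definition on_edge where
  "on_edge f x y p q \<longleftrightarrow> q \<in> S'.sg (f x) (f y) \<and> d' (f x) q * d x y = d x p * d' (f x) (f y)"

lemma on_edge_sym:
  assumes f: "equivariant f" and e: "(x, y) \<in> Ed" and p: "p \<in> S.sg x y" and "on_edge f x y p q"
  shows "on_edge f y x p q"
proof -
  note E = S.edgeD[OF e]
  have X: "f x \<in> X'" "f y \<in> X'" using equivX f E by auto
  have q: "q \<in> S'.sg (f x) (f y)" and m: "d' (f x) q * d x y = d x p * d' (f x) (f y)"
    using assms unfolding on_edge_def by auto
  have 1: "d' (f y) q = d' (f x) (f y) - d' (f x) q"
    using S'.seg_dist_add[OF X q] S'.d_comm[of "f y" q] by simp
  have 2: "d y p = d x y - d x p"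
    using S.seg_dist_add[OF E(3,4) p] S.d_comm[of y p] by simp
  have "(d' (f x) (f y) - d' (f x) q) * d x y = d' (f x) (f y) * d x y - d x p * d' (f x) (f y)"
    using m by (simp add: left_diff_distrib)
  also have "\<dots> = (d x y - d x p) * d' (f x) (f y)" by (simp add: algebra_simps)
  finally have "d' (f y) q * d x y = d y p * d' (f x) (f y)" unfolding 1 2 .
  then show ?thesis
    unfolding on_edge_def using q S'.seg_comm[OF X] S.d_comm[of y x] S'.d_comm[of "f y" "f x"] by simp
qed

lemma on_edge_dist:
  assumes f: "equivariant f" "lipV f L" and e: "(x, y) \<in> Ed" and p: "p \<in> S.sg x y" "p' \<in> S.sg x y"
    and q: "on_edge f x y p q" "on_edge f x y p' q'"
  shows "d' q q' \<le> L * d p p'"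
proof -
  note E = S.edgeD[OF e]
  have X: "f x \<in> X'" "f y \<in> X'" using equivX f E by auto
  have pos: "d x y > 0" using S.edge_pos e by blast
  have "d' q q' * d x y = \<bar>d' (f x) q - d' (f x) q'\<bar> * d x y"
    using S'.seg_dist[OF X] q unfolding on_edge_def by simp
  also have "\<dots> = \<bar>d' (f x) q * d x y - d' (f x) q' * d x y\<bar>"
    using pos by (simp add: abs_mult left_diff_distrib[symmetric])
  also have "\<dots> = \<bar>d x p * d' (f x) (f y) - d x p' * d' (f x) (f y)\<bar>"
    using q unfolding on_edge_def by simp
  also have "\<dots> = \<bar>d x p - d x p'\<bar> * d' (f x) (f y)"
    by (simp add: abs_mult left_diff_distrib[symmetric])
  also have "\<dots> = d p p' * d' (f x) (f y)" using S.seg_dist[OF E(3,4) p] by simp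
  also have "\<dots> \<le> d p p' * (L * d x y)"
    using f(2) e unfolding lipV_def by (intro mult_left_mono) auto
  finally have "d' q q' * d x y \<le> (L * d p p') * d x y" by (simp add: mult_ac)
  then show ?thesis using pos by simp
qed

lemma on_edge_ends:
  assumes f: "equivariant f" and e: "(x, y) \<in> Ed"
  shows "on_edge f x y x (f x)" "on_edge f x y y (f y)"
  using equivX[OF f] S.edgeD[OF e] unfolding on_edge_def by auto

lemma on_edge_unique:
  assumes f: "equivariant f" and e: "(x, y) \<in> Ed" and p: "p \<in> S.sg x y"
    and q: "on_edge f x y p q" "on_edge f x y p q'"
  shows "q = q'"
proof -
  have X: "f x \<in> X'" "f y \<in> X'" using equivX f S.edgeD[OF e] by auto
  have "d' (f x) q * d x y = d' (f x) q' * d x y" using q unfolding on_edge_def by simp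
  then have "d' (f x) q = d' (f x) q'" using S.edge_pos[OF e] by simp
  then show ?thesis using S'.seg_eqI[OF X] q unfolding on_edge_def by blast
qed

lemma on_edge_exists:
  assumes f: "equivariant f" and e: "(x, y) \<in> Ed" and p: "p \<in> S.sg x y"
  shows "\<exists>q. on_edge f x y p q"
proof -
  note E = S.edgeD[OF e]
  have X: "f x \<in> X'" "f y \<in> X'" using equivX f E by auto
  have pos: "d x y > 0" using S.edge_pos e by blast
  define t where "t = d x p * d' (f x) (f y) / d x y"
  have le: "d x p \<le> d x y"
    using S.seg_dist_add[OF E(3,4) p] mdist_nonneg[of M p y] by linarith
  have "t \<ge> 0" unfolding t_def by simp
  moreover have "d x p * d' (f x) (f y) \<le> d x y * d' (f x) (f y)" using le by (intro mult_right_mono) auto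
  then have "t \<le> d' (f x) (f y)" unfolding t_def using pos by (simp add: pos_divide_le_eq mult.commute)
  ultimately obtain q where "q \<in> S'.sg (f x) (f y)" "d' (f x) q = t" by (rule S'.seg_point[OF X])
  then show ?thesis unfolding on_edge_def t_def using pos by (intro exI[of _ q]) simp
qed

lemma on_edge_act:
  assumes f: "equivariant f" and e: "(x, y) \<in> Ed" and p: "p \<in> S.sg x y" and g: "g \<in> FF"
    and q: "on_edge f x y p q"
  shows "on_edge f (\<phi> g x) (\<phi> g y) (\<phi> g p) (\<phi>' g q)"
proof -
  note E = S.edgeD[OF e]
  have X: "f x \<in> X'" "f y \<in> X'" using equivX f E by auto
  have qX: "q \<in> X'" using q S'.seg_subset[OF X] unfolding on_edge_def by blast
  have pX: "p \<in> S.X" using p S.seg_subset E by blast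
  have fg: "f (\<phi> g x) = \<phi>' g (f x)" "f (\<phi> g y) = \<phi>' g (f y)" using equiv_act f g E by auto
  show ?thesis unfolding on_edge_def fg
    using S'.act_seg[OF g X] q S'.act_iso[OF g X(1) qX] S'.act_iso[OF g X] S.act_iso[OF g E(3) pX]
      S.act_iso[OF g E(3,4)] unfolding on_edge_def by simp
qed

text \<open>The value at a point must not depend on the edge chosen around it, so \<open>R\<close>
  asks for compatibility with all of them. The Lipschitz bound is obtained on one edge and between
  vertices, and in general by cutting a segment where it leaves an edge.\<close>

lemma extension:
  assumes f: "equivariant f" "lipV f L"
  shows "\<exists>h \<in> S.X \<rightarrow> X'. (\<forall>g\<in>FF. \<forall>x\<in>S.X. h (\<phi> g x) = \<phi>' g (h x)) \<and>
    (\<forall>x\<in>S.X. \<forall>y\<in>S.X. d' (h x) (h y) \<le> L * d x y)"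
proof -
  define R where "R p q \<longleftrightarrow> q \<in> X' \<and> (p \<in> V \<longrightarrow> q = f p) \<and>
    (\<forall>x y. (x, y) \<in> Ed \<and> p \<in> S.sg x y \<longrightarrow> on_edge f x y p q)" for p q
  have RV: "R p (f p)" if p: "p \<in> V" for p
  proof -
    have "on_edge f x y p (f p)" if e: "(x, y) \<in> Ed" and "p \<in> S.sg x y" for x y
    proof -
      have "p = x \<or> p = y" using S.edgeD(6)[OF e] that(2) p by blast
      then show ?thesis using on_edge_ends[OF f(1) e] by blast
    qed
    then show ?thesis unfolding R_def using equivX f p by blast
  qed
  have Rex: "\<exists>q. R p q" if p: "p \<in> S.X" for p
  proof (cases "p \<in> V")
    case False
    obtain x y where xy: "(x, y) \<in> Ed" "p \<in> S.sg x y" using S.ex_edge[OF p False] by blast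
    obtain q where q: "on_edge f x y p q" using on_edge_exists[OF f(1) xy] by blast
    have "f x \<in> X'" "f y \<in> X'" using equivX f S.edgeD[OF xy(1)] by auto
    then have qX: "q \<in> X'" using q S'.seg_subset unfolding on_edge_def by blast
    have "on_edge f u v p q" if uv: "(u, v) \<in> Ed" "p \<in> S.sg u v" for u v
    proof -
      have "u = x \<and> v = y \<or> u = y \<and> v = x" using S.edge_unique[OF xy(1) uv(1) xy(2) uv(2) False] .
      then show ?thesis using q on_edge_sym[OF f(1) xy q] by blast
    qed
    then show ?thesis unfolding R_def using qX False by blast
  qed (use RV in blast)
  define h where "h p = (SOME q. R p q)" for p
  have h: "R p (h p)" if "p \<in> S.X" for p unfolding h_def using someI_ex[OF Rex[OF that]] .
  have hX: "h p \<in> X'" if "p \<in> S.X" for p using h[OF that] unfolding R_def by blast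
  have hV: "h p = f p" if "p \<in> V" for p using h[of p] that S.V_X unfolding R_def by blast
  have hE: "on_edge f x y p (h p)" if "(x, y) \<in> Ed" "p \<in> S.sg x y" for x y p
  proof -
    have "p \<in> S.X" using that S.seg_subset S.edgeD by blast
    then show ?thesis using h[of p] that unfolding R_def by blast
  qed
  have act: "h (\<phi> g p) = \<phi>' g (h p)" if g: "g \<in> FF" and p: "p \<in> S.X" for g p
  proof (cases "p \<in> V")
    case True
    then show ?thesis using hV S.act_V g equiv_act f by simp
  next
    case False
    obtain x y where xy: "(x, y) \<in> Ed" "p \<in> S.sg x y" using S.ex_edge[OF p False] by blast
    note e = S.act_edge[OF g xy(1)]
    have pg: "\<phi> g p \<in> S.sg (\<phi> g x) (\<phi> g y)" using S.act_seg[OF g _ _ xy(2)] S.edgeD[OF xy(1)] by blast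
    show ?thesis
      using on_edge_unique[OF f(1) e pg hE[OF e pg] on_edge_act[OF f(1) xy g hE[OF xy]]] .
  qed
  have edge_lip: "d' (h p) (h q) \<le> L * d p q"
    if "(x, y) \<in> Ed" "p \<in> S.sg x y" "q \<in> S.sg x y" for x y p q
    using on_edge_dist[OF f that(1) that(2,3) hE[OF that(1,2)] hE[OF that(1,3)]] .
  have through: "d' (h p) (h q) \<le> L * d p q"
    if X: "p \<in> S.X" "q \<in> S.X" "z \<in> S.sg p q" and "d' (h p) (h z) \<le> L * d p z"
      "d' (h z) (h q) \<le> L * d z q" for p q z
  proof -
    have z: "z \<in> S.X" using X S.seg_subset by blast
    have "L * d p q = L * d p z + L * d z q" using S.seg_dist_add[OF X] by (metis distrib_left)
    then show ?thesis using S'.d_triangle[OF hX[OF X(1)] hX[OF z] hX[OF X(2)]] that by linarith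
  qed
  have vert: "d' (h p) (h u) \<le> L * d p u" if p: "p \<in> S.X" and u: "u \<in> V" for p u
  proof (cases "p \<in> V")
    case True
    then show ?thesis using lipV_all[OF f True u] hV u by simp
  next
    case False
    obtain x y where xy: "(x, y) \<in> Ed" "p \<in> S.sg x y" using S.ex_edge[OF p False] by blast
    note E = S.edgeD[OF xy(1)]
    obtain z where z: "z \<in> {x, y}" "z \<in> S.sg p u" using S.exit_vertex[OF xy u] by blast
    have zs: "z \<in> S.sg x y" "z \<in> V" using z E by auto
    have "d' (h z) (h u) \<le> L * d z u" using lipV_all[OF f zs(2) u] hV u zs by simp
    then show ?thesis using through[OF p _ z(2) edge_lip[OF xy zs(1)]] u S.V_X by blast
  qed
  have "d' (h p) (h q) \<le> L * d p q" if p: "p \<in> S.X" and q: "q \<in> S.X" for p q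
  proof (cases "p \<in> V")
    case True
    then show ?thesis using vert[OF q True] S.d_comm S'.d_comm by metis
  next
    case False
    obtain x y where xy: "(x, y) \<in> Ed" "p \<in> S.sg x y" using S.ex_edge[OF p False] by blast
    note E = S.edgeD[OF xy(1)]
    show ?thesis
    proof (cases "q \<in> S.sg x y")
      case True
      then show ?thesis using edge_lip xy by blast
    next
      case False
      obtain z where z: "z \<in> {x, y}" "z \<in> S.sg p q" using S.exit_edge[OF xy q False] by blast
      have zs: "z \<in> S.sg x y" "z \<in> V" using z E by auto
      have "d' (h z) (h q) \<le> L * d z q" using vert[OF q zs(2)] S.d_comm S'.d_comm by metis
      then show ?thesis using through[OF p q z(2) edge_lip[OF xy zs(1)]] by blast
    qed
  qed
  then show ?thesis using hX act by (intro bexI[of _ h]) auto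
qed

text \<open>Any equivariant Lipschitz map has a constant of at least the ratio of the translation
  lengths of \<open>g\<close>, which is \<open>\<Lambda>\<close>; and the affine extension of a
  minimizer attains it.\<close>

lemma Lip_eqI:
  assumes g: "g \<in> FF" and y: "y \<in> S.X" "d y (\<phi> g y) = translation_length M \<phi> g"
    and hyp: "translation_length M \<phi> g > 0"
    and t: "translation_length M' \<phi>' g = \<Lambda> * translation_length M \<phi> g"
  shows "Lip F M \<phi> M' \<phi>' = \<Lambda>"
  unfolding Lip_def
proof (rule cInf_eq_minimum)
  obtain f where f: "equivariant f" "lipV f \<Lambda>" using minimizer_exists by blast
  show "\<Lambda> \<in> {L. 0 \<le> L \<and> (\<exists>f\<in>S.X \<rightarrow> X'. (\<forall>g\<in>FF. \<forall>x\<in>S.X. f (\<phi> g x) = \<phi>' g (f x)) \<and>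
      (\<forall>x\<in>S.X. \<forall>y\<in>S.X. d' (f x) (f y) \<le> L * d x y))}"
    using extension[OF f] \<Lambda>_nonneg by blast
next
  fix L assume "L \<in> {L. 0 \<le> L \<and> (\<exists>f\<in>S.X \<rightarrow> X'. (\<forall>g\<in>FF. \<forall>x\<in>S.X. f (\<phi> g x) = \<phi>' g (f x)) \<and>
      (\<forall>x\<in>S.X. \<forall>y\<in>S.X. d' (f x) (f y) \<le> L * d x y))}"
  then obtain f where f: "f \<in> S.X \<rightarrow> X'" "\<forall>g\<in>FF. \<forall>x\<in>S.X. f (\<phi> g x) = \<phi>' g (f x)"
    "\<forall>x\<in>S.X. \<forall>y\<in>S.X. d' (f x) (f y) \<le> L * d x y" by blast
  have fy: "f y \<in> X'" using f y by blast
  have "bdd_below ((\<lambda>x. d' x (\<phi>' g x)) ` X')" by (rule bdd_belowI2[of _ 0]) simp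
  then have "translation_length M' \<phi>' g \<le> d' (f y) (\<phi>' g (f y))"
    unfolding translation_length_def using fy by (rule cINF_lower)
  also have "\<dots> = d' (f y) (f (\<phi> g y))" using f(2) g y by simp
  also have "\<dots> \<le> L * translation_length M \<phi> g" using f(3) y S.act_X[OF g] by metis
  finally have "\<Lambda> * translation_length M \<phi> g \<le> L * translation_length M \<phi> g" using t by simp
  then show "\<Lambda> \<le> L" using hyp by simp
qed

end

section \<open>Translation length along a periodic geodesic\<close>

context gtree
begin

text \<open>Along the geodesic, the \<open>n\<close>-th power of \<open>g\<close> moves
  \<open>x 0\<close> by exactly \<open>n\<close> times the distance from \<open>x 0\<close> to
  \<open>x K\<close>. A point moved by less would fall behind by an amount linear in
  \<open>n\<close>, whereas the displacements of two points differ by at most twice their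
  distance.\<close>

lemma periodic_geodesic_translation:
  assumes g: "g \<in> FF" and x: "\<And>n. x n \<in> X" and K: "K > 0"
    and per: "\<And>n. x (n + K) = act g (x n)"
    and geo: "\<And>n. d (x 0) (x n) = (\<Sum>i<n. d (x i) (x (Suc i)))"
  shows "translation_length M \<phi> g = d (x 0) (x K)"
proof -
  let ?t = "d (x 0) (x K)"
  have pw: "x (n * K) = (act g ^^ n) (x 0)" for n
  proof (induction n)
    case (Suc n)
    have "x (Suc n * K) = act g (x (n * K))" using per[of "n * K"] by (simp add: add.commute)
    then show ?case using Suc by simp
  qed simp
  have pX: "(act g ^^ n) z \<in> X" if "z \<in> X" for n z using that act_X g by (induction n) auto
  have piso: "d ((act g ^^ n) y) ((act g ^^ n) z) = d y z" if "y \<in> X" "z \<in> X" for n y z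
    using that act_iso g pX by (induction n) auto
  have len: "d (x 0) (x (n * K)) = real n * ?t" for n
  proof (induction n)
    case (Suc n)
    have step: "d (x (i + K)) (x (Suc i + K)) = d (x i) (x (Suc i))" for i
      using per[of i] per[of "Suc i"] act_iso[OF g x x] by simp
    have "(\<Sum>i<Suc n * K. d (x i) (x (Suc i)))
        = (\<Sum>i<K. d (x i) (x (Suc i))) + (\<Sum>i<n * K. d (x (i + K)) (x (Suc i + K)))"
    proof -
      have "(\<Sum>i<m + K. h i) = (\<Sum>i<K. h i) + (\<Sum>i<m. h (i + K))" for m and h :: "nat \<Rightarrow> real"
        by (induction m) auto
      from this[where m = "n * K" and h = "\<lambda>i. d (x i) (x (Suc i))"] show ?thesis by (simp add: add.commute)
    qed
    also have "\<dots> = ?t + real n * ?t" unfolding step using geo[of K] geo[of "n * K"] Suc by simp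
    finally show ?case using geo[of "Suc n * K"] by (simp add: algebra_simps)
  qed (use x in simp)
  have lower: "?t \<le> d z (act g z)" if z: "z \<in> X" for z
  proof (rule ccontr)
    assume "\<not> ?thesis"
    then have pos: "?t - d z (act g z) > 0" by simp
    have up: "d z ((act g ^^ n) z) \<le> real n * d z (act g z)" for n
    proof (induction n)
      case (Suc n)
      have "d ((act g ^^ n) z) ((act g ^^ Suc n) z) = d z (act g z)"
        using piso[OF z act_X[OF g z], of n] by (simp add: funpow_swap1)
      then have "d z ((act g ^^ Suc n) z) \<le> real n * d z (act g z) + d z (act g z)"
        using d_triangle[OF z pX[OF z, of n] pX[OF z, of "Suc n"]] Suc by linarith
      then show ?case by (simp add: algebra_simps)
    qed (use z in simp)
    have "real n * (?t - d z (act g z)) \<le> 2 * d (x 0) z" for n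
    proof -
      have "d (x 0) (x (n * K)) \<le> d (x 0) z + d z ((act g ^^ n) z) + d ((act g ^^ n) z) (x (n * K))"
        using d_triangle[OF x z x, of 0 "n * K"] d_triangle[OF z pX[OF z, of n] x, of "n * K"] by linarith
      moreover have "d ((act g ^^ n) z) (x (n * K)) = d (x 0) z"
        unfolding pw using piso[OF z x, of n 0] d_comm by simp
      ultimately show ?thesis using len[of n] up[of n] by (simp add: algebra_simps)
    qed
    then show False using reals_Archimedean3[OF pos] by (metis not_less)
  qed
  have "x K = act g (x 0)" using per[of 0] by simp
  then have "?t \<in> (\<lambda>z. d z (act g z)) ` X" using x[of 0] by auto
  then show ?thesis unfolding translation_length_def by (rule cInf_eq_minimum) (use lower in auto)
qed

end


section \<open>Turns in the quotient graph of groups\<close>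

text \<open>Of the two common points on the middle segment, the one nearer to \<open>u\<close> lies
  on all three segments.\<close>

lemma (in rtree) gate_trans:
  assumes X: "u \<in> X" "a \<in> X" "b \<in> X" "c \<in> X"
    and ab: "sg u a \<inter> sg u b \<noteq> {u}" and bc: "sg u b \<inter> sg u c \<noteq> {u}"
  shows "sg u a \<inter> sg u c \<noteq> {u}"
proof -
  have "u \<in> sg u a \<inter> sg u b" "u \<in> sg u b \<inter> sg u c" using X by auto
  then obtain p q where p: "p \<in> sg u a" "p \<in> sg u b" "p \<noteq> u"
    and q: "q \<in> sg u b" "q \<in> sg u c" "q \<noteq> u" using ab bc by blast
  show ?thesis
  proof (cases "d u p \<le> d u q")
    case True
    then have "p \<in> sg u q" using seg_order(1)[OF X(1,3) p(2) q(1)] by simp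
    then have "p \<in> sg u c" using seg_mono[OF X(1,4) seg_ends(1)[OF X(1,4)] q(2)] by blast
    then show ?thesis using p by blast
  next
    case False
    then have "q \<in> sg u p" using seg_order(1)[OF X(1,3) q(1) p(2)] by simp
    then have "q \<in> sg u a" using seg_mono[OF X(1,2) seg_ends(1)[OF X(1,2)] p(1)] by blast
    then show ?thesis using q by blast
  qed
qed

locale lifted_pair = tree_pair M V F \<phi> M' V' \<phi>'
  for M :: "'p metric" and V and F :: "'g monoid" and \<phi> and M' :: "'q metric" and V' and \<phi>' +
  fixes f and s :: "'p set \<Rightarrow> 'p" and l :: "('p \<times> 'p) set \<Rightarrow> 'p \<times> 'p" and c :: "('p \<times> 'p) set \<Rightarrow> 'g"
  assumes f_opt: "opt f" and lifts: "quotient_lifts F M \<phi> V s l c"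
begin

abbreviation Q where "Q \<equiv> quotient_graph_of_groups F M \<phi> V s l c"
abbreviation rev_e where "rev_e e \<equiv> prod.swap ` e"
abbreviation QE where "QE \<equiv> quotient_edges F M \<phi> V"

lemma f_equivariant: "equivariant f" and f_lip: "lipV f \<Lambda>"
  using f_opt unfolding opt_def by auto

section \<open>Orbits of oriented edges\<close>

definition eorb where "eorb x y = {(\<phi> g x, \<phi> g y) |g. g \<in> FF}"

lemma QE_iff: "e \<in> QE \<longleftrightarrow> (\<exists>x y. (x, y) \<in> Ed \<and> e = eorb x y)"
  unfolding quotient_edges_def orbits_def orbit_def eorb_def by (auto simp: map_prod_def)

lemma eorb_act:
  assumes "(x, y) \<in> Ed" "g \<in> FF"
  shows "eorb (\<phi> g x) (\<phi> g y) = eorb x y"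
proof -
  have sub: "eorb (\<phi> g x) (\<phi> g y) \<subseteq> eorb x y" if "(x, y) \<in> Ed" "g \<in> FF" for g x y
  proof
    note E = S.edgeD[OF that(1)]
    fix z assume "z \<in> eorb (\<phi> g x) (\<phi> g y)"
    then obtain h where h: "h \<in> FF" "z = (\<phi> h (\<phi> g x), \<phi> h (\<phi> g y))" unfolding eorb_def by blast
    then have "z = (\<phi> (h \<otimes>\<^bsub>F\<^esub> g) x, \<phi> (h \<otimes>\<^bsub>F\<^esub> g) y)"
      using S.act_mult[OF h(1) that(2)] E by simp
    then show "z \<in> eorb x y" unfolding eorb_def using S.F.m_closed[OF h(1) that(2)] by blast
  qed
  have "eorb x y = eorb (\<phi> (inv\<^bsub>F\<^esub> g) (\<phi> g x)) (\<phi> (inv\<^bsub>F\<^esub> g) (\<phi> g y))"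
    using S.act_inv[OF assms(2)] S.edgeD[OF assms(1)] by simp
  also have "\<dots> \<subseteq> eorb (\<phi> g x) (\<phi> g y)" using sub S.act_edge[OF assms(2,1)] assms(2) by simp
  finally show ?thesis using sub[OF assms] by blast
qed

lemma eorb_self:
  assumes "(x, y) \<in> Ed"
  shows "(x, y) \<in> eorb x y"
proof -
  have "(x, y) = (\<phi> \<one>\<^bsub>F\<^esub> x, \<phi> \<one>\<^bsub>F\<^esub> y)" using S.act_one S.edgeD(3,4)[OF assms] by simp
  then show ?thesis unfolding eorb_def using S.F.one_closed by blast
qed

lemma QE_mem:
  assumes "e \<in> QE" "(u, v) \<in> e"
  shows "(u, v) \<in> Ed" "e = eorb u v"
proof -
  obtain x y where xy: "(x, y) \<in> Ed" "e = eorb x y" using assms QE_iff by blast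
  then obtain g where g: "g \<in> FF" "u = \<phi> g x" "v = \<phi> g y"
    using assms(2) unfolding eorb_def by blast
  show "(u, v) \<in> Ed" "e = eorb u v"
    unfolding g(2,3) xy(2) using S.act_edge[OF g(1) xy(1)] eorb_act[OF xy(1) g(1)] by simp_all
qed

lemma QE_transitive:
  assumes "e \<in> QE" "(u, v) \<in> e" "(u', v') \<in> e"
  shows "\<exists>g\<in>FF. u' = \<phi> g u \<and> v' = \<phi> g v"
proof -
  have "(u', v') \<in> eorb u v" using assms(3) QE_mem(2)[OF assms(1,2)] by metis
  then show ?thesis unfolding eorb_def by blast
qed

lemma swap_eorb: "rev_e (eorb x y) = eorb y x"
  unfolding eorb_def Setcompr_eq_image image_image by simp

lemma fst_eorb: "fst ` eorb x y = orbit F \<phi> x"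
  unfolding eorb_def orbit_def Setcompr_eq_image image_image by simp

lemma rev_QE: "e \<in> QE \<Longrightarrow> rev_e e \<in> QE"
  using QE_iff swap_eorb S.edge_sym by metis

lemma rev_rev: "rev_e (rev_e e) = e"
  by (simp add: image_image)

lemma Q_simps [simp]:
  "ini Q e = fst ` e" "bar Q e = rev_e e" "ter Q e = snd ` e" "edges Q = QE"
  "verts Q = orbits F V \<phi>" "vgrp Q v = F\<lparr>carrier := stabilizer F \<phi> (s v)\<rparr>"
  unfolding quotient_graph_of_groups_def ter_def by (simp_all add: image_image)

lemma l_mem: "e \<in> QE \<Longrightarrow> l e \<in> e" and l_rev: "e \<in> QE \<Longrightarrow> l (rev_e e) = prod.swap (l e)"
  and c_FF: "e \<in> QE \<Longrightarrow> c e \<in> FF" and c_ter: "e \<in> QE \<Longrightarrow> \<phi> (c e) (s (snd ` e)) = snd (l e)"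
  and s_mem: "v \<in> orbits F V \<phi> \<Longrightarrow> s v \<in> v"
  using lifts unfolding quotient_lifts_def by auto

lemma l_Ed: "e \<in> QE \<Longrightarrow> (fst (l e), snd (l e)) \<in> Ed"
  using QE_mem l_mem by (metis prod.collapse)

text \<open>Inversions are ruled out by the lifts: an orbit equal to its own reverse would have a
  lift equal to its own reverse.\<close>

lemma rev_ne: "e \<in> QE \<Longrightarrow> rev_e e \<noteq> e"
  using l_rev l_Ed S.edgeD(5) by (metis fst_swap prod.collapse)

lemma verts_QE: "e \<in> QE \<Longrightarrow> fst ` e \<in> orbits F V \<phi>"
  unfolding orbits_def using QE_iff[of e] fst_eorb S.edgeD(1) by blast

lemma s_V:
  assumes v: "v \<in> orbits F V \<phi>"
  shows "s v \<in> V"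
proof -
  obtain x where x: "x \<in> V" "v = orbit F \<phi> x" using v unfolding orbits_def by blast
  have "s v \<in> orbit F \<phi> x" using s_mem[OF v] x(2) by simp
  then obtain g where "g \<in> FF" "s v = \<phi> g x" unfolding orbit_def by blast
  then show ?thesis using S.act_V x(1) by simp
qed

section \<open>Standard lifts and Bass--Serre elements\<close>

text \<open>The translate of \<open>l e\<close> that starts at the chosen lift of the initial vertex of \<open>e\<close> goes from
  \<open>ori e\<close> to \<open>tip e\<close>.\<close>

definition ori :: "('p \<times> 'p) set \<Rightarrow> 'p" where "ori e = s (fst ` e)"

lemma ori_V: "e \<in> QE \<Longrightarrow> ori e \<in> V" unfolding ori_def using verts_QE s_V by blast

lemma ori_X: "e \<in> QE \<Longrightarrow> ori e \<in> S.X" using ori_V S.V_X by blast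

lemma ori_rev: "ori (rev_e e) = s (snd ` e)" unfolding ori_def by (simp add: image_image)

lemma c_ori: "e \<in> QE \<Longrightarrow> \<phi> (c (rev_e e)) (ori e) = fst (l e)"
  using c_ter[OF rev_QE] l_rev unfolding ori_def by (simp add: image_image)

definition tip where "tip e = \<phi> (inv\<^bsub>F\<^esub> (c (rev_e e))) (snd (l e))"

abbreviation ee where "ee e \<equiv> edge_elem F c e"

lemma ee_FF: "e \<in> QE \<Longrightarrow> ee e \<in> FF"
  unfolding edge_elem_def using c_FF rev_QE by simp

lemma lift_edge:
  assumes e: "e \<in> QE"
  shows "ori e = \<phi> (inv\<^bsub>F\<^esub> (c (rev_e e))) (fst (l e))" "(ori e, tip e) \<in> e" "tip e \<in> V" "tip e \<in> S.X"
proof -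
  note k = c_FF[OF rev_QE[OF e]]
  show o: "ori e = \<phi> (inv\<^bsub>F\<^esub> (c (rev_e e))) (fst (l e))"
    using S.act_inv[OF k ori_X[OF e]] c_ori[OF e] by simp
  have "e = eorb (fst (l e)) (snd (l e))" using QE_mem(2)[OF e] l_mem[OF e] by (metis prod.collapse)
  moreover have "(ori e, tip e) \<in> eorb (fst (l e)) (snd (l e))"
    unfolding o tip_def eorb_def using k by auto
  ultimately show m: "(ori e, tip e) \<in> e" by simp
  show "tip e \<in> V" "tip e \<in> S.X" using S.edgeD QE_mem(1)[OF e m] by blast+
qed

text \<open>The translates of \<open>l e\<close> used for \<open>e\<close> and for its reverse are
  normalized at opposite ends; the edge element is the quotient of the two normalizing elements.
  This is what places consecutive edges of a lifted path.\<close>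

lemma ee_tip:
  assumes e: "e \<in> QE"
  shows "\<phi> (ee e) (ori (rev_e e)) = tip e" "\<phi> (ee e) (tip (rev_e e)) = ori e"
proof -
  note k = c_FF[OF rev_QE[OF e]] c_FF[OF e]
  note E = S.edgeD[OF l_Ed[OF e]]
  show "\<phi> (ee e) (ori (rev_e e)) = tip e"
    unfolding edge_elem_def tip_def
    using S.act_mult[OF _ k(2) ori_X[OF rev_QE[OF e]]] k c_ter[OF e] by (simp add: ori_rev)
  have "tip (rev_e e) = \<phi> (inv\<^bsub>F\<^esub> (c e)) (fst (l e))"
    unfolding tip_def rev_rev l_rev[OF e] by simp
  then have "\<phi> (c e) (tip (rev_e e)) = fst (l e)" using S.act_inv'[OF k(2) E(3)] by simp
  then show "\<phi> (ee e) (tip (rev_e e)) = ori e"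
    unfolding edge_elem_def
    using S.act_mult[OF _ k(2) lift_edge(4)[OF rev_QE[OF e]]] k lift_edge(1)[OF e] by simp
qed

section \<open>Turns of tension edges\<close>

definition D where "D = {e \<in> QE. e \<subseteq> \<Delta> f}"

text \<open>Quantifying over all lifts at a common vertex covers every choice of vertex group
  element. For \<open>a = b\<close> the two lifts may still differ, so \<open>N a a\<close> can
  fail; that is the case of a path turning back through a vertex group element.\<close>

definition N where
  "N a b \<longleftrightarrow> (\<forall>v w w'. (v, w) \<in> a \<longrightarrow> (v, w') \<in> b \<longrightarrow>
     S'.sg (f v) (f w) \<inter> S'.sg (f v) (f w') \<noteq> {f v})"

lemma D_QE: "e \<in> D \<Longrightarrow> e \<in> QE" and D_\<Delta>: "e \<in> D \<Longrightarrow> (x, y) \<in> e \<Longrightarrow> (x, y) \<in> \<Delta> f"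
  unfolding D_def by auto

lemma eorb_D:
  assumes "(x, y) \<in> \<Delta> f"
  shows "eorb x y \<in> D"
  unfolding D_def using QE_iff \<Delta>_Ed[OF assms] \<Delta>_act[OF f_equivariant _ assms] unfolding eorb_def by blast

lemma D_fin: "finite D"
proof -
  have "D \<subseteq> (\<lambda>(x, y). eorb x y) ` S.edge_reps"
  proof
    fix e assume "e \<in> D"
    then obtain x y where xy: "(x, y) \<in> Ed" "e = eorb x y" using D_QE QE_iff by blast
    obtain g b b' where g: "g \<in> FF" "(b, b') \<in> S.edge_reps" "x = \<phi> g b" "y = \<phi> g b'"
      using S.edge_reps_cover[OF xy(1)] by blast
    then have "e = eorb b b'" using eorb_act S.edge_reps_Ed xy by blast
    then show "e \<in> (\<lambda>(x, y). eorb x y) ` S.edge_reps" using g by force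
  qed
  then show ?thesis using S.edge_reps_finite finite_subset by blast
qed

lemma f_vert: "v \<in> V \<Longrightarrow> f v \<in> X'"
  using equivX f_equivariant by blast

lemma \<Delta>_X':
  assumes "(x, y) \<in> \<Delta> f"
  shows "f x \<in> X'" "f y \<in> X'" "f x \<noteq> f y"
proof -
  note E = S.edgeD[OF \<Delta>_Ed[OF assms]]
  show X: "f x \<in> X'" "f y \<in> X'" using f_vert E by auto
  have "d' (f x) (f y) > 0" using \<Delta>_eq[OF assms] \<Lambda>_pos S.edge_pos[OF \<Delta>_Ed[OF assms]] by simp
  then show "f x \<noteq> f y" using X by auto
qed

text \<open>For transitivity, lifts of the first and third edge at \<open>v\<close> are compared
  with a lift of the second at \<open>v\<close>, which exists because the initial vertices agree.
  The existence of an allowed turn is \<open>gates\<close>, that is, the optimality of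
  \<open>f\<close>.\<close>

sublocale turns Q D N
proof
  show "finite D" by (rule D_fin)
  show "D \<subseteq> edges Q" using D_QE by auto
  fix e assume e: "e \<in> D"
  show "bar Q e \<in> D"
  proof -
    have "rev_e e \<subseteq> \<Delta> f" using D_\<Delta>[OF e] \<Delta>_sym by auto
    then show ?thesis using rev_QE[OF D_QE[OF e]] unfolding D_def by simp
  qed
  show "bar Q (bar Q e) = e" using rev_rev by simp
  show "bar Q e \<noteq> e" using rev_ne D_QE[OF e] by simp
next
  fix a b assume "N a b"
  then show "N b a" unfolding N_def by (metis Int_commute)
next
  fix a b c assume D: "a \<in> D" "b \<in> D" "c \<in> D" and ini: "ini Q a = ini Q b" "ini Q b = ini Q c"
    and N: "N a b" "N b c"
  show "N a c" unfolding N_def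
  proof (intro allI impI)
    fix v w w' assume v: "(v, w) \<in> a" "(v, w') \<in> c"
    have "v \<in> fst ` a" using v(1) by force
    then have "v \<in> fst ` b" using ini by simp
    then obtain u where u: "(v, u) \<in> b" by auto
    note X = \<Delta>_X'(1,2)[OF D_\<Delta>[OF D(1) v(1)]] \<Delta>_X'(2)[OF D_\<Delta>[OF D(2) u]]
      \<Delta>_X'(2)[OF D_\<Delta>[OF D(3) v(2)]]
    have "S'.sg (f v) (f w) \<inter> S'.sg (f v) (f u) \<noteq> {f v}"
      "S'.sg (f v) (f u) \<inter> S'.sg (f v) (f w') \<noteq> {f v}"
      using N v u unfolding N_def by blast+
    then show "S'.sg (f v) (f w) \<inter> S'.sg (f v) (f w') \<noteq> {f v}" by (rule S'.gate_trans[OF X])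
  qed
next
  fix a assume a: "a \<in> D"
  obtain v w where v: "(v, w) \<in> a" using l_mem[OF D_QE[OF a]] by (metis prod.collapse)
  then obtain w' where w': "(v, w') \<in> \<Delta> f" "S'.sg (f v) (f w) \<inter> S'.sg (f v) (f w') = {f v}"
    using gates[OF f_opt D_\<Delta>[OF a v]] by blast
  have "ini Q (eorb v w') = ini Q a" using QE_mem(2)[OF D_QE[OF a] v] fst_eorb by simp
  moreover have "\<not> N a (eorb v w')" unfolding N_def using v w' eorb_self \<Delta>_Ed by blast
  ultimately show "\<exists>b\<in>D. ini Q b = ini Q a \<and> \<not> N a b" using eorb_D[OF w'(1)] by blast
qed

lemma D_nonempty: "D \<noteq> {}"
proof -
  have "\<Delta> f \<noteq> {}" using \<Delta>_nonempty[OF f_equivariant f_lip] by blast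
  then show ?thesis using eorb_D by (metis empty_iff equals0I surj_pair)
qed

definition opens where
  "opens u a b \<longleftrightarrow> S'.sg (f u) (f a) \<inter> S'.sg (f u) (f b) = {f u}"

lemma opens_act:
  assumes g: "g \<in> FF" and V: "u \<in> V" "a \<in> V" "b \<in> V"
  shows "opens (\<phi> g u) (\<phi> g a) (\<phi> g b) \<longleftrightarrow> opens u a b"
proof -
  have X: "f u \<in> X'" "f a \<in> X'" "f b \<in> X'" using f_vert V by auto
  have "inj_on (\<phi>' g) X'" using S'.act_inj[OF g] by (intro inj_onI) blast
  then have i: "\<phi>' g ` (S'.sg (f u) (f a) \<inter> S'.sg (f u) (f b))
      = \<phi>' g ` S'.sg (f u) (f a) \<inter> \<phi>' g ` S'.sg (f u) (f b)"
    using S'.seg_subset X by (intro inj_on_image_Int) auto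
  have "opens (\<phi> g u) (\<phi> g a) (\<phi> g b) \<longleftrightarrow>
      \<phi>' g ` (S'.sg (f u) (f a) \<inter> S'.sg (f u) (f b)) = \<phi>' g ` {f u}"
    unfolding opens_def i using equiv_act[OF f_equivariant g] V S'.act_seg_image[OF g] X by simp
  also have "\<dots> \<longleftrightarrow> opens u a b"
    unfolding opens_def using \<open>inj_on (\<phi>' g) X'\<close> S'.seg_subset X
    by (intro inj_on_image_eq_iff) auto
  finally show ?thesis .
qed

text \<open>Some pair of lifts of the turn is not folded. Translate it so that the first lift
  becomes the standard one of the reverse of \<open>e\<close>; the second then differs from the
  standard lift of \<open>e'\<close> by an element \<open>h\<close> of the vertex group.\<close>

lemma turn_lift:
  assumes e: "e \<in> D" "e' \<in> D" and T: "T e e'"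
  shows "ori e' = ori (rev_e e)"
    "\<exists>h\<in>stabilizer F \<phi> (ori (rev_e e)). opens (ori (rev_e e)) (tip (rev_e e)) (\<phi> h (tip e'))"
proof -
  have ini: "fst ` e' = snd ` e" and "\<not> N (rev_e e) e'" using T unfolding T_def by auto
  then show o: "ori e' = ori (rev_e e)" unfolding ori_def by (simp add: image_image)
  obtain v w w' where v: "(v, w) \<in> rev_e e" "(v, w') \<in> e'" "opens v w w'"
    using \<open>\<not> N (rev_e e) e'\<close> unfolding N_def opens_def by blast
  have re: "rev_e e \<in> QE" "e' \<in> QE" using e D_QE rev_QE by auto
  let ?u = "ori (rev_e e)"
  obtain k where k: "k \<in> FF" "v = \<phi> k ?u" "w = \<phi> k (tip (rev_e e))"
    using QE_transitive[OF re(1) lift_edge(2)[OF re(1)] v(1)] by blast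
  obtain m where m: "m \<in> FF" "v = \<phi> m ?u" "w' = \<phi> m (tip e')"
    using QE_transitive[OF re(2) lift_edge(2)[OF re(2)] v(2)] o by auto
  define h where "h = inv\<^bsub>F\<^esub> k \<otimes>\<^bsub>F\<^esub> m"
  have hF: "h \<in> FF" unfolding h_def using k m by simp
  note uX = ori_X[OF re(1)] and tX = lift_edge(4)[OF re(2)]
  have "\<phi> h ?u = \<phi> (inv\<^bsub>F\<^esub> k) (\<phi> k ?u)"
    unfolding h_def using S.act_mult[OF _ m(1) uX] k m by simp
  then have "\<phi> h ?u = ?u" using S.act_inv[OF k(1) uX] by simp
  then have hs: "h \<in> stabilizer F \<phi> ?u" unfolding stabilizer_def using hF by simp
  have "\<phi> k (\<phi> h (tip e')) = \<phi> (k \<otimes>\<^bsub>F\<^esub> h) (tip e')" using S.act_mult[OF k(1) hF tX] by simp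
  also have "k \<otimes>\<^bsub>F\<^esub> h = m" unfolding h_def using k m by (simp add: S.F.m_assoc[symmetric])
  finally have "w' = \<phi> k (\<phi> h (tip e'))" using m by simp
  then have "opens ?u (tip (rev_e e)) (\<phi> h (tip e'))"
    using v(3) opens_act[OF k(1) ori_V[OF re(1)] lift_edge(3)[OF re(1)] S.act_V[OF hF lift_edge(3)[OF re(2)]]]
      k by simp
  then show "\<exists>h\<in>stabilizer F \<phi> ?u. opens ?u (tip (rev_e e)) (\<phi> h (tip e'))" using hs by blast
qed

definition H where
  "H e e' = (SOME h. h \<in> stabilizer F \<phi> (ori (rev_e e)) \<and>
     opens (ori (rev_e e)) (tip (rev_e e)) (\<phi> h (tip e')))"

lemma H:
  assumes "e \<in> D" "e' \<in> D" "T e e'"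
  shows "H e e' \<in> stabilizer F \<phi> (ori (rev_e e))" "H e e' \<in> FF"
    "\<phi> (H e e') (ori (rev_e e)) = ori (rev_e e)"
    "opens (ori (rev_e e)) (tip (rev_e e)) (\<phi> (H e e') (tip e'))"
proof -
  have "\<exists>h. h \<in> stabilizer F \<phi> (ori (rev_e e)) \<and>
     opens (ori (rev_e e)) (tip (rev_e e)) (\<phi> h (tip e'))" using turn_lift(2)[OF assms] by blast
  from someI_ex[OF this]
  show "H e e' \<in> stabilizer F \<phi> (ori (rev_e e))"
    "opens (ori (rev_e e)) (tip (rev_e e)) (\<phi> (H e e') (tip e'))" unfolding H_def by auto
  then show "H e e' \<in> FF" "\<phi> (H e e') (ori (rev_e e)) = ori (rev_e e)"
    unfolding stabilizer_def by auto
qed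

lemma not_opens_same:
  assumes "(u, a) \<in> \<Delta> f"
  shows "\<not> opens u a a"
proof
  note X = \<Delta>_X'[OF assms]
  assume "opens u a a"
  then have "S'.sg (f u) (f a) = {f u}" unfolding opens_def by simp
  then show False using X(3) S'.seg_ends(2)[OF X(1,2)] by simp
qed

text \<open>If the tip were fixed, the turn would be one of a tension edge with itself, and the
  image of such an edge is not a single point.\<close>

lemma H_moves:
  assumes e: "e \<in> D" and T: "T e (rev_e e)"
  shows "\<phi> (H e (rev_e e)) (tip (rev_e e)) \<noteq> tip (rev_e e)"
proof
  assume "\<phi> (H e (rev_e e)) (tip (rev_e e)) = tip (rev_e e)"
  moreover have re: "rev_e e \<in> D" using bar_D[OF e] by simp
  ultimately have "opens (ori (rev_e e)) (tip (rev_e e)) (tip (rev_e e))"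
    using H(4)[OF e re T] by simp
  moreover have "(ori (rev_e e), tip (rev_e e)) \<in> \<Delta> f"
    using D_\<Delta>[OF re] lift_edge(2)[OF D_QE[OF re]] by blast
  ultimately show False using not_opens_same by blast
qed

text \<open>Elements coming from the edge group fix the tip of the standard lift of the reverse of
  \<open>e\<close>, whereas \<open>H\<close> moves it. This is cyclic reducedness at a place of
  backtracking.\<close>

lemma H_not_edge_group:
  assumes e: "e \<in> D" and T: "T e (rev_e e)"
  shows "H e (rev_e e) \<notin> emb Q e ` carrier (egrp Q e)"
proof
  assume "H e (rev_e e) \<in> emb Q e ` carrier (egrp Q e)"
  then obtain x where x: "x \<in> stabilizer F \<phi> (fst (l e))"
    "H e (rev_e e) = inv\<^bsub>F\<^esub> (c e) \<otimes>\<^bsub>F\<^esub> x \<otimes>\<^bsub>F\<^esub> c e"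
    unfolding quotient_graph_of_groups_def by auto
  have xF: "x \<in> FF" "\<phi> x (fst (l e)) = fst (l e)" using x(1) unfolding stabilizer_def by auto
  note eQ = D_QE[OF e]
  note k = c_FF[OF eQ]
  have lX: "fst (l e) \<in> S.X" using S.edgeD(3)[OF l_Ed[OF eQ]] .
  have tX: "tip (rev_e e) \<in> S.X" using lift_edge(4)[OF rev_QE[OF eQ]] .
  have t: "tip (rev_e e) = \<phi> (inv\<^bsub>F\<^esub> (c e)) (fst (l e))"
    unfolding tip_def rev_rev l_rev[OF eQ] by simp
  then have ct: "\<phi> (c e) (tip (rev_e e)) = fst (l e)" using S.act_inv'[OF k lX] by simp
  have "\<phi> (H e (rev_e e)) (tip (rev_e e)) = \<phi> (inv\<^bsub>F\<^esub> (c e)) (\<phi> x (\<phi> (c e) (tip (rev_e e))))"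
    unfolding x(2) using S.act_mult[OF _ k tX] S.act_mult[OF _ xF(1) S.act_X[OF k tX]] k xF by simp
  also have "\<dots> = tip (rev_e e)" unfolding ct xF(2) by (rule t[symmetric])
  finally show False using H_moves[OF e T] by simp
qed

text \<open>The element chosen by \<open>H\<close> moves a tip, so it is a nontrivial element of the
  vertex group.\<close>

lemma turn_back_non_free:
  assumes e: "e \<in> D" and T: "T e (rev_e e)"
  shows "non_free Q (ter Q e)"
proof -
  have re: "rev_e e \<in> D" using bar_D[OF e] by simp
  have "\<phi> \<one>\<^bsub>F\<^esub> (tip (rev_e e)) = tip (rev_e e)"
    using S.act_one lift_edge(4)[OF D_QE[OF re]] by blast
  then have "H e (rev_e e) \<noteq> \<one>\<^bsub>F\<^esub>" using H_moves[OF e T] by metis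
  moreover have "H e (rev_e e) \<in> stabilizer F \<phi> (s (snd ` e))" using H(1)[OF e re T] ori_rev by simp
  ultimately have "stabilizer F \<phi> (s (snd ` e)) \<noteq> {\<one>\<^bsub>F\<^esub>}" by blast
  moreover have "snd ` e \<in> orbits F V \<phi>"
    using verts_QE[OF D_QE[OF re]] by (simp add: image_image)
  ultimately show ?thesis unfolding non_free_def by simp
qed

end


section \<open>The line of a legal word\<close>

lemma sorted_wrt_map_upt:
  assumes "\<And>i j. i < j \<Longrightarrow> j < n \<Longrightarrow> P (h i) (h j)"
  shows "sorted_wrt P (map h [0..<n])"
  unfolding sorted_wrt_map
  by (rule sorted_wrt_mono_rel[OF _ sorted_wrt_upt[of 0 n]]) (use assms in auto)

section \<open>Position of the points of a geodesic chain\<close>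

context rtree
begin

lemma chain_between:
  assumes X: "\<And>i. x i \<in> X" and ne: "\<And>i. x i \<noteq> x (Suc i)"
    and turn: "\<And>i. sg (x (Suc i)) (x i) \<inter> sg (x (Suc i)) (x (Suc (Suc i))) = {x (Suc i)}"
  shows "sg (x 0) (x (Suc n)) \<subseteq> (\<Union>i\<le>n. sg (x i) (x (Suc i)))"
    and "i < j \<Longrightarrow> d (x 0) (x i) < d (x 0) (x j)"
    and "i \<le> n \<Longrightarrow> x i \<in> sg (x 0) (x n)"
proof -
  note st = chain_step[of x, OF assms] and geo = chain_geodesic[of x, OF assms]
  show "sg (x 0) (x (Suc n)) \<subseteq> (\<Union>i\<le>n. sg (x i) (x (Suc i)))"
  proof (induction n)
    case (Suc n)
    have "sg (x 0) (x (Suc (Suc n))) = sg (x 0) (x (Suc n)) \<union> sg (x (Suc n)) (x (Suc (Suc n)))"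
      using seg_split[OF X X st] .
    then show ?case using Suc by (auto simp: atMost_Suc)
  qed simp
  have pos: "d (x i) (x (Suc i)) > 0" for i using d_pos[OF X X ne] .
  show "d (x 0) (x i) < d (x 0) (x j)" if "i < j" for i j
    using that
  proof (induction j)
    case (Suc j)
    have "d (x 0) (x j) < d (x 0) (x (Suc j))" using geo[of j] geo[of "Suc j"] pos[of j] by simp
    then show ?case using Suc by (cases "i = j") auto
  qed simp
  show "x i \<in> sg (x 0) (x n)" if "i \<le> n" for i n
    using that
  proof (induction n)
    case 0
    then show ?case using X by simp
  next
    case (Suc n)
    show ?case
    proof (cases "i = Suc n")
      case True
      then show ?thesis using X by simp
    next
      case False
      then have "x i \<in> sg (x 0) (x n)" using Suc by simp
      moreover have "sg (x 0) (x n) \<subseteq> sg (x 0) (x (Suc n))"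
        using seg_mono[OF X X _ st] X by simp
      ultimately show ?thesis by blast
    qed
  qed
qed

end

section \<open>The periodic line and its translation lengths\<close>

context lifted_pair
begin

context
  fixes w assumes w: "legal w"
begin

definition K where "K = length w"
text \<open>The cyclic word is unrolled to a periodic infinite one, so that the turn from the last
  letter to the first is treated like any other.\<close>

definition ew where "ew n = w ! (n mod K)"

lemma K_pos: "K > 0" using w unfolding legal_def K_def by simp

lemma ew_D: "ew n \<in> D"
  using w K_pos unfolding legal_def ew_def K_def by (meson mod_less_divisor nth_mem subsetD)

lemma ew_QE: "ew n \<in> QE" using ew_D D_QE by blast

lemma ew_T: "T (ew n) (ew (Suc n))"
proof (cases "Suc (n mod K) = K")
  case True
  have ne: "w \<noteq> []" using w unfolding legal_def by simp
  have "n mod K = length w - 1" using True unfolding K_def by simp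
  then have "ew n = last w" unfolding ew_def using last_conv_nth[OF ne] by simp
  moreover have "Suc n mod K = 0" using True by (simp add: mod_Suc)
  then have "ew (Suc n) = hd w" unfolding ew_def using hd_conv_nth[OF ne] by simp
  ultimately show ?thesis using w unfolding legal_def by simp
next
  case False
  then have "ew (Suc n) = w ! Suc (n mod K)" unfolding ew_def by (simp add: mod_Suc)
  moreover have "Suc (n mod K) < K" using False K_pos by (meson Suc_lessI mod_less_divisor)
  ultimately show ?thesis
    using w successively_nth[of T w "n mod K"] unfolding legal_def ew_def K_def by simp
qed

lemma ew_per: "ew (n + K) = ew n" unfolding ew_def by simp

definition hh where "hh n = H (ew n) (ew (Suc n))"

lemmas hh = H[OF ew_D ew_D ew_T, folded hh_def]

text \<open>Partial products of the Bass--Serre word with the chosen vertex group elements;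
  \<open>elt K\<close> is the element translating along the line.\<close>

definition elt where "elt = rec_nat \<one>\<^bsub>F\<^esub> (\<lambda>n a. a \<otimes>\<^bsub>F\<^esub> ee (ew n) \<otimes>\<^bsub>F\<^esub> hh n)"

lemma elt_simps: "elt 0 = \<one>\<^bsub>F\<^esub>" "elt (Suc n) = elt n \<otimes>\<^bsub>F\<^esub> ee (ew n) \<otimes>\<^bsub>F\<^esub> hh n"
  unfolding elt_def by simp_all

lemma elt_FF: "elt n \<in> FF"
  by (induction n) (simp_all add: elt_simps ee_FF[OF ew_QE] hh(2))

lemma elt_per: "elt (n + K) = elt K \<otimes>\<^bsub>F\<^esub> elt n"
proof (induction n)
  case 0
  then show ?case using elt_FF by (simp add: elt_simps)
next
  case (Suc n)
  have "hh (n + K) = hh n" unfolding hh_def using ew_per[of n] ew_per[of "Suc n"] by simp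
  then show ?case
    using Suc ew_per[of n] elt_FF ee_FF[OF ew_QE] hh(2) by (simp add: elt_simps S.F.m_assoc)
qed

definition pt where "pt n = \<phi> (elt n) (ori (ew n))"

lemma pt_V: "pt n \<in> V" unfolding pt_def using S.act_V elt_FF ori_V ew_QE by simp

lemma pt_X: "pt n \<in> S.X" using pt_V S.V_X by blast

lemma pt_per: "pt (n + K) = \<phi> (elt K) (pt n)"
  unfolding pt_def elt_per ew_per using S.act_mult elt_FF ori_X ew_QE by simp

text \<open>The first form shows the turn at \<open>pt (Suc n)\<close> as a translate of the
  position in which \<open>H\<close> was chosen. The second shows that the edge leaving
  \<open>pt n\<close> is a translate of a standard lift.\<close>

lemma pt_Suc: "pt (Suc n) = \<phi> (elt n \<otimes>\<^bsub>F\<^esub> ee (ew n)) (ori (rev_e (ew n)))"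
  "pt (Suc n) = \<phi> (elt n) (tip (ew n))"
proof -
  note e = ee_FF[OF ew_QE] and r = rev_QE[OF ew_QE]
  have "ori (ew (Suc n)) = ori (rev_e (ew n))" using turn_lift(1)[OF ew_D ew_D ew_T] .
  then show 1: "pt (Suc n) = \<phi> (elt n \<otimes>\<^bsub>F\<^esub> ee (ew n)) (ori (rev_e (ew n)))"
    unfolding pt_def elt_simps
    using S.act_mult[OF S.F.m_closed[OF elt_FF e] hh(2) ori_X[OF r]] hh(3) by simp
  show "pt (Suc n) = \<phi> (elt n) (tip (ew n))"
    unfolding 1 using S.act_mult[OF elt_FF e ori_X[OF r]] ee_tip(1)[OF ew_QE] by simp
qed

lemma pt_back: "pt n = \<phi> (elt n \<otimes>\<^bsub>F\<^esub> ee (ew n)) (tip (rev_e (ew n)))"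
  using S.act_mult[OF elt_FF ee_FF[OF ew_QE] lift_edge(4)[OF rev_QE[OF ew_QE]]] ee_tip(2)[OF ew_QE]
  unfolding pt_def by simp

lemma pt_ahead: "pt (Suc (Suc n)) = \<phi> (elt n \<otimes>\<^bsub>F\<^esub> ee (ew n)) (\<phi> (hh n) (tip (ew (Suc n))))"
  unfolding pt_Suc(2) elt_simps
  using S.act_mult[OF S.F.m_closed[OF elt_FF ee_FF[OF ew_QE]] hh(2) lift_edge(4)[OF ew_QE]] by simp

lemma pt_\<Delta>: "(pt n, pt (Suc n)) \<in> \<Delta> f"
  unfolding pt_Suc(2) unfolding pt_def
  by (rule \<Delta>_act[OF f_equivariant elt_FF D_\<Delta>[OF ew_D lift_edge(2)[OF ew_QE]]])

lemma pt_opens: "opens (pt (Suc n)) (pt n) (pt (Suc (Suc n)))"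
proof -
  have "opens (\<phi> (elt n \<otimes>\<^bsub>F\<^esub> ee (ew n)) (ori (rev_e (ew n))))
      (\<phi> (elt n \<otimes>\<^bsub>F\<^esub> ee (ew n)) (tip (rev_e (ew n))))
      (\<phi> (elt n \<otimes>\<^bsub>F\<^esub> ee (ew n)) (\<phi> (hh n) (tip (ew (Suc n)))))"
    using opens_act[OF S.F.m_closed[OF elt_FF ee_FF[OF ew_QE]] ori_V[OF rev_QE[OF ew_QE]]
        lift_edge(3)[OF rev_QE[OF ew_QE]] S.act_V[OF hh(2) lift_edge(3)[OF ew_QE]]] hh(4) by blast
  then show ?thesis unfolding pt_Suc(1)[symmetric] pt_back[symmetric] pt_ahead[symmetric] .
qed

lemma pt_Ed: "(pt n, pt (Suc n)) \<in> Ed" using pt_\<Delta> \<Delta>_Ed by blast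

lemma pt_ne: "pt n \<noteq> pt (Suc n)" using S.edgeD(5)[OF pt_Ed] .

text \<open>If the line turned back on itself in the source, the turn would be one of an edge with
  itself, which is never open in the target. So legality in the target yields a geodesic in the
  source as well.\<close>

lemma pt_turn: "S.sg (pt (Suc n)) (pt n) \<inter> S.sg (pt (Suc n)) (pt (Suc (Suc n))) = {pt (Suc n)}"
proof (rule S.two_edges_meet[OF S.edge_sym[OF pt_Ed] pt_Ed])
  show "pt n \<noteq> pt (Suc (Suc n))"
    using pt_opens[of n] not_opens_same[OF \<Delta>_sym[OF pt_\<Delta>]] by metis
qed

lemma fpt_X: "f (pt n) \<in> X'" using f_vert pt_V by blast

lemma fpt_turn: "S'.sg (f (pt (Suc n))) (f (pt n)) \<inter> S'.sg (f (pt (Suc n))) (f (pt (Suc (Suc n))))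
    = {f (pt (Suc n))}"
  using pt_opens unfolding opens_def .

lemma length_source: "translation_length M \<phi> (elt K) = d (pt 0) (pt K)"
  using S.periodic_geodesic_translation[OF elt_FF pt_X K_pos pt_per
      S.chain_geodesic[of pt, OF pt_X pt_ne pt_turn]] .

text \<open>The images of the vertices form a geodesic translated by the same element, and each of
  its steps is stretched by exactly \<open>\<Lambda>\<close>.\<close>

lemma length_target: "translation_length M' \<phi>' (elt K) = \<Lambda> * d (pt 0) (pt K)"
proof -
  have ne: "f (pt n) \<noteq> f (pt (Suc n))" for n using \<Delta>_X'(3)[OF pt_\<Delta>] .
  note geo = S'.chain_geodesic[of "\<lambda>n. f (pt n)", OF fpt_X ne fpt_turn]
  have per: "f (pt (n + K)) = \<phi>' (elt K) (f (pt n))" for n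
    unfolding pt_per using equiv_act[OF f_equivariant elt_FF pt_V] .
  have "translation_length M' \<phi>' (elt K) = d' (f (pt 0)) (f (pt K))"
    using S'.periodic_geodesic_translation[of "elt K" "\<lambda>n. f (pt n)", OF elt_FF fpt_X K_pos per geo] .
  also have "\<dots> = (\<Sum>i<K. \<Lambda> * d (pt i) (pt (Suc i)))" unfolding geo using \<Delta>_eq[OF pt_\<Delta>] by simp
  also have "\<dots> = \<Lambda> * d (pt 0) (pt K)"
    using S.chain_geodesic[of pt, OF pt_X pt_ne pt_turn, of K] by (simp add: sum_distrib_left)
  finally show ?thesis .
qed

lemma pt_K: "pt K = \<phi> (elt K) (pt 0)" using pt_per[of 0] by simp

lemma length_pos: "translation_length M \<phi> (elt K) > 0"
  using S.chain_between(2)[of pt 0 K, OF pt_X pt_ne pt_turn K_pos] pt_X unfolding length_source by simp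

lemma elt_witness: "witness F M \<phi> M' \<phi>' (elt K)"
proof -
  have "Lip F M \<phi> M' \<phi>' = \<Lambda>"
    by (rule Lip_eqI[OF elt_FF pt_X[of 0] _ length_pos])
      (simp_all add: length_source length_target pt_K[symmetric])
  then show ?thesis
    unfolding witness_def hyperbolic_def using length_pos elt_FF
    by (simp add: length_target length_source)
qed

section \<open>The cyclic path read off the line\<close>

definition gog_path where "gog_path = map (\<lambda>i. (ew i, hh i)) [0..<K]"

lemma gog_path_fst: "map fst gog_path = w"
  unfolding gog_path_def by (intro nth_equalityI) (auto simp: K_def ew_def)

lemma gog_path_nth: "n < K \<Longrightarrow> gog_path ! n = (ew n, hh n)"
  and gog_path_length: "length gog_path = K"
  unfolding gog_path_def by auto

text \<open>The starting index \<open>j\<close> is arbitrary for the sake of the induction: after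
  \<open>j\<close> steps the prefix carried along by \<open>path_lift\<close> is
  \<open>elt j\<close>.\<close>

lemma path_lift_upt:
  "path_lift F \<phi> l c (elt j) (map (\<lambda>i. (ew i, hh i)) [j..<j + m]) = map (\<lambda>i. (pt i, pt (Suc i))) [j..<j + m]"
proof (induction m arbitrary: j)
  case (Suc m)
  let ?b = "elt j \<otimes>\<^bsub>F\<^esub> inv\<^bsub>F\<^esub> (c (rev_e (ew j)))"
  note k = c_FF[OF rev_QE[OF ew_QE]]
  note E = S.edgeD[OF l_Ed[OF ew_QE]]
  have "\<phi> ?b (fst (l (ew j))) = pt j"
    unfolding pt_def lift_edge(1)[OF ew_QE] using S.act_mult[OF elt_FF S.F.inv_closed[OF k] E(3)] .
  moreover have "\<phi> ?b (snd (l (ew j))) = pt (Suc j)"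
    unfolding pt_Suc(2) tip_def using S.act_mult[OF elt_FF S.F.inv_closed[OF k] E(4)] .
  ultimately have 1: "map_prod (\<phi> ?b) (\<phi> ?b) (l (ew j)) = (pt j, pt (Suc j))"
    by (cases "l (ew j)") simp
  have "[j..<j + Suc m] = j # [Suc j..<Suc j + m]" by (simp add: upt_conv_Cons)
  then show ?case using 1 Suc[of "Suc j"] by (simp add: Let_def elt_simps(2))
qed simp

lemma path_elem_upt:
  "path_elem F c (map (\<lambda>i. (ew i, hh i)) [j..<j + m]) \<in> FF \<and>
   elt j \<otimes>\<^bsub>F\<^esub> path_elem F c (map (\<lambda>i. (ew i, hh i)) [j..<j + m]) = elt (j + m)"
proof (induction m arbitrary: j)
  case 0
  then show ?case using elt_FF by simp
next
  case (Suc m)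
  define r where "r = path_elem F c (map (\<lambda>i. (ew i, hh i)) [Suc j..<Suc j + m])"
  have r: "r \<in> FF" "elt (Suc j) \<otimes>\<^bsub>F\<^esub> r = elt (Suc j + m)" using Suc[of "Suc j"] unfolding r_def by auto
  have "[j..<j + Suc m] = j # [Suc j..<Suc j + m]" by (simp add: upt_conv_Cons)
  then have p: "path_elem F c (map (\<lambda>i. (ew i, hh i)) [j..<j + Suc m]) = ee (ew j) \<otimes>\<^bsub>F\<^esub> hh j \<otimes>\<^bsub>F\<^esub> r"
    unfolding r_def by (simp only: list.map path_elem.simps)
  have "elt j \<otimes>\<^bsub>F\<^esub> (ee (ew j) \<otimes>\<^bsub>F\<^esub> hh j \<otimes>\<^bsub>F\<^esub> r) = elt (Suc j) \<otimes>\<^bsub>F\<^esub> r"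
    using elt_FF[of j] ee_FF[OF ew_QE, of j] hh(2)[of j] r(1) by (simp add: elt_simps(2) S.F.m_assoc)
  then show ?case unfolding p using ee_FF[OF ew_QE, of j] hh(2)[of j] r by simp
qed

lemma cyclic_gog_path: "cyclic_path Q gog_path"
  unfolding cyclic_path_def
proof (intro conjI allI impI ballI)
  show "gog_path \<noteq> []" using gog_path_length K_pos by auto
  fix x assume "x \<in> set gog_path"
  then obtain i where "x = (ew i, hh i)" unfolding gog_path_def by auto
  then show "case x of (e, g) \<Rightarrow> e \<in> edges Q \<and> g \<in> carrier (vgrp Q (ter Q e))"
    using ew_QE hh(1) ori_rev by simp
next
  fix i assume "i < length gog_path"
  then have i: "i < K" using gog_path_length by simp
  have "ew (Suc i mod K) = ew (Suc i)" unfolding ew_def by simp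
  then have "fst (gog_path ! (Suc i mod K)) = ew (Suc i)" using gog_path_nth K_pos by simp
  moreover have "ter Q (ew i) = ini Q (ew (Suc i))" using ew_T unfolding T_def by blast
  ultimately show "ter Q (fst (gog_path ! i)) = ini Q (fst (gog_path ! (Suc i mod length gog_path)))"
    using gog_path_nth[OF i] gog_path_length by simp
qed

lemma reduced_gog_path: "cyclically_reduced Q gog_path"
  unfolding cyclically_reduced_def
proof (intro allI impI)
  fix i assume "i < length gog_path"
    and turn: "fst (gog_path ! (Suc i mod length gog_path)) = bar Q (fst (gog_path ! i))"
  then have i: "i < K" using gog_path_length by simp
  have "ew (Suc i mod K) = ew (Suc i)" unfolding ew_def by simp
  then have "fst (gog_path ! (Suc i mod K)) = ew (Suc i)" using gog_path_nth K_pos by simp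
  then have r: "ew (Suc i) = rev_e (ew i)" using turn gog_path_nth[OF i] gog_path_length by simp
  have "T (ew i) (rev_e (ew i))" using ew_T[of i] unfolding r .
  then have "hh i \<notin> emb Q (ew i) ` carrier (egrp Q (ew i))"
    unfolding hh_def r by (rule H_not_edge_group[OF ew_D])
  then show "snd (gog_path ! i) \<notin> emb Q (fst (gog_path ! i)) ` carrier (egrp Q (fst (gog_path ! i)))"
    using gog_path_nth[OF i] by simp
qed

lemma pt_vertices: "set (map pt [0..<Suc K]) = S.sg (pt 0) (pt K) \<inter> V"
proof
  show "set (map pt [0..<Suc K]) \<subseteq> S.sg (pt 0) (pt K) \<inter> V"
    using S.chain_between(3)[of pt _ K, OF pt_X pt_ne pt_turn] pt_V by auto
  show "S.sg (pt 0) (pt K) \<inter> V \<subseteq> set (map pt [0..<Suc K])"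
  proof
    fix v assume v: "v \<in> S.sg (pt 0) (pt K) \<inter> V"
    obtain n where n: "K = Suc n" using K_pos by (metis gr0_implies_Suc)
    then have "v \<in> (\<Union>i\<le>n. S.sg (pt i) (pt (Suc i)))"
      using S.chain_between(1)[of pt n, OF pt_X pt_ne pt_turn] v by auto
    then obtain i where i: "i \<le> n" "v \<in> S.sg (pt i) (pt (Suc i))" by blast
    then have "v = pt i \<or> v = pt (Suc i)" using S.edgeD(6)[OF pt_Ed] v by blast
    then obtain m where "m < Suc K" "v = pt m"
      using i(1) n by (metis Suc_le_mono le_SucI less_Suc_eq_le)
    then show "v \<in> set (map pt [0..<Suc K])" unfolding set_map set_upt by auto
  qed
qed

lemma projects: "projects_axis F M \<phi> V s l c (elt K) gog_path"
proof -
  \<comment> \<open>The line starts at the standard lift of its first vertex, so the identity serves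
    as the translating element \<open>a\<close>.\<close>
  have es: "path_lift F \<phi> l c \<one>\<^bsub>F\<^esub> gog_path = map (\<lambda>i. (pt i, pt (Suc i))) [0..<K]"
    using path_lift_upt[of 0 K] unfolding gog_path_def by (simp add: elt_simps)
  have hd: "fst (hd (path_lift F \<phi> l c \<one>\<^bsub>F\<^esub> gog_path)) = pt 0"
    unfolding es using K_pos by (simp add: hd_map)
  have xs: "map fst (path_lift F \<phi> l c \<one>\<^bsub>F\<^esub> gog_path) @ [\<phi> (elt K) (pt 0)] = map pt [0..<Suc K]"
    unfolding es using pt_K by (simp add: o_def)
  have pe: "\<one>\<^bsub>F\<^esub> \<otimes>\<^bsub>F\<^esub> path_elem F c gog_path = elt K \<otimes>\<^bsub>F\<^esub> \<one>\<^bsub>F\<^esub>"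
    using path_elem_upt[of 0 K] elt_FF unfolding gog_path_def by (simp add: elt_simps)
  have "pt 0 \<in> axis M \<phi> (elt K)" unfolding axis_def using pt_X length_source pt_K by simp
  moreover have "sorted_wrt (\<lambda>y z. d (pt 0) y < d (pt 0) z) (map pt [0..<Suc K])"
    by (rule sorted_wrt_map_upt) (rule S.chain_between(2)[of pt, OF pt_X pt_ne pt_turn])
  ultimately show ?thesis
    unfolding projects_axis_def Let_def
    using cyclic_gog_path reduced_gog_path pe pt_vertices pt_K
    by (intro conjI bexI[of _ "\<one>\<^bsub>F\<^esub>"]) (simp_all only: hd xs S.F.one_closed)
qed

lemma gog_path_vgrp: "x \<in> set gog_path \<Longrightarrow> snd x \<in> carrier (vgrp Q (ter Q (fst x)))"
  using cyclic_gog_path unfolding cyclic_path_def by (auto simp: case_prod_beta)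

end

theorem candidate_witness:
  "\<exists>g p. witness F M \<phi> M' \<phi>' g \<and> projects_axis F M \<phi> V s l c g p \<and> candidate_form Q p"
proof -
  obtain w where w: "legal w"
    and form: "simple_loop Q w \<or>
     (\<exists>\<alpha> \<beta>. w = \<alpha> @ \<beta> \<and>
        simple_loop Q \<alpha> \<and> simple_loop Q \<beta> \<and> start Q \<alpha> = start Q \<beta> \<and>
        path_verts Q \<alpha> \<inter> path_verts Q \<beta> = {start Q \<alpha>} \<and> set \<alpha> \<inter> (set \<beta> \<union> bar Q ` set \<beta>) = {}) \<or>
     (\<exists>\<alpha> \<sigma> \<beta>. w = \<alpha> @ \<sigma> @ \<beta> @ rev_path Q \<sigma> \<and>
        simple_loop Q \<alpha> \<and> simple_loop Q \<beta> \<and> segment Q \<sigma> \<and>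
        start Q \<sigma> = start Q \<alpha> \<and> finish Q \<sigma> = start Q \<beta> \<and> path_verts Q \<alpha> \<inter> path_verts Q \<beta> = {} \<and>
        path_verts Q \<sigma> \<inter> path_verts Q \<alpha> = {start Q \<sigma>} \<and>
        path_verts Q \<sigma> \<inter> path_verts Q \<beta> = {finish Q \<sigma>}) \<or>
     (\<exists>\<alpha> \<sigma>. w = \<alpha> @ \<sigma> @ rev_path Q \<sigma> \<and>
        simple_loop Q \<alpha> \<and> segment Q \<sigma> \<and> start Q \<sigma> = start Q \<alpha> \<and>
        path_verts Q \<sigma> \<inter> path_verts Q \<alpha> = {start Q \<sigma>}) \<or>
     (\<exists>\<sigma>. w = \<sigma> @ rev_path Q \<sigma> \<and> segment Q \<sigma>)"
    (is "_ \<or> ?fig \<or> ?barb \<or> ?sing \<or> ?doub")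
    using legal_form[OF D_nonempty] by (elim exE conjE) (rule that)
  let ?p = "gog_path w"
  note fst_p = gog_path_fst[OF w]
  have sD: "set w \<subseteq> D" and sT: "successively T w" "T (last w) (hd w)" using w unfolding legal_def by auto
  have seg_ne: "\<sigma> \<noteq> []" if "segment Q \<sigma>" for \<sigma> using that unfolding segment_def edge_path_def by simp
  have vg: "snd (last r) \<in> carrier (vgrp Q (ter Q (last (map fst r))))"
    if "?p = q @ r @ t" "r \<noteq> []" for q r t
    using gog_path_vgrp[OF w, of "last r"] that by (simp add: last_map)
  have "loop_form Q ?p \<or> figure_eight_form Q ?p \<or> barbell_form Q ?p \<or>
    singly_degenerate_barbell_form Q ?p \<or> doubly_degenerate_barbell_form Q ?p"
    using form
  proof (elim disjE)
    assume "simple_loop Q w"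
    then have "loop_form Q ?p" unfolding loop_form_def fst_p .
    then show ?thesis by (rule disjI1)
  next
    assume ?fig
    then have "figure_eight_form Q ?p" unfolding figure_eight_form_def fst_p .
    then show ?thesis by (rule disjI2[OF disjI1])
  next
    assume ?barb
    then have "barbell_form Q ?p" unfolding barbell_form_def fst_p .
    then show ?thesis by (rule disjI2[OF disjI2[OF disjI1]])
  next
    assume ?sing
    then obtain \<alpha> \<sigma> where a: "w = \<alpha> @ \<sigma> @ rev_path Q \<sigma>" "simple_loop Q \<alpha>" "segment Q \<sigma>"
      "start Q \<sigma> = start Q \<alpha>" "path_verts Q \<sigma> \<inter> path_verts Q \<alpha> = {start Q \<sigma>}" by blast
    have "map fst ?p = \<alpha> @ \<sigma> @ rev_path Q \<sigma>" using fst_p a by simp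
    then obtain q r t where p: "?p = q @ r @ t" "map fst q = \<alpha>" "map fst r = \<sigma>" "map fst t = rev_path Q \<sigma>"
      by (auto simp: map_eq_append_conv append_eq_map_conv)
    note ne = seg_ne[OF a(3)]
    \<comment> \<open>The segment is followed by its reverse, so the word turns back at the far end;
      such a turn is legal only if the vertex group is nontrivial.\<close>
    have "successively T (\<sigma> @ rev_path Q \<sigma>)" using sT(1) unfolding a(1) successively_append_iff[of T \<alpha>] by blast
    then have "T (last \<sigma>) (hd (rev_path Q \<sigma>))" using ne unfolding successively_append_iff rp_simps by blast
    then have "T (last \<sigma>) (rev_e (last \<sigma>))" using rp_hd[OF ne] by simp
    moreover have "last \<sigma> \<in> D" using sD a(1) ne by auto
    ultimately have nf: "non_free Q (finish Q \<sigma>)" unfolding finish_def using turn_back_non_free by blast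
    have "r \<noteq> []" using p ne by auto
    then have h: "snd (last r) \<in> carrier (vgrp Q (finish Q \<sigma>))" using vg[OF p(1)] p(3) unfolding finish_def by simp
    then have "singly_degenerate_barbell_form Q ?p"
      unfolding singly_degenerate_barbell_form_def
      by (intro exI[of _ \<alpha>] exI[of _ \<sigma>] exI[of _ q] exI[of _ r] exI[of _ t] exI[of _ "snd (last r)"]
          conjI p a(2-5) nf h refl)
    then show ?thesis by (rule disjI2[OF disjI2[OF disjI2[OF disjI1]]])
  next
    assume ?doub
    then obtain \<sigma> where a: "w = \<sigma> @ rev_path Q \<sigma>" "segment Q \<sigma>" by blast
    have "map fst ?p = \<sigma> @ rev_path Q \<sigma>" using fst_p a by simp
    then obtain r t where p: "?p = r @ t" "map fst r = \<sigma>" "map fst t = rev_path Q \<sigma>"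
      by (auto simp: map_eq_append_conv)
    note ne = seg_ne[OF a(2)]
    have sD': "last \<sigma> \<in> D" "hd \<sigma> \<in> D" using sD a(1) ne by auto
    have "T (last \<sigma>) (hd (rev_path Q \<sigma>))"
      using sT(1) ne unfolding a(1) successively_append_iff rp_simps by blast
    then have "T (last \<sigma>) (rev_e (last \<sigma>))" using rp_hd[OF ne] by simp
    then have nf: "non_free Q (finish Q \<sigma>)" unfolding finish_def using turn_back_non_free sD' by blast
    \<comment> \<open>The second place of backtracking is the turn from the last letter to the
      first.\<close>
    have "last w = rev_e (hd \<sigma>)" "hd w = hd \<sigma>" using a(1) ne rp_last[OF ne] by simp_all
    then have "T (rev_e (hd \<sigma>)) (rev_e (rev_e (hd \<sigma>)))" using sT(2) by (simp add: rev_rev)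
    moreover have "rev_e (hd \<sigma>) \<in> D" using bar_D[OF sD'(2)] by simp
    ultimately have "non_free Q (ter Q (rev_e (hd \<sigma>)))" using turn_back_non_free by blast
    moreover have tr: "ter Q (rev_e (hd \<sigma>)) = start Q \<sigma>" unfolding start_def by (simp add: image_image)
    ultimately have nf': "non_free Q (start Q \<sigma>)" by simp
    have "map fst r \<noteq> []" "map fst t \<noteq> []" unfolding p(2,3) rp_simps using ne by simp_all
    then have rt: "r \<noteq> []" "t \<noteq> []" by auto
    have h: "snd (last r) \<in> carrier (vgrp Q (finish Q \<sigma>))"
      using vg[of "[]" r t] p rt unfolding finish_def by simp
    have "last (map fst t) = rev_e (hd \<sigma>)" using p(3) rp_last[OF ne] by simp
    then have h': "snd (last t) \<in> carrier (vgrp Q (start Q \<sigma>))"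
      using vg[of r t "[]"] p rt tr by simp
    have "doubly_degenerate_barbell_form Q ?p"
      unfolding doubly_degenerate_barbell_form_def
      by (intro exI[of _ \<sigma>] exI[of _ r] exI[of _ t] exI[of _ "snd (last r)"] exI[of _ "snd (last t)"]
          conjI p a(2) nf nf' h h' refl)
    then show ?thesis by (rule disjI2[OF disjI2[OF disjI2[OF disjI2]]])
  qed
  \<comment> \<open>The rotation is by \<open>0\<close>, as \<open>legal_form\<close> delivers the
    word with the right starting point.\<close>
  then have "candidate_form Q ?p" unfolding candidate_form_def by (intro exI[of _ 0]) simp
  then show ?thesis using elt_witness[OF w] projects[OF w] by blast
qed

end


section \<open>Passage to the subdivided tree\<close>

lemma gtreeI:
  assumes "group F" "outer_space F M V \<phi>"
  shows "gtree M V F \<phi>"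
proof -
  have "real_tree M" "simplicial_structure M V" using assms(2) unfolding outer_space_def by auto
  then show ?thesis using assms
    by (intro gtree.intro stree.intro rtree.intro stree_axioms.intro gtree_axioms.intro)
qed

theorem theorem2:
  fixes F :: "'g monoid"
    and \<Gamma> :: "'p metric" and V :: "'p set" and \<phi> :: "'g \<Rightarrow> 'p \<Rightarrow> 'p"
    and \<Gamma>' :: "'q metric" and V' :: "'q set" and \<phi>' :: "'g \<Rightarrow> 'q \<Rightarrow> 'q"
    and s :: "'p set \<Rightarrow> 'p" and l :: "('p \<times> 'p) set \<Rightarrow> 'p \<times> 'p" and c :: "('p \<times> 'p) set \<Rightarrow> 'g"
  assumes "group F" and "finitely_generated_group F" and "virtually_nonabelian_free F"
    and "outer_space F \<Gamma> V \<phi>" and "outer_space F \<Gamma>' V' \<phi>'"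
    and "quotient_lifts F \<Gamma> \<phi> (subdivision F \<Gamma> \<phi> V) s l c"
  shows "\<exists>g p. witness F \<Gamma> \<phi> \<Gamma>' \<phi>' g \<and>
           projects_axis F \<Gamma> \<phi> (subdivision F \<Gamma> \<phi> V) s l c g p \<and>
           candidate_form (quotient_graph_of_groups F \<Gamma> \<phi> (subdivision F \<Gamma> \<phi> V) s l c) p"
proof -
  let ?W = "subdivision F \<Gamma> \<phi> V"
  \<comment> \<open>Only the source is subdivided, as it is the source whose quotient graph of
    groups is formed.\<close>
  have "outer_space F \<Gamma> ?W \<phi>" using gtree.outer_space_subdivision gtreeI assms(1,4) by blast
  then have "gtree \<Gamma> ?W F \<phi>" "gtree \<Gamma>' V' F \<phi>'" using gtreeI assms(1,5) by blast+
  moreover have "infinite (carrier F)" using infinite_virtually_nonabelian_free assms(1,3) by blast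
  ultimately interpret P: tree_pair \<Gamma> ?W F \<phi> \<Gamma>' V' \<phi>'
    using assms(2)
    by (intro tree_pair.intro fg_gtree.intro fg_gtree_axioms.intro tree_pair_axioms.intro)
  obtain f where "P.opt f" using P.opt_exists by blast
  then interpret lifted_pair \<Gamma> ?W F \<phi> \<Gamma>' V' \<phi>' f s l c
    using assms(6) P.tree_pair_axioms by (intro lifted_pair.intro lifted_pair_axioms.intro)
  show ?thesis by (rule candidate_witness)
qed


end
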